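(* Let $1<r<\infty$ and $\theta>0$. For $1\le p<\infty$ put $$\eta=p_0\theta_0,\qquad p_0=4(l_0+1)^5\Big(p+\big(\tfrac{r+1}{2}\big)'\Big),\qquad \theta_0=p\big((3\theta+n)p+(l_0+1)n\big),$$ where $s'=s/(s-1)$ denotes the conjugate exponent of $s$. (a) If $1\le p<\infty$ and $\omega\in A_p^{\rho,\theta}$, then there is a constant $C$ such that for every sequence $f=\{f_k\}_{k\ge1}$ of locally integrable functions on $\mathbb{R}^n$ and every $\alpha>0$, $$\omega\big(\{x\in\mathbb{R}^n:\ |M_{V,\eta}f(x)|_r>\alpha\}\big)\le C\,\alpha^{-p}\int_{\mathbb{R}^n}|f(x)|_r^p\,\omega(x)\,dx .$$ (b) If $1<p<\infty$ and $\omega\in A_p^{\rho,\theta}$, then there is a constant $C$ such that for every sequence $f=\{f_k\}_{k\ge1}$ of locally integrable functions on $\mathbb{R}^n$, $$\int_{\mathbb{R}^n}|M_{V,\eta}f(x)|_r^p\,\omega(x)\,dx\le C\int_{\mathbb{R}^n}|f(x)|_r^p\,\omega(x)\,dx .$$ Here $C$ depends on $r,p,\theta,l_0,C_0$ (and on the given weight $\omega$ and the dimension), but not on $f$ or $\alpha$.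
   Context: Let $n\ge3$. For $1<q<\infty$, a nonnegative function $V\in L^q_{\rm loc}(\mathbb{R}^n)$ belongs to $B_q$ if there is $C>0$ with $\left(\frac1{|B|}\int_{B}V^q\right)^{1/q}\le C\,\frac1{|B|}\int_{B}V$ for every ball $B=B(x,r)$. Standing assumption: $V\in B_{n/2}$ and $V\not\equiv0$. Define $\rho(x)=\frac1{m_V(x)}=\sup\{r>0:\ r^{2-n}\int_{B(x,r)}V(y)\,dy\le1\}$; then $0<\rho(x)<\infty$. The constants $l_0>0$, $C_0>1$ are fixed constants (known to exist) for which, for all $x,y\in\mathbb{R}^n$, $$\frac1{C_0}(1+|x-y|m_V(x))^{-l_0}\le\frac{m_V(x)}{m_V(y)}\le C_0(1+|x-y|m_V(x))^{l_0/(l_0+1)}.$$ For a ball $B=B(x_0,r)$ and $\theta\ge0$, $\Psi_\theta(B)=(1+r/\rho(x_0))^\theta$. The maximal operator is $M_{V,\theta}f(x)=\sup_{B\ni x}\frac1{\Psi_\theta(B)|B|}\int_B|f(y)|\,dy$, the supremum being over balls $B$ containing $x$. A weight is a positive locally integrable function; $\omega(E)=\int_E\omega$. For $1<p<\infty$, a weight $\omega$ is in $A_p^{\rho,\theta}$ if there is $C$ with $$\Big(\frac1{\Psi_\theta(B)|B|}\int_B\omega\Big)\Big(\frac1{\Psi_\theta(B)|B|}\int_B\omega^{-\frac1{p-1}}\Big)^{p-1}\le C\quad\text{for all balls }B;$$ $\omega\in A_1^{\rho,\theta}$ if $M_{V,\theta}\omega(x)\le C\omega(x)$ for a.e. $x$.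 For a sequence $f=\{f_k\}_{k\ge1}$: $|f(x)|_r=(\sum_k|f_k(x)|^r)^{1/r}$, and $|M_{V,\eta}f(x)|_r=(\sum_k|M_{V,\eta}f_k(x)|^r)^{1/r}$. *)

theory Defs
  imports "HOL-Analysis.Analysis"
begin

text \<open>Throughout, measurability and integrals refer to Lebesgue measure \<^const>\<open>lebesgue\<close>, balls are
  open balls of positive radius, and quantities that may be infinite (maximal functions,
  \<open>l\<^sup>r\<close>-norms, weighted integrals) take values in \<^typ>\<open>ennreal\<close>.\<close>

definition locally_integrable :: "('a::euclidean_space \<Rightarrow> 'b::euclidean_space) \<Rightarrow> bool" where
  "locally_integrable f \<longleftrightarrow> (\<forall>K. compact K \<longrightarrow> f absolutely_integrable_on K)"

text \<open>Power of an extended nonnegative real; only used for exponents \<open>a > 0\<close>, where \<open>\<infinity>\<^sup>a = \<infinity>\<close>.\<close>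

definition ennpowr :: "ennreal \<Rightarrow> real \<Rightarrow> ennreal" where
  "ennpowr x a = (if x = \<infinity> then \<infinity> else ennreal (enn2real x powr a))"

definition lr_norm :: "real \<Rightarrow> (nat \<Rightarrow> ennreal) \<Rightarrow> ennreal" where
  "lr_norm r a = ennpowr (\<Sum>k. ennpowr (a k) r) (1 / r)"

definition conj_exponent :: "real \<Rightarrow> real" where
  "conj_exponent s = s / (s - 1)"


definition reverse_Holder :: "real \<Rightarrow> (real^'n \<Rightarrow> real) \<Rightarrow> bool" where
  "reverse_Holder q V \<longleftrightarrow>
     1 < q \<and> (\<forall>x. 0 \<le> V x) \<and>
     V \<in> borel_measurable lebesgue \<and> locally_integrable (\<lambda>x. V x powr q) \<and>
     (\<exists>C>0. \<forall>x r. 0 < r \<longrightarrow>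
        (1 / measure lebesgue (ball x r) * (LINT y:ball x r|lebesgue. V y powr q)) powr (1 / q)
        \<le> C * (1 / measure lebesgue (ball x r) * (LINT y:ball x r|lebesgue. V y)))"

definition crit_radius :: "(real^'n \<Rightarrow> real) \<Rightarrow> real^'n \<Rightarrow> real" where
  "crit_radius V x =
     Sup {r. 0 < r \<and> r powr (2 - real CARD('n)) * (LINT y:ball x r|lebesgue. V y) \<le> 1}"

definition aux_m :: "(real^'n \<Rightarrow> real) \<Rightarrow> real^'n \<Rightarrow> real" where
  "aux_m V x = 1 / crit_radius V x"

definition slow_variation :: "(real^'n \<Rightarrow> real) \<Rightarrow> real \<Rightarrow> real \<Rightarrow> bool" where
  "slow_variation V l0 C0 \<longleftrightarrow>
     0 < l0 \<and> 1 < C0 \<and>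
     (\<forall>x y. 1 / C0 * (1 + norm (x - y) * aux_m V x) powr (- l0) \<le> aux_m V x / aux_m V y \<and>
            aux_m V x / aux_m V y \<le> C0 * (1 + norm (x - y) * aux_m V x) powr (l0 / (l0 + 1)))"

definition Psi :: "(real^'n \<Rightarrow> real) \<Rightarrow> real \<Rightarrow> real^'n \<Rightarrow> real \<Rightarrow> real" where
  "Psi V \<theta> x0 r = (1 + r / crit_radius V x0) powr \<theta>"

text \<open>\<open>(1 / (\<Psi>\<^sub>\<theta>(B) |B|)) \<integral>\<^sub>B g\<close> for \<open>B = B(x0, r)\<close> and \<open>g \<ge> 0\<close>.\<close>

definition Psi_avg ::
  "(real^'n \<Rightarrow> real) \<Rightarrow> real \<Rightarrow> real^'n \<Rightarrow> real \<Rightarrow> (real^'n \<Rightarrow> ennreal) \<Rightarrow> ennreal" where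
  "Psi_avg V \<theta> x0 r g =
     (\<integral>\<^sup>+y\<in>ball x0 r. g y \<partial>lebesgue) / ennreal (Psi V \<theta> x0 r * measure lebesgue (ball x0 r))"

definition max_op ::
  "(real^'n \<Rightarrow> real) \<Rightarrow> real \<Rightarrow> (real^'n \<Rightarrow> 'b::real_normed_vector) \<Rightarrow> real^'n \<Rightarrow> ennreal" where
  "max_op V \<theta> f x =
     (SUP (x0, r)\<in>{(x0, r). 0 < r \<and> x \<in> ball x0 r}. Psi_avg V \<theta> x0 r (\<lambda>y. ennreal (norm (f y))))"

definition weight :: "(real^'n \<Rightarrow> real) \<Rightarrow> bool" where
  "weight \<omega> \<longleftrightarrow> (\<forall>x. 0 < \<omega> x) \<and> locally_integrable \<omega>"

text \<open>The class \<open>A\<^sub>p\<close> adapted to \<open>\<rho>\<close>, for \<open>1 \<le> p < \<infinity>\<close>. For \<open>p > 1\<close> the averages are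
  extended-valued so that the condition fails when \<open>\<omega> powr (-1/(p-1))\<close> is not locally integrable.\<close>

definition Ap_rho :: "(real^'n \<Rightarrow> real) \<Rightarrow> real \<Rightarrow> real \<Rightarrow> (real^'n \<Rightarrow> real) \<Rightarrow> bool" where
  "Ap_rho V \<theta> p \<omega> \<longleftrightarrow>
     weight \<omega> \<and> 1 \<le> p \<and>
     (if p = 1
      then \<exists>C>0. AE x in lebesgue. max_op V \<theta> \<omega> x \<le> ennreal (C * \<omega> x)
      else \<exists>C>0. \<forall>x0 r. 0 < r \<longrightarrow>
             Psi_avg V \<theta> x0 r (\<lambda>y. ennreal (\<omega> y)) *
             ennpowr (Psi_avg V \<theta> x0 r (\<lambda>y. ennreal (\<omega> y powr (- 1 / (p - 1))))) (p - 1)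
             \<le> ennreal C)"

end

theory Submission
  imports Defs
begin

text \<open>
  Only the slow variation of the critical radius \<open>\<rho>\<close> matters. Balls \<open>B(x\<^sub>0, R)\<close> with \<open>R \<le> \<rho>(x\<^sub>0)\<close> lie in
  cubes of comparable size from finitely many shifted grids, on which \<open>\<omega>\<close> is an ordinary \<open>A\<^sub>p\<close> weight. For
  finite families of such cubes the \<open>l\<^sup>r\<close>-valued maximal function is dominated by
  \<open>(\<Sum>\<^sub>Q \<langle>|f|\<^sub>r\<rangle>\<^sub>Q\<^sup>r 1\<^sub>Q)\<^sup>1\<^sup>/\<^sup>r\<close> over a sparse family, and a Carleson type inequality for sparse families, proved
  by Young's inequality and absorption, gives the strong bound for \<open>p > 1\<close>. The sparse domination needs the unweighted
  weak \<open>(1,1)\<close> bound; this and the case \<open>p = 1\<close> come from a Calderon-Zygmund decomposition and the bound for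
  \<open>p = r\<close>, which reduces to the scalar sparse domination. Balls with \<open>R > \<rho>(x\<^sub>0)\<close> are controlled by the averages
  over \<open>B(x, 2\<^sup>j \<rho>(x))\<close> with weights \<open>2\<close> to the power \<open>- j \<eta> / (l\<^sub>0 + 1)\<close>. These are positive linear operators, so
  Minkowski's inequality removes the \<open>l\<^sup>r\<close>-norm, and their norms on \<open>L\<^sup>p(\<omega>)\<close> grow geometrically in \<open>j\<close>
  with a rate that \<open>\<eta>\<close> beats.
\<close>

section \<open>Powers of extended nonnegative reals\<close>

text \<open>Absorption subtracts a quantity from itself and needs it to be finite. Therefore all
  dyadic estimates concern finite families, with constants independent of the family, and
  \<open>truncation\<close> is removed by monotone convergence at the end of the local part.

  Above the critical radius the weight is doubling only with a loss: comparing a ball of radius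
  about 2^j times the critical radius at x with a ball centred at another of its points costs powers
  of 2^j, and the average itself costs some more. In total the norm on the weighted space grows like
  2^(j N) with N = (l0 + 3) \<theta> + (l0 + 1) n. A ball of radius R at x0 is captured at a scale j
  with 2^j at most of order (1 + R / \<rho>(x0))^(l0 + 1), so its damping factor is at most of order
  2^(- j \<eta> / (l0 + 1)). This is why \<eta> / (l0 + 1) has to be at least N + 2: two geometric
  series in j must converge.

  The reverse Hoelder condition with q = n / 2 enters through the critical radius, a supremum of
  reals, which has to be taken over a nonempty set bounded above.\<close>

lemma ennpowr_top [simp]: "ennpowr top a = top"
  by (simp add: ennpowr_def)

lemma ennpowr_ennreal: "0 \<le> t \<Longrightarrow> ennpowr (ennreal t) a = ennreal (t powr a)"
  by (simp add: ennpowr_def)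

lemma ennpowr_0 [simp]: "ennpowr 0 a = 0"
  by (simp add: ennpowr_def)

lemma ennpowr_1_left [simp]: "ennpowr 1 a = 1"
  by (simp add: ennpowr_def)

lemma ennpowr_1 [simp]: "ennpowr x 1 = x"
  by (cases x) (auto simp: ennpowr_ennreal)

lemma ennpowr_mono: "x \<le> y \<Longrightarrow> 0 \<le> a \<Longrightarrow> ennpowr x a \<le> ennpowr y a"
  by (cases x; cases y) (auto simp: ennpowr_ennreal powr_mono2 top_unique intro!: ennreal_leI)

lemma ennpowr_mult: "ennpowr (x * y) a = ennpowr x a * ennpowr y a"
proof (cases x; cases y)
  fix u v assume "0 \<le> u" "x = ennreal u" "0 \<le> v" "y = ennreal v"
  then show ?thesis
    by (simp add: ennpowr_ennreal ennreal_mult[symmetric] powr_mult)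
next
  fix u assume "0 \<le> u" "x = ennreal u" "y = top"
  then show ?thesis
    by (cases "u = 0") (auto simp: ennpowr_ennreal ennreal_mult_top)
next
  fix u assume "0 \<le> u" "y = ennreal u" "x = top"
  then show ?thesis
    by (cases "u = 0") (auto simp: ennpowr_ennreal ennreal_top_mult)
qed simp

lemma ennpowr_ennpowr: "ennpowr (ennpowr x a) b = ennpowr x (a * b)"
  by (cases x) (auto simp: ennpowr_ennreal powr_powr)

lemma ennpowr_inverse [simp]: "0 < a \<Longrightarrow> ennpowr (ennpowr x a) (1 / a) = x"
  and ennpowr_inverse' [simp]: "0 < a \<Longrightarrow> ennpowr (ennpowr x (1 / a)) a = x"
  by (auto simp: ennpowr_ennpowr)

lemma ennpowr_add: "0 < a \<Longrightarrow> 0 < b \<Longrightarrow> ennpowr x (a + b) = ennpowr x a * ennpowr x b"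
  by (cases x) (auto simp: ennpowr_ennreal powr_add ennreal_mult[symmetric] ennreal_top_mult)

lemma ennpowr_eq_0_iff [simp]: "ennpowr x a = 0 \<longleftrightarrow> x = 0"
  by (cases x) (auto simp: ennpowr_ennreal)

lemma ennpowr_eq_top_iff [simp]: "ennpowr x a = top \<longleftrightarrow> x = top"
  by (cases x) (auto simp: ennpowr_ennreal)

lemma ennpowr_le_iff: "0 < a \<Longrightarrow> ennpowr x a \<le> y \<longleftrightarrow> x \<le> ennpowr y (1 / a)"
  using ennpowr_mono[of "ennpowr x a" y "1 / a"] ennpowr_mono[of x "ennpowr y (1 / a)" a] by auto

lemma le_ennpowr_iff: "0 < a \<Longrightarrow> x \<le> ennpowr y a \<longleftrightarrow> ennpowr x (1 / a) \<le> y"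
  using ennpowr_mono[of x "ennpowr y a" "1 / a"] ennpowr_mono[of "ennpowr x (1 / a)" y a] by auto

lemma ennpowr_mono_iff: "0 < a \<Longrightarrow> ennpowr x a \<le> ennpowr y a \<longleftrightarrow> x \<le> y"
  by (simp add: ennpowr_le_iff)

text \<open>For \<open>0 < a\<close> the power is an order isomorphism with inverse exponent
  \<open>1 / a\<close>, so it can be moved to the other side of an inequality with a
  supremum.\<close>

lemma ennpowr_SUP:
  assumes "0 < a"
  shows "ennpowr (SUP i\<in>I. f i) a = (SUP i\<in>I. ennpowr (f i) a)"
proof (rule antisym)
  have "f i \<le> ennpowr (SUP i\<in>I. ennpowr (f i) a) (1 / a)" if "i \<in> I" for i
    using assms that by (subst ennpowr_le_iff[symmetric]) (auto intro: SUP_upper)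
  then show "ennpowr (SUP i\<in>I. f i) a \<le> (SUP i\<in>I. ennpowr (f i) a)"
    using assms by (subst ennpowr_le_iff) (auto intro: SUP_least)
  show "(SUP i\<in>I. ennpowr (f i) a) \<le> ennpowr (SUP i\<in>I. f i) a"
    using assms by (intro SUP_least ennpowr_mono SUP_upper) auto
qed

lemma measurable_ennpowr [measurable]: "(\<lambda>x. ennpowr x a) \<in> borel_measurable borel"
  unfolding ennpowr_def by measurable

text \<open>Dividing by \<open>u + v\<close> puts both summands in the unit interval, where a number
  is at most its power \<open>a\<close> because \<open>a \<le> 1\<close>; then the two inequalities
  are added.\<close>

lemma ennpowr_add_le:
  assumes "0 < a" "a \<le> 1"
  shows "ennpowr (x + y) a \<le> ennpowr x a + ennpowr y a"
proof (cases x; cases y)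
  fix u v assume uv: "0 \<le> u" "x = ennreal u" "0 \<le> v" "y = ennreal v"
  have "(u + v) powr a \<le> u powr a + v powr a"
  proof (cases "u + v = 0")
    case False
    then have s: "0 < u + v" using uv by simp
    have *: "t / (u + v) \<le> (t / (u + v)) powr a" if "0 \<le> t" "t \<le> u + v" for t
      using powr_mono'[of a 1 "t / (u + v)"] that assms s by (cases "t = 0") auto
    have "1 \<le> (u / (u + v)) powr a + (v / (u + v)) powr a"
    proof -
      have "1 = u / (u + v) + v / (u + v)"
        using s by (subst add_divide_distrib[symmetric]) simp
      then show ?thesis using *[of u] *[of v] uv by linarith
    qed
    also have "\<dots> = (u powr a + v powr a) / (u + v) powr a"
      using uv s by (simp add: powr_divide add_divide_distrib)
    finally show ?thesis using s by (simp add: field_simps)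
  qed (use uv in auto)
  then have "ennreal ((u + v) powr a) \<le> ennreal (u powr a) + ennreal (v powr a)"
    by (subst ennreal_plus[symmetric]) (auto intro: ennreal_leI simp del: ennreal_plus)
  moreover have "x + y = ennreal (u + v)" using uv by simp
  ultimately show ?thesis using uv by (simp add: ennpowr_ennreal del: ennreal_plus)
qed auto

lemma ennpowr_sum_le:
  assumes "0 < a" "a \<le> 1"
  shows "ennpowr (\<Sum>i\<in>I. f i) a \<le> (\<Sum>i\<in>I. ennpowr (f i) a)"
proof (induction I rule: infinite_finite_induct)
  case (insert i I)
  have "ennpowr (f i + sum f I) a \<le> ennpowr (f i) a + ennpowr (sum f I) a"
    using assms by (rule ennpowr_add_le)
  also have "\<dots> \<le> ennpowr (f i) a + (\<Sum>i\<in>I. ennpowr (f i) a)"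
    by (intro add_left_mono insert)
  finally show ?case using insert by simp
qed auto

text \<open>Every summand is at most the largest one, whose power is one term on the right. This is
  crude, but it covers exponents below and above 1 at once.\<close>

lemma ennpowr_sum_le_card:
  assumes "0 < a" "finite I"
  shows "ennpowr (\<Sum>i\<in>I. f i) a \<le> ennpowr (of_nat (card I)) a * (\<Sum>i\<in>I. ennpowr (f i) a)"
proof (cases "I = {}")
  case False
  then obtain j where j: "j \<in> I" "f j = Max (f ` I)"
    using assms by (metis (no_types, lifting) Max_in finite_imageI image_iff image_is_empty)
  have "f i \<le> f j" if "i \<in> I" for i using that j assms by simp
  then have "(\<Sum>i\<in>I. f i) \<le> of_nat (card I) * f j"
    by (rule sum_bounded_above)
  then have "ennpowr (\<Sum>i\<in>I. f i) a \<le> ennpowr (of_nat (card I)) a * ennpowr (f j) a"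
    unfolding ennpowr_mult[symmetric] using assms by (intro ennpowr_mono) auto
  also have "\<dots> \<le> ennpowr (of_nat (card I)) a * (\<Sum>i\<in>I. ennpowr (f i) a)"
    using j assms by (intro mult_left_mono member_le_sum) auto
  finally show ?thesis .
qed simp

lemma ennpowr_weighted_geometric_mean_le:
  assumes "0 < t" "t < 1"
  shows "ennpowr u t * ennpowr v (1 - t) \<le> ennreal t * u + ennreal (1 - t) * v"
proof (cases u; cases v)
  fix a b assume ab: "0 \<le> a" "u = ennreal a" "0 \<le> b" "v = ennreal b"
  have "a powr t * b powr (1 - t) \<le> t * a + (1 - t) * b"
    using ab assms Youngs_inequality_0[of t "1 - t" a b]
    by (cases "a = 0"; cases "b = 0") auto
  then show ?thesis using ab assms
    by (simp add: ennpowr_ennreal flip: ennreal_mult ennreal_plus)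
next
  fix a assume "0 \<le> a" "u = ennreal a" "v = top"
  then show ?thesis using assms by (simp add: ennreal_mult_top)
next
  fix a assume "0 \<le> a" "v = ennreal a" "u = top"
  then show ?thesis using assms by (simp add: ennreal_mult_top)
next
  assume "u = top" "v = top"
  then show ?thesis using assms by (simp add: ennreal_mult_top)
qed

text \<open>Both integrals are normalised to 1 and the weighted geometric mean inequality is
  integrated. In the degenerate cases either the integrand vanishes almost everywhere or the right
  side is infinite, since both exponents are positive.\<close>

lemma nn_integral_Holder:
  assumes t: "0 < t" "t < 1" and [measurable]: "u \<in> borel_measurable M" "v \<in> borel_measurable M"
  shows "(\<integral>\<^sup>+x. ennpowr (u x) t * ennpowr (v x) (1 - t) \<partial>M)
    \<le> ennpowr (\<integral>\<^sup>+x. u x \<partial>M) t * ennpowr (\<integral>\<^sup>+x. v x \<partial>M) (1 - t)"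
proof -
  let ?U = "\<integral>\<^sup>+x. u x \<partial>M" and ?V = "\<integral>\<^sup>+x. v x \<partial>M"
  consider (zero) "?U = 0 \<or> ?V = 0" | (infinite) "?U \<noteq> 0" "?V \<noteq> 0" "?U = top \<or> ?V = top"
    | (fin) "?U \<noteq> 0" "?V \<noteq> 0" "?U < top" "?V < top"
    unfolding less_top[symmetric] by blast
  then show ?thesis
  proof cases
    case zero
    then have "AE x in M. ennpowr (u x) t * ennpowr (v x) (1 - t) = 0"
      by (auto simp: nn_integral_0_iff_AE)
    then show ?thesis using nn_integral_0_iff_AE[of "\<lambda>x. ennpowr (u x) t * ennpowr (v x) (1 - t)" M] by simp
  next
    case infinite
    then have "ennpowr ?U t * ennpowr ?V (1 - t) = top"
      by (auto simp: ennreal_mult_eq_top_iff)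
    then show ?thesis by simp
  next
    case fin
    obtain a b where ab: "?U = ennreal a" "?V = ennreal b" "0 < a" "0 < b"
      using fin by (metis enn2real_positive_iff ennreal_enn2real not_gr_zero)
    let ?c = "ennreal (a powr t * b powr (1 - t))"
    have "(\<integral>\<^sup>+x. ennpowr (u x) t * ennpowr (v x) (1 - t) \<partial>M)
        = (\<integral>\<^sup>+x. ?c * (ennpowr (ennreal (1 / a) * u x) t * ennpowr (ennreal (1 / b) * v x) (1 - t)) \<partial>M)"
    proof (intro nn_integral_cong)
      fix x
      have "?c * (ennpowr (ennreal (1 / a) * u x) t * ennpowr (ennreal (1 / b) * v x) (1 - t))
        = (?c * ennreal ((1/a) powr t) * ennreal ((1/b) powr (1-t))) * (ennpowr (u x) t * ennpowr (v x) (1 - t))"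
        using ab by (simp add: ennpowr_mult ennpowr_ennreal mult_ac)
      also have "?c * ennreal ((1/a) powr t) * ennreal ((1/b) powr (1-t)) = 1"
        using ab by (simp flip: ennreal_mult) (simp add: powr_divide field_simps)
      finally show "ennpowr (u x) t * ennpowr (v x) (1 - t) = ?c * (ennpowr (ennreal (1 / a) * u x) t * ennpowr (ennreal (1 / b) * v x) (1 - t))"
        by simp
    qed
    also have "\<dots> \<le> (\<integral>\<^sup>+x. ?c * (ennreal t * (ennreal (1 / a) * u x) + ennreal (1 - t) * (ennreal (1 / b) * v x)) \<partial>M)"
      by (intro nn_integral_mono mult_left_mono ennpowr_weighted_geometric_mean_le t) auto
    also have "\<dots> = ?c * (ennreal t * (ennreal (1 / a) * ?U) + ennreal (1 - t) * (ennreal (1 / b) * ?V))"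
      by (simp add: nn_integral_cmult nn_integral_add)
    also have "\<dots> = ?c"
      using ab t by (simp flip: ennreal_mult ennreal_plus)
    also have "?c = ennpowr ?U t * ennpowr ?V (1 - t)"
      using ab by (simp add: ennpowr_ennreal ennreal_mult)
    finally show ?thesis .
  qed
qed

section \<open>Sequence norms and Minkowski's inequality\<close>

lemma lr_norm_powr [simp]: "0 < r \<Longrightarrow> ennpowr (lr_norm r a) r = (\<Sum>k. ennpowr (a k) r)"
  by (simp add: lr_norm_def)

lemma le_lr_norm: "0 < r \<Longrightarrow> a k \<le> lr_norm r a"
  unfolding lr_norm_def
  by (subst ennpowr_le_iff[of r "a k", symmetric])
     (use sum_le_suminf[of "\<lambda>k. ennpowr (a k) r" "{k}"] in auto)

lemma measurable_lr_norm [measurable]: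
  "(\<And>k. f k \<in> borel_measurable M) \<Longrightarrow> (\<lambda>x. lr_norm r (\<lambda>k. f k x)) \<in> borel_measurable M"
  unfolding lr_norm_def by measurable

lemma sum_Holder_lr_norm:
  assumes "1 < r" "finite I"
  shows "(\<Sum>k\<in>I. ennpowr (a k) (r - 1) * b k) \<le> ennpowr (\<Sum>k\<in>I. ennpowr (a k) r) (1 - 1 / r) * lr_norm r b"
proof -
  have "(\<Sum>k\<in>I. ennpowr (a k) (r - 1) * b k)
     = (\<integral>\<^sup>+k. ennpowr (ennpowr (b k) r) (1/r) * ennpowr (ennpowr (a k) r) (1 - 1/r) \<partial>count_space I)"
    using assms by (subst nn_integral_count_space_finite)
       (auto simp: ennpowr_ennpowr right_diff_distrib mult.commute)
  also have "\<dots> \<le> ennpowr (\<integral>\<^sup>+k. ennpowr (b k) r \<partial>count_space I) (1/r)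
       * ennpowr (\<integral>\<^sup>+k. ennpowr (a k) r \<partial>count_space I) (1 - 1/r)"
    using assms by (intro nn_integral_Holder) auto
  also have "\<dots> \<le> lr_norm r b * ennpowr (\<Sum>k\<in>I. ennpowr (a k) r) (1 - 1/r)"
    unfolding lr_norm_def using assms
    by (auto simp: nn_integral_count_space_finite intro!: mult_right_mono ennpowr_mono sum_le_suminf)
  finally show ?thesis by (simp add: mult.commute)
qed

text \<open>Duality made explicit: the sequence of integrals raised to \<open>r - 1\<close> is the
  optimal test sequence. Pairing with it under the integral and applying Hoelder's inequality at
  each point bounds a partial sum \<open>?A\<close> by \<open>ennpowr ?A (1 - 1 / r) * ?F\<close>,
  and the power is cancelled.\<close>

lemma Minkowski_lr_norm:
  assumes r: "1 < r" and [measurable]: "\<And>k. f k \<in> borel_measurable M"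
  shows "(\<Sum>k. ennpowr (\<integral>\<^sup>+x. f k x \<partial>M) r) \<le> ennpowr (\<integral>\<^sup>+x. lr_norm r (\<lambda>k. f k x) \<partial>M) r"
proof (cases "(\<integral>\<^sup>+x. lr_norm r (\<lambda>k. f k x) \<partial>M) = top")
  case False
  let ?F = "\<integral>\<^sup>+x. lr_norm r (\<lambda>k. f k x) \<partial>M"
  define a where "a k = (\<integral>\<^sup>+x. f k x \<partial>M)" for k
  have "a k \<le> ?F" for k
    unfolding a_def using r by (intro nn_integral_mono le_lr_norm[of r "\<lambda>k. f k _"]) auto
  then have a_fin: "a k \<noteq> top" for k
    using False neq_top_trans by blast
  have partial: "(\<Sum>k<n. ennpowr (a k) r) \<le> ennpowr ?F r" for n
  proof (cases "(\<Sum>k<n. ennpowr (a k) r) = 0")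
    case A0: False
    let ?A = "\<Sum>k<n. ennpowr (a k) r"
    \<comment> \<open>The cancellation below needs a finite \<open>?A\<close>; this is why only
      finitely many indices are taken first.\<close>
    have A_fin: "?A \<noteq> top" using a_fin by simp
    have "ennpowr ?A (1 - 1 / r) * ennpowr ?A (1 / r) = ?A"
      using r by (subst ennpowr_add[symmetric]) auto
    also have "?A = (\<Sum>k<n. ennpowr (a k) (r - 1) * (\<integral>\<^sup>+x. f k x \<partial>M))"
      using r ennpowr_add[of "r - 1" 1] by (simp add: a_def)
    also have "\<dots> = (\<integral>\<^sup>+x. (\<Sum>k<n. ennpowr (a k) (r - 1) * f k x) \<partial>M)"
      by (simp add: nn_integral_sum nn_integral_cmult)
    also have "\<dots> \<le> (\<integral>\<^sup>+x. ennpowr ?A (1 - 1 / r) * lr_norm r (\<lambda>k. f k x) \<partial>M)"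
      by (intro nn_integral_mono sum_Holder_lr_norm[OF r]) auto
    also have "\<dots> = ennpowr ?A (1 - 1 / r) * ?F"
      by (simp add: nn_integral_cmult)
    finally have "ennpowr ?A (1 - 1 / r) * ennpowr ?A (1 / r) \<le> ennpowr ?A (1 - 1 / r) * ?F" .
    then have "ennpowr ?A (1 / r) \<le> ?F"
      using A0 A_fin by (subst (asm) ennreal_mult_le_mult_iff) auto
    then show ?thesis using r by (simp add: le_ennpowr_iff)
  qed simp
  show ?thesis
    using partial by (simp add: a_def suminf_eq_SUP SUP_least)
qed simp

section \<open>Laminar and sparse families\<close>

text \<open>Young's inequality for the conjugate exponents \<open>q\<close> and
  \<open>q / (q - 1)\<close>, written without the second one so that \<open>q = 1\<close> is
  included. There \<open>b powr 0\<close> is 0 or 1, as \<open>0 powr 0 = 0\<close>.\<close>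

lemma Young_powr:
  fixes a b q :: real
  assumes "1 \<le> q" "0 \<le> a" "0 \<le> b"
  shows "a * b powr (q - 1) \<le> a powr q / q + (1 - 1 / q) * b powr q"
proof (cases "q = 1 \<or> b = 0 \<or> a = 0")
  case False
  then have "a powr q > 0" "b powr q > 0" using assms by auto
  then have "(a powr q) powr (1 / q) * (b powr q) powr (1 - 1 / q) \<le> 1 / q * a powr q + (1 - 1 / q) * b powr q"
    using assms by (intro Youngs_inequality_0) auto
  moreover have "q * (1 - 1 / q) = q - 1" using assms by (simp add: right_diff_distrib)
  ultimately show ?thesis using assms False by (simp add: powr_powr)
next
  case True
  then show ?thesis using assms by (auto simp: divide_simps)
qed

definition laminar :: "'a set set \<Rightarrow> bool" where
  "laminar S \<longleftrightarrow> (\<forall>P\<in>S. \<forall>Q\<in>S. P \<subseteq> Q \<or> Q \<subseteq> P \<or> P \<inter> Q = {})"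

text \<open>In a laminar family these remainders are pairwise disjoint, so they stand in for the
  members themselves whenever measures have to add up.\<close>

definition core :: "'a set set \<Rightarrow> 'a set \<Rightarrow> 'a set" where
  "core S Q = Q - \<Union>{P \<in> S. P \<subset> Q}"

lemma laminarD: "laminar S \<Longrightarrow> P \<in> S \<Longrightarrow> Q \<in> S \<Longrightarrow> x \<in> P \<Longrightarrow> x \<in> Q \<Longrightarrow> P \<subseteq> Q \<or> Q \<subseteq> P"
  unfolding laminar_def by blast

lemma laminar_subset: "laminar S \<Longrightarrow> T \<subseteq> S \<Longrightarrow> laminar T"
  unfolding laminar_def by blast

lemma core_unique:
  assumes "laminar S" "P \<in> S" "Q \<in> S" "x \<in> core S P" "x \<in> core S Q"
  shows "P = Q"
  using assms laminarD[OF assms(1-3), of x] unfolding core_def by auto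

text \<open>A discrete form of \<open>G\<^sup>q = \<integral> q G\<^sup>q\<^sup>-\<^sup>1 dG\<close> along a chain.\<close>

lemma chain_sum_powr_le:
  fixes b :: "'a set \<Rightarrow> real"
  assumes "finite C" "\<And>P Q. P \<in> C \<Longrightarrow> Q \<in> C \<Longrightarrow> P \<subseteq> Q \<or> Q \<subseteq> P"
    "\<And>Q. 0 \<le> b Q" "1 \<le> q"
  shows "(\<Sum>Q\<in>C. b Q) powr q \<le> q * (\<Sum>Q\<in>C. b Q * (\<Sum>P\<in>{P\<in>C. Q \<subseteq> P}. b P) powr (q - 1))"
  using assms(1,2)
proof (induction C rule: finite_psubset_induct)
  case (psubset C)
  show ?case
  proof (cases "C = {}")
    case False
    then obtain R where R: "R \<in> C" "\<And>P. P \<in> C \<Longrightarrow> R \<subseteq> P"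
      using finite_has_minimal[OF psubset.hyps(1)] psubset.prems by metis
    let ?D = "C - {R}"
    define T u where "T = (\<Sum>Q\<in>C. b Q)" and "u = (\<Sum>Q\<in>?D. b Q)"
    have Tu: "T = b R + u" unfolding T_def u_def using R psubset.hyps by (simp add: sum.remove)
    have nn: "0 \<le> u" "0 \<le> T" unfolding T_def u_def by (auto intro: sum_nonneg assms)
    have IH: "u powr q \<le> q * (\<Sum>Q\<in>?D. b Q * (\<Sum>P\<in>{P\<in>?D. Q \<subseteq> P}. b P) powr (q - 1))"
      unfolding u_def using R psubset.prems by (intro psubset.IH) auto
    \<comment> \<open>\<open>R\<close> is contained in all members, so none of the others is
      contained in it: deleting \<open>R\<close> leaves the sums over larger members
      unchanged.\<close>
    have "{P\<in>?D. Q \<subseteq> P} = {P\<in>C. Q \<subseteq> P}" if "Q \<in> ?D" for Q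
      using that R(2)[of Q] by auto
    then have IH': "u powr q \<le> q * (\<Sum>Q\<in>?D. b Q * (\<Sum>P\<in>{P\<in>C. Q \<subseteq> P}. b P) powr (q - 1))"
      using IH by simp
    have up: "{P\<in>C. R \<subseteq> P} = C" using R by auto
    \<comment> \<open>With \<open>T = b R + u\<close> this becomes the tangent estimate
      \<open>T powr q - u powr q \<le> q * (T - u) * T powr (q - 1)\<close>, which is the
      contribution of \<open>R\<close> in the induction.\<close>
    have "u * T powr (q - 1) \<le> u powr q / q + (1 - 1 / q) * T powr q"
      using assms nn by (intro Young_powr)
    then have "q * (u * T powr (q - 1)) \<le> q * (u powr q / q + (1 - 1 / q) * T powr q)"
      using assms by (intro mult_left_mono) auto
    also have "\<dots> = u powr q + (q - 1) * T powr q"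
      using assms by (simp add: distrib_left right_diff_distrib left_diff_distrib)
    finally have "q * (u * T powr (q - 1)) \<le> u powr q + (q - 1) * T powr q" .
    moreover have "T * T powr (q - 1) = T powr q"
      using nn powr_add[of T 1 "q - 1"] by (cases "T = 0") auto
    then have "q * (b R * T powr (q - 1)) + q * (u * T powr (q - 1)) = q * T powr q"
      unfolding Tu by (simp flip: distrib_left distrib_right)
    ultimately have "T powr q \<le> u powr q + q * (b R * T powr (q - 1))"
      by (simp add: left_diff_distrib)
    also have "\<dots> \<le> q * (\<Sum>Q\<in>?D. b Q * (\<Sum>P\<in>{P\<in>C. Q \<subseteq> P}. b P) powr (q - 1)) + q * (b R * T powr (q - 1))"
      using IH' by simp
    also have "\<dots> = q * (\<Sum>Q\<in>C. b Q * (\<Sum>P\<in>{P\<in>C. Q \<subseteq> P}. b P) powr (q - 1))"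
      by (simp add: sum.remove[OF psubset.hyps(1) R(1), of "\<lambda>Q. b Q * (\<Sum>P\<in>{P\<in>C. Q \<subseteq> P}. b P) powr (q - 1)"]
          up T_def distrib_left)
    finally show ?thesis unfolding T_def .
  qed simp
qed

lemma sum_mult_indicator_eq:
  fixes c :: "'b \<Rightarrow> 'c::semiring_1"
  shows "finite S \<Longrightarrow> (\<Sum>Q\<in>S. c Q * indicator (A Q) x) = (\<Sum>Q\<in>{Q\<in>S. x \<in> A Q}. c Q)"
  by (simp add: sum.inter_filter)

lemma core_sets: "finite S \<Longrightarrow> (\<And>Q. Q \<in> S \<Longrightarrow> Q \<in> sets M) \<Longrightarrow> Q \<in> S \<Longrightarrow> core S Q \<in> sets M"
  unfolding core_def by (intro sets.Diff sets.finite_Union) auto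

lemma sum_core_le:
  assumes "finite S" "laminar S" "\<And>Q. Q \<in> S \<Longrightarrow> x \<in> Q \<Longrightarrow> c Q \<le> (t :: real)" "0 \<le> t"
  shows "(\<Sum>Q\<in>S. c Q * indicator (core S Q) x) \<le> t"
proof (cases "\<exists>Q\<in>S. x \<in> core S Q")
  case True
  then obtain Q where Q: "Q \<in> S" "x \<in> core S Q" by blast
  have "{P\<in>S. x \<in> core S P} = {Q}"
    using core_unique[OF assms(2) _ Q(1) _ Q(2)] Q by blast
  then have "(\<Sum>Q\<in>S. c Q * indicator (core S Q) x) = c Q"
    by (simp add: sum_mult_indicator_eq[OF assms(1)])
  then show ?thesis using assms(3)[of Q] Q by (auto simp: core_def)
next
  case False
  then have "(\<Sum>Q\<in>S. c Q * indicator (core S Q) x) = 0" by (intro sum.neutral) auto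
  then show ?thesis using assms by simp
qed

text \<open>Absorption. By \<open>chain_sum_powr_le\<close> the integral is at most the sum of
  \<open>q * b Q * g Q powr (q - 1) * measure M Q\<close>, where \<open>g Q\<close> collects
  \<open>Q\<close> and the members containing it. Replacing members by cores costs \<open>K\<close>;
  the cores are disjoint and \<open>g Q\<close> is at most the whole sum on \<open>Q\<close>, so
  after Young's inequality a fraction \<open>1 - 1 / q\<close> of the integral itself stands on the
  right and is subtracted.\<close>

lemma laminar_sum_powr_nn_integral_le:
  fixes b :: "'a set \<Rightarrow> real"
  assumes fin: "finite S" and lam: "laminar S"
    and sets [measurable]: "\<And>Q. Q \<in> S \<Longrightarrow> Q \<in> sets M"
    and emeasure: "\<And>Q. Q \<in> S \<Longrightarrow> emeasure M Q < top"
    and K: "\<And>Q. Q \<in> S \<Longrightarrow> measure M Q \<le> K * measure M (core S Q)"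
    and b: "\<And>Q. 0 \<le> b Q" and q: "1 \<le> q" and K0: "0 \<le> K"
  shows "(\<integral>\<^sup>+x. ennreal ((\<Sum>Q\<in>S. b Q * indicator Q x) powr q) \<partial>M)
    \<le> ennreal ((q * K) powr q * (\<Sum>Q\<in>S. b Q powr q * measure M Q))"
proof -
  define G where "G x = (\<Sum>Q\<in>S. b Q * indicator Q x)" for x
  define g where "g Q = (\<Sum>P\<in>{P\<in>S. Q \<subseteq> P}. b P)" for Q
  have cs [measurable]: "core S Q \<in> sets M" if "Q \<in> S" for Q
    using core_sets[OF fin sets that] .
  have cm: "emeasure M (core S Q) = ennreal (measure M (core S Q))" if "Q \<in> S" for Q
    using emeasure[OF that] emeasure_mono[of "core S Q" Q M] that
    by (intro emeasure_eq_ennreal_measure) (auto simp: core_def top_unique)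
  have g0: "0 \<le> g Q" for Q unfolding g_def by (intro sum_nonneg b)
  have G0: "0 \<le> G x" for x unfolding G_def by (intro sum_nonneg) (auto simp: b)
  have G_eq: "G x = (\<Sum>Q\<in>{Q\<in>S. x \<in> Q}. b Q)" for x
    unfolding G_def by (rule sum_mult_indicator_eq[OF fin])
  have pointwise: "G x powr q \<le> (\<Sum>Q\<in>S. q * b Q * g Q powr (q - 1) * indicator Q x)" for x
  proof -
    let ?C = "{Q\<in>S. x \<in> Q}"
    have "G x powr q \<le> q * (\<Sum>Q\<in>?C. b Q * (\<Sum>P\<in>{P\<in>?C. Q \<subseteq> P}. b P) powr (q - 1))"
      unfolding G_eq using fin lam b q by (intro chain_sum_powr_le) (auto dest: laminarD)
    also have "\<dots> = q * (\<Sum>Q\<in>?C. b Q * g Q powr (q - 1))"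
    proof -
      have "{P\<in>?C. Q \<subseteq> P} = {P\<in>S. Q \<subseteq> P}" if "Q \<in> ?C" for Q using that by auto
      then show ?thesis by (simp add: g_def)
    qed
    also have "\<dots> = (\<Sum>Q\<in>S. q * b Q * g Q powr (q - 1) * indicator Q x)"
      unfolding sum_mult_indicator_eq[OF fin] sum_distrib_left by (simp add: mult_ac)
    finally show ?thesis .
  qed
  have "(\<integral>\<^sup>+x. ennreal (G x powr q) \<partial>M) \<le> (\<integral>\<^sup>+x. (\<Sum>Q\<in>S. ennreal (q * b Q * g Q powr (q - 1)) * indicator Q x) \<partial>M)"
  proof (intro nn_integral_mono)
    fix x
    have "ennreal (G x powr q) \<le> ennreal (\<Sum>Q\<in>S. q * b Q * g Q powr (q - 1) * indicator Q x)"
      using pointwise by (rule ennreal_leI)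
    also have "\<dots> = (\<Sum>Q\<in>S. ennreal (q * b Q * g Q powr (q - 1) * indicator Q x))"
      using b q by (intro sum_ennreal[symmetric]) auto
    also have "\<dots> = (\<Sum>Q\<in>S. ennreal (q * b Q * g Q powr (q - 1)) * indicator Q x)"
      by (intro sum.cong refl) (auto simp: indicator_def)
    finally show "ennreal (G x powr q) \<le> (\<Sum>Q\<in>S. ennreal (q * b Q * g Q powr (q - 1)) * indicator Q x)" .
  qed
  also have "\<dots> = (\<Sum>Q\<in>S. ennreal (q * b Q * g Q powr (q - 1)) * emeasure M Q)"
    by (subst nn_integral_sum) (auto intro!: sum.cong nn_integral_cmult_indicator)
  also have "\<dots> = (\<Sum>Q\<in>S. ennreal (q * b Q * g Q powr (q - 1) * measure M Q))"
    using emeasure b q by (intro sum.cong refl) (auto simp: emeasure_eq_ennreal_measure ennreal_mult less_top)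
  also have "\<dots> = ennreal (\<Sum>Q\<in>S. q * b Q * g Q powr (q - 1) * measure M Q)"
    using b q by (intro sum_ennreal) auto
  finally have le: "(\<integral>\<^sup>+x. ennreal (G x powr q) \<partial>M) \<le> ennreal (\<Sum>Q\<in>S. q * b Q * g Q powr (q - 1) * measure M Q)" .
  \<comment> \<open>The bound just obtained is a finite sum of finite terms, so the integral is a
    real number \<open>i\<close>; without this the final subtraction would be meaningless.\<close>
  then obtain i where i: "0 \<le> i" "(\<integral>\<^sup>+x. ennreal (G x powr q) \<partial>M) = ennreal i"
    "i \<le> (\<Sum>Q\<in>S. q * b Q * g Q powr (q - 1) * measure M Q)"
    using b q by (subst (asm) le_ennreal_iff) (auto intro!: sum_nonneg)
  have "ennreal (\<Sum>Q\<in>S. g Q powr q * measure M (core S Q)) = (\<integral>\<^sup>+x. (\<Sum>Q\<in>S. ennreal (g Q powr q) * indicator (core S Q) x) \<partial>M)"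
  proof -
    have "ennreal (\<Sum>Q\<in>S. g Q powr q * measure M (core S Q)) = (\<Sum>Q\<in>S. ennreal (g Q powr q) * emeasure M (core S Q))"
      by (subst sum_ennreal[symmetric]) (auto simp: cm ennreal_mult)
    also have "\<dots> = (\<integral>\<^sup>+x. (\<Sum>Q\<in>S. ennreal (g Q powr q) * indicator (core S Q) x) \<partial>M)"
      by (subst nn_integral_sum) (auto intro!: sum.cong nn_integral_cmult_indicator[symmetric])
    finally show ?thesis .
  qed
  also have "\<dots> \<le> (\<integral>\<^sup>+x. ennreal (G x powr q) \<partial>M)"
  proof (intro nn_integral_mono)
    fix x
    have "(\<Sum>Q\<in>S. ennreal (g Q powr q) * indicator (core S Q) x) = ennreal (\<Sum>Q\<in>S. g Q powr q * indicator (core S Q) x)"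
      by (subst sum_ennreal[symmetric]) (auto simp: indicator_def simp del: sum_ennreal intro!: sum.cong)
    also have "\<dots> \<le> ennreal (G x powr q)"
    proof (intro ennreal_leI sum_core_le fin lam)
      fix Q assume "Q \<in> S" "x \<in> Q"
      then have "g Q \<le> G x"
        unfolding g_def G_eq using fin b by (intro sum_mono2) auto
      then show "g Q powr q \<le> G x powr q" using g0 q by (intro powr_mono2) auto
    qed simp
    finally show "(\<Sum>Q\<in>S. ennreal (g Q powr q) * indicator (core S Q) x) \<le> ennreal (G x powr q)" .
  qed
  finally have core_le: "(\<Sum>Q\<in>S. g Q powr q * measure M (core S Q)) \<le> i"
    using i by simp
  have "i \<le> (\<Sum>Q\<in>S. q * b Q * g Q powr (q - 1) * measure M Q)" by (rule i)
  also have "\<dots> \<le> (\<Sum>Q\<in>S. q * b Q * g Q powr (q - 1) * (K * measure M (core S Q)))"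
    using b q K by (intro sum_mono mult_left_mono) auto
  also have "\<dots> \<le> (\<Sum>Q\<in>S. ((q * K * b Q) powr q / q + (1 - 1 / q) * g Q powr q) * measure M (core S Q))"
  proof (intro sum_mono)
    fix Q
    \<comment> \<open>The factor \<open>q * K\<close> goes entirely to \<open>b Q\<close>, so that
      the term in \<open>g Q\<close> keeps the coefficient \<open>1 - 1 / q < 1\<close> and can be
      absorbed.\<close>
    have "(q * K * b Q) * g Q powr (q - 1) \<le> (q * K * b Q) powr q / q + (1 - 1 / q) * g Q powr q"
      using q K0 b g0 by (intro Young_powr) auto
    then have "(q * K * b Q) * g Q powr (q - 1) * measure M (core S Q) \<le> ((q * K * b Q) powr q / q + (1 - 1 / q) * g Q powr q) * measure M (core S Q)"
      by (rule mult_right_mono) simp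
    then show "q * b Q * g Q powr (q - 1) * (K * measure M (core S Q)) \<le> ((q * K * b Q) powr q / q + (1 - 1 / q) * g Q powr q) * measure M (core S Q)"
      by (simp add: mult_ac)
  qed
  also have "\<dots> = (q * K) powr q / q * (\<Sum>Q\<in>S. b Q powr q * measure M (core S Q)) + (1 - 1 / q) * (\<Sum>Q\<in>S. g Q powr q * measure M (core S Q))"
    unfolding sum_distrib_left sum.distrib[symmetric]
    by (intro sum.cong refl) (simp add: powr_mult algebra_simps)
  also have "\<dots> \<le> (q * K) powr q / q * (\<Sum>Q\<in>S. b Q powr q * measure M Q) + (1 - 1 / q) * i"
  proof (intro add_mono mult_left_mono sum_mono core_le)
    fix Q assume "Q \<in> S"
    then show "measure M (core S Q) \<le> measure M Q"
      using emeasure cs by (intro measure_mono_fmeasurable) (auto simp: fmeasurable_def, auto simp: core_def)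
  qed (use q in auto)
  finally have "i / q \<le> (q * K) powr q / q * (\<Sum>Q\<in>S. b Q powr q * measure M Q)"
    by (simp add: left_diff_distrib)
  then have "i \<le> (q * K) powr q * (\<Sum>Q\<in>S. b Q powr q * measure M Q)"
    using q by (simp add: divide_le_cancel)
  then show ?thesis using i unfolding G_def by (simp add: ennreal_leI)
qed

section \<open>Weights on finite laminar families and the Carleson inequality\<close>

definition avg :: "'a measure \<Rightarrow> ('a \<Rightarrow> ennreal) \<Rightarrow> 'a set \<Rightarrow> ennreal" where
  "avg M f Q = (\<integral>\<^sup>+x\<in>Q. f x \<partial>M) / emeasure M Q"

definition wint :: "'a measure \<Rightarrow> ('a \<Rightarrow> real) \<Rightarrow> 'a set \<Rightarrow> ennreal" where
  "wint M w Q = (\<integral>\<^sup>+x\<in>Q. ennreal (w x) \<partial>M)"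

definition dual_weight :: "real \<Rightarrow> ('a \<Rightarrow> real) \<Rightarrow> 'a \<Rightarrow> real" where
  "dual_weight p w x = w x powr (- 1 / (p - 1))"

text \<open>The usual condition on averages with the denominators multiplied out, so that infinite
  integrals are excluded by the inequality itself and no quotient has to be interpreted.\<close>

definition Ap_on :: "'a measure \<Rightarrow> 'a set set \<Rightarrow> real \<Rightarrow> real \<Rightarrow> ('a \<Rightarrow> real) \<Rightarrow> bool" where
  "Ap_on M D p C w \<longleftrightarrow> (\<forall>Q\<in>D. wint M w Q * ennpowr (wint M (dual_weight p w) Q) (p - 1) \<le> ennreal C * ennpowr (emeasure M Q) p)"

definition sparse :: "'a measure \<Rightarrow> 'a set set \<Rightarrow> bool" where
  "sparse M S \<longleftrightarrow> (\<forall>Q\<in>S. 2 * emeasure M (\<Union>{P\<in>S. P \<subset> Q}) \<le> emeasure M Q)"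

text \<open>With \<open>q = p / (p - 1)\<close> this is \<open>C * (q * K) powr p\<close>, where
  \<open>K\<close> compares the dual weight of a member with that of its core
  (\<open>sparse_Ap_core\<close>); the outer \<open>C\<close> pays for the return from the dual
  weight to \<open>w\<close>.\<close>

definition carleson_const :: "real \<Rightarrow> real \<Rightarrow> real" where
  "carleson_const p C = C * (p / (p - 1) * (C * 2 powr p) powr (1 / (p - 1))) powr p"

lemma wint_eq_density:
  "(\<lambda>x. ennreal (w x)) \<in> borel_measurable M \<Longrightarrow> Q \<in> sets M \<Longrightarrow> wint M w Q = emeasure (density M (\<lambda>x. ennreal (w x))) Q"
  by (simp add: wint_def emeasure_density)

lemma wint_mono: "P \<subseteq> Q \<Longrightarrow> wint M w P \<le> wint M w Q"
  unfolding wint_def by (intro nn_integral_mono) (auto simp: indicator_def)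

lemma wint_pos:
  assumes [measurable]: "w \<in> borel_measurable M" "Q \<in> sets M"
    and "\<And>x. 0 < w x" "emeasure M Q \<noteq> 0"
  shows "wint M w Q \<noteq> 0"
proof
  assume "wint M w Q = 0"
  then have "AE x in M. ennreal (w x) * indicator Q x = 0"
    unfolding wint_def by (subst (asm) nn_integral_0_iff_AE) auto
  then have "AE x in M. x \<notin> Q"
  proof (rule eventually_mono)
    show "x \<notin> Q" if "ennreal (w x) * indicator Q x = 0" for x
      using that assms(3)[of x] by (auto simp: indicator_def split: if_splits)
  qed
  then show False using assms by (simp add: AE_iff_measurable[OF _ refl] sets.sets_into_space Int_absorb1 Collect_conj_eq emeasure_eq_0_AE)
qed

lemma dual_weight_mult:
  assumes "1 < p" "0 < w x"
  shows "ennpowr (ennreal (w x)) (1 / p) * ennpowr (ennreal (dual_weight p w x)) (1 - 1 / p) = 1"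
proof -
  have "w x powr (1 / p) * (w x powr (- 1 / (p - 1))) powr (1 - 1 / p) = w x powr (1 / p + (- 1 / (p - 1)) * (1 - 1 / p))"
    by (simp only: powr_powr powr_add)
  also have "1 / p + (- 1 / (p - 1)) * (1 - 1 / p) = 0"
    using assms by (simp add: field_simps)
  finally show ?thesis using assms
    by (simp add: ennpowr_ennreal dual_weight_def flip: ennreal_mult)
qed

text \<open>By \<open>dual_weight_mult\<close> a factor 1 can be inserted whose two parts go to
  \<open>f\<close> and to the dual weight; Hoelder's inequality with exponents \<open>1 / p\<close>
  and \<open>1 - 1 / p\<close> does the rest.\<close>

lemma weighted_Holder:
  assumes p: "1 < p" and [measurable]: "f \<in> borel_measurable M" "w \<in> borel_measurable M" "E \<in> sets M"
    and w: "\<And>x. 0 < w x"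
  shows "ennpowr (\<integral>\<^sup>+x\<in>E. f x \<partial>M) p
    \<le> (\<integral>\<^sup>+x\<in>E. ennpowr (f x) p * ennreal (w x) \<partial>M) * ennpowr (wint M (dual_weight p w) E) (p - 1)"
proof -
  let ?u = "\<lambda>x. ennpowr (f x) p * ennreal (w x) * indicator E x"
  let ?v = "\<lambda>x. ennreal (dual_weight p w x) * indicator E x"
  have [measurable]: "dual_weight p w \<in> borel_measurable M"
    unfolding dual_weight_def by measurable
  note one = dual_weight_mult[of p w, OF p w]
  have "(\<integral>\<^sup>+x\<in>E. f x \<partial>M) = (\<integral>\<^sup>+x. ennpowr (?u x) (1 / p) * ennpowr (?v x) (1 - 1 / p) \<partial>M)"
  proof (intro nn_integral_cong)
    fix x
    show "f x * indicator E x = ennpowr (?u x) (1 / p) * ennpowr (?v x) (1 - 1 / p)"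
      using p one[of x] by (cases "x \<in> E") (simp_all add: ennpowr_mult mult.assoc)
  qed
  also have "\<dots> \<le> ennpowr (\<integral>\<^sup>+x. ?u x \<partial>M) (1 / p) * ennpowr (\<integral>\<^sup>+x. ?v x \<partial>M) (1 - 1 / p)"
    using p by (intro nn_integral_Holder) auto
  finally have "ennpowr (\<integral>\<^sup>+x\<in>E. f x \<partial>M) p \<le> ennpowr (ennpowr (\<integral>\<^sup>+x. ?u x \<partial>M) (1 / p) * ennpowr (\<integral>\<^sup>+x. ?v x \<partial>M) (1 - 1 / p)) p"
    using p by (intro ennpowr_mono) auto
  also have "\<dots> = (\<integral>\<^sup>+x. ?u x \<partial>M) * ennpowr (\<integral>\<^sup>+x. ?v x \<partial>M) (p - 1)"
    using p by (simp add: ennpowr_mult ennpowr_ennpowr left_diff_distrib)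
  finally show ?thesis unfolding wint_def .
qed

text \<open>Hoelder's inequality for the constant function 1. It reverses the \<open>A_p\<close>
  inequality on an arbitrary measurable set, and is later applied to cores.\<close>

lemma emeasure_powr_le_wint:
  assumes "1 < p" "w \<in> borel_measurable M" "E \<in> sets M" "\<And>x. 0 < w x"
  shows "ennpowr (emeasure M E) p \<le> wint M w E * ennpowr (wint M (dual_weight p w) E) (p - 1)"
  using weighted_Holder[of p "\<lambda>_. 1" M w E] assms by (simp add: wint_def)

text \<open>Members of measure zero or infinity are excluded so that \<open>avg\<close> can be
  multiplied back by the measure and measures can be cancelled.\<close>

locale finite_laminar =
  fixes M :: "'a measure" and D :: "'a set set"
  assumes finite: "finite D" and lam: "laminar D"
    and sets [measurable]: "Q \<in> D \<Longrightarrow> Q \<in> sets M"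
    and nonnull: "Q \<in> D \<Longrightarrow> emeasure M Q \<noteq> 0"
    and finite_measure: "Q \<in> D \<Longrightarrow> emeasure M Q \<noteq> top"
begin

lemma emeasure_eq: "Q \<in> D \<Longrightarrow> emeasure M Q = ennreal (measure M Q)"
  and measure_pos: "Q \<in> D \<Longrightarrow> 0 < measure M Q"
  using finite_measure[of Q] nonnull[of Q] by (auto simp: emeasure_eq_ennreal_measure zero_less_measure_iff)

lemma avg_mult_emeasure: "Q \<in> D \<Longrightarrow> avg M f Q * emeasure M Q = (\<integral>\<^sup>+x\<in>Q. f x \<partial>M)"
  unfolding avg_def using finite_measure[of Q] nonnull[of Q]
  by (metis ennreal_divide_times ennreal_divide_self less_top mult.right_neutral)

lemma finite_laminar_subset: "E \<subseteq> D \<Longrightarrow> finite_laminar M E"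
  using finite lam sets nonnull finite_measure
  by unfold_locales (auto intro: finite_subset laminar_subset)

lemma sparse_core:
  assumes "sparse M D" "Q \<in> D"
  shows "emeasure M Q \<le> 2 * emeasure M (core D Q)"
proof -
  let ?U = "\<Union>{P\<in>D. P \<subset> Q}"
  have [measurable]: "?U \<in> sets M" using finite by (intro sets.finite_Union) auto
  have U: "2 * emeasure M ?U \<le> emeasure M Q" using assms by (auto simp: sparse_def)
  have "emeasure M Q = emeasure M ?U + emeasure M (core D Q)"
    unfolding core_def using assms by (subst plus_emeasure) (auto intro!: arg_cong[where f="emeasure M"])
  moreover obtain a where a: "emeasure M Q = ennreal a" "0 \<le> a" using emeasure_eq[OF assms(2)] measure_nonneg by blast
  ultimately obtain b c where bc: "emeasure M ?U = ennreal b" "0 \<le> b" "emeasure M (core D Q) = ennreal c" "0 \<le> c" "a = b + c"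
    by (cases "emeasure M ?U"; cases "emeasure M (core D Q)") (auto simp flip: ennreal_plus)
  have "ennreal (2 * b) \<le> ennreal a" using U a bc by (simp add: numeral_mult_ennreal)
  then have "2 * b \<le> a" using a(2) by (simp only: ennreal_le_iff)
  then have "a \<le> 2 * c" using bc(5) by linarith
  then have "ennreal a \<le> ennreal (2 * c)" by (rule ennreal_leI)
  then show ?thesis using a(1) bc(3,4) by (simp only: numeral_mult_ennreal)
qed

text \<open>The two factors of the \<open>A_p\<close> product are nonzero by positivity and their
  product is finite, so each of them is finite. This licenses all later cancellations of
  weights.\<close>

lemma Ap_on_finite:
  assumes "1 < p" and [measurable]: "w \<in> borel_measurable M" and w: "\<And>x. 0 < w x" and "Ap_on M D p C w" "Q \<in> D"
  shows "wint M w Q \<noteq> 0" "wint M w Q \<noteq> top"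
    "wint M (dual_weight p w) Q \<noteq> 0" "wint M (dual_weight p w) Q \<noteq> top"
proof -
  have dw [measurable]: "dual_weight p w \<in> borel_measurable M" unfolding dual_weight_def by measurable
  show 1: "wint M w Q \<noteq> 0" using assms nonnull by (intro wint_pos) auto
  have "0 < dual_weight p w x" for x using w[of x] by (simp add: dual_weight_def)
  then show 2: "wint M (dual_weight p w) Q \<noteq> 0" using assms nonnull by (intro wint_pos) auto
  have "wint M w Q * ennpowr (wint M (dual_weight p w) Q) (p - 1) \<le> ennreal C * ennpowr (emeasure M Q) p"
    using assms by (auto simp: Ap_on_def)
  also have "\<dots> < top" using finite_measure[OF assms(5)] by (auto simp: ennreal_mult_eq_top_iff less_top[symmetric])
  finally show "wint M w Q \<noteq> top" "wint M (dual_weight p w) Q \<noteq> top"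
    using 1 2 by (auto simp: ennreal_mult_less_top less_top[symmetric])
qed

text \<open>The \<open>A_p\<close> bound on \<open>Q\<close>, sparseness, and Hoelder's inequality
  on the core bound the product of weight and dual weight for \<open>Q\<close> by a constant times
  the same product for the core. Enlarging one factor from the core to \<open>Q\<close> and
  cancelling it leaves the comparison for the other.\<close>

lemma sparse_Ap_core:
  assumes p: "1 < p" and [measurable]: "w \<in> borel_measurable M" and w: "\<And>x. 0 < w x"
    and C: "0 \<le> C" and Ap: "Ap_on M D p C w" and sp: "sparse M D" and Q: "Q \<in> D"
  shows "wint M w Q \<le> ennreal (C * 2 powr p) * wint M w (core D Q)"
    "wint M (dual_weight p w) Q \<le> ennreal ((C * 2 powr p) powr (1 / (p - 1))) * wint M (dual_weight p w) (core D Q)"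
proof -
  let ?s = "dual_weight p w" and ?E = "core D Q"
  have [measurable]: "?E \<in> sets M" using finite sets Q by (rule core_sets)
  have sub: "?E \<subseteq> Q" by (auto simp: core_def)
  have "wint M w Q * ennpowr (wint M ?s Q) (p - 1) \<le> ennreal C * ennpowr (emeasure M Q) p"
    using Ap Q by (auto simp: Ap_on_def)
  also have "\<dots> \<le> ennreal C * ennpowr (2 * emeasure M ?E) p"
    using sparse_core[OF sp Q] p by (intro mult_left_mono ennpowr_mono) auto
  also have "\<dots> = ennreal (C * 2 powr p) * ennpowr (emeasure M ?E) p"
    using C ennpowr_ennreal[of 2 p] by (simp add: ennpowr_mult ennreal_mult mult.assoc)
  also have "\<dots> \<le> ennreal (C * 2 powr p) * (wint M w ?E * ennpowr (wint M ?s ?E) (p - 1))"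
    using p w by (intro mult_left_mono emeasure_powr_le_wint) auto
  finally have *: "wint M w Q * ennpowr (wint M ?s Q) (p - 1) \<le> ennreal (C * 2 powr p) * (wint M w ?E * ennpowr (wint M ?s ?E) (p - 1))" .
  note fin = Ap_on_finite[OF p assms(2) w Ap Q]
  have "ennpowr (wint M ?s Q) (p - 1) * wint M w Q \<le> ennpowr (wint M ?s Q) (p - 1) * (ennreal (C * 2 powr p) * wint M w ?E)"
    using * order_trans[OF * mult_left_mono[OF mult_left_mono[OF ennpowr_mono[OF wint_mono[OF sub]]]]] p
    by (simp add: mult_ac)
  then show "wint M w Q \<le> ennreal (C * 2 powr p) * wint M w ?E"
    using fin by (subst (asm) ennreal_mult_le_mult_iff) auto
  have "wint M w Q * ennpowr (wint M ?s Q) (p - 1) \<le> wint M w Q * (ennreal (C * 2 powr p) * ennpowr (wint M ?s ?E) (p - 1))"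
    using * order_trans[OF * mult_left_mono[OF mult_right_mono[OF wint_mono[OF sub]]]]
    by (simp add: mult_ac)
  then have "ennpowr (wint M ?s Q) (p - 1) \<le> ennreal (C * 2 powr p) * ennpowr (wint M ?s ?E) (p - 1)"
    using fin by (subst (asm) ennreal_mult_le_mult_iff) auto
  then have "wint M ?s Q \<le> ennpowr (ennreal (C * 2 powr p) * ennpowr (wint M ?s ?E) (p - 1)) (1 / (p - 1))"
    using p by (subst (asm) ennpowr_le_iff) auto
  then show "wint M ?s Q \<le> ennreal ((C * 2 powr p) powr (1 / (p - 1))) * wint M ?s ?E"
    using p C by (simp add: ennpowr_mult ennpowr_ennreal)
qed

text \<open>Let \<open>a Q\<close> be the integral of \<open>F\<close> over \<open>Q\<close> divided
  by the dual weight of \<open>Q\<close>. The sum \<open>X\<close> of \<open>a Q powr p\<close>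
  times dual weights equals the integral of \<open>F * G\<close>. Hoelder's inequality, and the
  absorption lemma for \<open>G\<close> in the measure given by the dual weight, bound
  \<open>X\<close> by a multiple of its own power \<open>1 - 1 / p\<close>, which is cancelled. The
  \<open>A_p\<close> condition then turns dual weights back into \<open>w\<close>.\<close>

lemma sparse_carleson:
  assumes p: "1 < p" and [measurable]: "w \<in> borel_measurable M" "F \<in> borel_measurable M" and w: "\<And>x. 0 < w x"
    and C: "0 \<le> C" and Ap: "Ap_on M D p C w" and sp: "sparse M D"
  shows "(\<Sum>Q\<in>D. ennpowr (avg M F Q) p * wint M w Q)
    \<le> ennreal (carleson_const p C) * (\<integral>\<^sup>+x. ennpowr (F x) p * ennreal (w x) \<partial>M)"
proof (cases "C = 0 \<or> (\<integral>\<^sup>+x. ennpowr (F x) p * ennreal (w x) \<partial>M) = top")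
  case True
  \<comment> \<open>If the integral on the right is infinite, a positive constant is needed;
    \<open>C = 0\<close> forces an empty family because \<open>A_p\<close> products are
    nonzero.\<close>
  have "C \<noteq> 0" if D: "D \<noteq> {}"
  proof
    assume "C = 0"
    obtain Q where "Q \<in> D" using D by blast
    then show False using Ap Ap_on_finite[OF p assms(2) w Ap] \<open>C = 0\<close> by (auto simp: Ap_on_def)
  qed
  then consider "D = {}" | "C \<noteq> 0" by blast
  then show ?thesis
  proof cases
    case 2
    then have "0 < carleson_const p C" using p C by (simp add: carleson_const_def)
    then show ?thesis using True 2 by (simp add: ennreal_mult_top)
  qed simp
next
  case False
  then have C0: "0 < C" and I_fin: "(\<integral>\<^sup>+x. ennpowr (F x) p * ennreal (w x) \<partial>M) < top"
    using C by (auto simp: less_top)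
  let ?s = "dual_weight p w" and ?I = "\<integral>\<^sup>+x. ennpowr (F x) p * ennreal (w x) \<partial>M"
  define K where "K = (C * 2 powr p) powr (1 / (p - 1))"
  define q where "q = p / (p - 1)"
  have q1: "1 < q" and qp: "(p - 1) * q = p" and q_inv: "1 / q = 1 - 1 / p" using p by (auto simp: q_def field_simps)
  have K0: "0 < K" using C0 by (simp add: K_def)
  have ms [measurable]: "?s \<in> borel_measurable M" unfolding dual_weight_def by measurable
  note fin = Ap_on_finite[OF p assms(2) w Ap]
  have s_pos: "0 < ?s x" for x using w[of x] by (simp add: dual_weight_def)
  define sm where "sm Q = enn2real (wint M ?s Q)" for Q
  have sm: "wint M ?s Q = ennreal (sm Q)" "0 < sm Q" if "Q \<in> D" for Q
    using fin[OF that] unfolding sm_def by (auto simp: enn2real_positive_iff less_top[symmetric] zero_less_iff_neq_zero)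
  define I where "I Q = enn2real (\<integral>\<^sup>+x\<in>Q. F x \<partial>M)" for Q
  \<comment> \<open>Finite by weighted Hoelder, since in this case the weighted integral of
    \<open>ennpowr (F x) p\<close> is finite; from here on the sums are sums of reals.\<close>
  have I: "(\<integral>\<^sup>+x\<in>Q. F x \<partial>M) = ennreal (I Q)" if "Q \<in> D" for Q
  proof -
    have "ennpowr (\<integral>\<^sup>+x\<in>Q. F x \<partial>M) p \<le> (\<integral>\<^sup>+x\<in>Q. ennpowr (F x) p * ennreal (w x) \<partial>M) * ennpowr (wint M ?s Q) (p - 1)"
      using that p w by (intro weighted_Holder) auto
    also have "\<dots> \<le> ?I * ennpowr (wint M ?s Q) (p - 1)"
      by (intro mult_right_mono nn_integral_mono) (auto simp: indicator_def)
    also have "\<dots> < top" using I_fin fin[OF that] by (auto simp: ennreal_mult_eq_top_iff less_top[symmetric])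
    finally show ?thesis unfolding I_def by (simp add: less_top[symmetric])
  qed
  have I0: "0 \<le> I Q" for Q by (simp add: I_def)
  define a where "a Q = (if Q \<in> D then I Q / sm Q else 0)" for Q
  have a0: "0 \<le> a Q" for Q using sm I0 by (auto simp: a_def intro!: divide_nonneg_pos)
  define X where "X = (\<Sum>Q\<in>D. a Q powr p * sm Q)"
  have X0: "0 \<le> X" unfolding X_def using sm by (intro sum_nonneg mult_nonneg_nonneg) (auto intro: less_imp_le)
  \<comment> \<open>The dual function: because \<open>(p - 1) * q = p\<close>, absorption bounds the
    integral of \<open>G powr q\<close> against the dual weight by a multiple of \<open>X\<close>
    again.\<close>
  define G where "G x = (\<Sum>Q\<in>D. a Q powr (p - 1) * indicator Q x)" for x
  have G0: "0 \<le> G x" for x unfolding G_def by (intro sum_nonneg) auto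
  have [measurable]: "G \<in> borel_measurable M" unfolding G_def by measurable
  have aI: "a Q powr p * sm Q = a Q powr (p - 1) * I Q" if "Q \<in> D" for Q
  proof (cases "a Q = 0")
    case False
    then have "a Q powr p = a Q powr (p - 1) * a Q" using a0[of Q] powr_add[of "a Q" "p - 1" 1] by simp
    moreover have "a Q * sm Q = I Q" using that sm[OF that] by (simp add: a_def)
    ultimately show ?thesis by simp
  next
    case True
    then have "I Q = 0" using that sm[OF that] by (simp add: a_def)
    then show ?thesis using True by simp
  qed
  have G_int: "(\<integral>\<^sup>+x. ennreal (G x powr q) * ennreal (?s x) \<partial>M) \<le> ennreal ((q * K) powr q * X)"
  proof -
    let ?N = "density M (\<lambda>x. ennreal (?s x))"
    have N: "emeasure ?N Q = wint M ?s Q" if "Q \<in> sets M" for Q using that by (simp add: wint_eq_density)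
    have cs [measurable]: "core D Q \<in> sets M" if "Q \<in> D" for Q using finite sets that by (rule core_sets)
    have Nm: "measure ?N Q = sm Q" if "Q \<in> D" for Q
      using that sm[OF that] by (simp add: measure_def N sm_def)
    have "(\<integral>\<^sup>+x. ennreal (G x powr q) * ennreal (?s x) \<partial>M) = (\<integral>\<^sup>+x. ennreal (G x powr q) \<partial>?N)"
      by (subst nn_integral_density) (auto simp: mult.commute)
    also have "\<dots> \<le> ennreal ((q * K) powr q * (\<Sum>Q\<in>D. (a Q powr (p - 1)) powr q * measure ?N Q))"
      unfolding G_def
    proof (intro laminar_sum_powr_nn_integral_le)
      fix Q assume Q: "Q \<in> D"
      show "Q \<in> sets ?N" using Q by simp
      show "emeasure ?N Q < top" using Q fin[OF Q] by (simp add: N less_top)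
      have "wint M ?s (core D Q) \<le> wint M ?s Q" by (intro wint_mono) (auto simp: core_def)
      then have cfin: "wint M ?s (core D Q) < top" using fin[OF Q] by (simp add: less_top[symmetric] neq_top_trans)
      have "ennreal (sm Q) \<le> ennreal K * wint M ?s (core D Q)"
        using sparse_Ap_core(2)[OF p assms(2) w C Ap sp Q] sm(1)[OF Q] by (simp add: K_def)
      also have "\<dots> = ennreal (K * measure ?N (core D Q))"
        using cfin K0 cs[OF Q] by (simp add: measure_def N ennreal_mult)
      finally show "measure ?N Q \<le> K * measure ?N (core D Q)"
        using K0 by (simp add: Nm Q)
    qed (use finite lam q1 K0 in auto)
    also have "(\<Sum>Q\<in>D. (a Q powr (p - 1)) powr q * measure ?N Q) = X"
      unfolding X_def by (intro sum.cong refl) (simp add: powr_powr qp Nm)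
    finally show ?thesis .
  qed
  have X_le: "ennreal X \<le> ennreal ((q * K) powr p) * ?I"
  proof (cases "X = 0")
    case False
    have "ennreal X = (\<Sum>Q\<in>D. ennreal (a Q powr (p - 1)) * (\<integral>\<^sup>+x\<in>Q. F x \<partial>M))"
      unfolding X_def by (subst sum_ennreal[symmetric]) (auto simp: aI I ennreal_mult I0 intro!: sum.cong simp del: sum_ennreal)
    also have "\<dots> = (\<integral>\<^sup>+x. (\<Sum>Q\<in>D. ennreal (a Q powr (p - 1)) * (F x * indicator Q x)) \<partial>M)"
      by (subst nn_integral_sum) (auto simp: nn_integral_cmult)
    also have "\<dots> = (\<integral>\<^sup>+x. ennpowr (ennpowr (F x) p * ennreal (w x)) (1 / p) * ennpowr (ennreal (G x powr q) * ennreal (?s x)) (1 - 1 / p) \<partial>M)"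
    proof (intro nn_integral_cong)
      fix x
      note one = dual_weight_mult[of p w x, OF p w]
      have "(\<Sum>Q\<in>D. ennreal (a Q powr (p - 1)) * (F x * indicator Q x)) = F x * (\<Sum>Q\<in>D. ennreal (a Q powr (p - 1) * indicator Q x))"
        unfolding sum_distrib_left by (intro sum.cong refl) (auto simp: indicator_def mult_ac)
      also have "(\<Sum>Q\<in>D. ennreal (a Q powr (p - 1) * indicator Q x)) = ennreal (G x)"
        unfolding G_def by (subst sum_ennreal) auto
      also have "F x * ennreal (G x) = F x * ennpowr (ennreal (w x)) (1 / p) * (ennreal (G x) * ennpowr (ennreal (?s x)) (1 - 1 / p))"
        using one by (metis (no_types, opaque_lifting) mult.assoc mult.commute mult.right_neutral)
      also have "\<dots> = ennpowr (ennpowr (F x) p * ennreal (w x)) (1 / p) * ennpowr (ennreal (G x powr q) * ennreal (?s x)) (1 - 1 / p)"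
        using p G0[of x] q1
        by (simp add: ennpowr_mult ennpowr_ennreal powr_powr q_inv[symmetric])
      finally show "(\<Sum>Q\<in>D. ennreal (a Q powr (p - 1)) * (F x * indicator Q x)) = ennpowr (ennpowr (F x) p * ennreal (w x)) (1 / p) * ennpowr (ennreal (G x powr q) * ennreal (?s x)) (1 - 1 / p)" .
    qed
    also have "\<dots> \<le> ennpowr ?I (1 / p) * ennpowr (\<integral>\<^sup>+x. ennreal (G x powr q) * ennreal (?s x) \<partial>M) (1 - 1 / p)"
      using p by (intro nn_integral_Holder) auto
    also have "\<dots> \<le> ennpowr ?I (1 / p) * ennpowr (ennreal ((q * K) powr q * X)) (1 - 1 / p)"
      using p by (intro mult_left_mono ennpowr_mono G_int) auto
    also have "\<dots> = ennpowr (ennreal X) (1 - 1 / p) * (ennreal (q * K) * ennpowr ?I (1 / p))"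
      using X0 q1 K0 by (simp add: ennreal_mult ennpowr_mult ennpowr_ennreal powr_powr q_inv[symmetric] mult_ac)
    finally have "ennpowr (ennreal X) (1 - 1 / p) * ennpowr (ennreal X) (1 / p) \<le> ennpowr (ennreal X) (1 - 1 / p) * (ennreal (q * K) * ennpowr ?I (1 / p))"
      using p by (subst ennpowr_add[symmetric]) auto
    then have "ennpowr (ennreal X) (1 / p) \<le> ennreal (q * K) * ennpowr ?I (1 / p)"
      using False X0 by (subst (asm) ennreal_mult_le_mult_iff) auto
    then have "ennreal X \<le> ennpowr (ennreal (q * K) * ennpowr ?I (1 / p)) p"
      using p by (subst (asm) ennpowr_le_iff) auto
    then show ?thesis using p q1 K0 by (simp add: ennpowr_mult ennpowr_ennreal)
  qed simp
  have "(\<Sum>Q\<in>D. ennpowr (avg M F Q) p * wint M w Q) \<le> (\<Sum>Q\<in>D. ennreal C * ennreal (a Q powr p * sm Q))"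
  proof (intro sum_mono)
    fix Q assume Q: "Q \<in> D"
    have m: "emeasure M Q = ennreal (measure M Q)" "0 < measure M Q" using Q emeasure_eq measure_pos by auto
    obtain wq where wq: "wint M w Q = ennreal wq" "0 < wq"
      using fin[OF Q] by (cases "wint M w Q") auto
    have "ennreal (wq * sm Q powr (p - 1)) \<le> ennreal (C * measure M Q powr p)"
      using Ap Q sm[OF Q] wq m C by (auto simp: Ap_on_def ennpowr_ennreal ennreal_mult)
    then have A: "wq * sm Q powr (p - 1) \<le> C * measure M Q powr p"
      using C by (subst (asm) ennreal_le_iff) auto
    have I_eq: "I Q = a Q * sm Q" using Q sm[OF Q] by (simp add: a_def)
    \<comment> \<open>The last parenthesis in the numerator is the \<open>A_p\<close> product on
      \<open>Q\<close>, bounded by \<open>C * measure M Q powr p\<close>.\<close>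
    have "(I Q / measure M Q) powr p * wq = a Q powr p * sm Q * (wq * sm Q powr (p - 1)) / measure M Q powr p"
      using m sm[OF Q] a0[of Q] powr_add[of "sm Q" "p - 1" 1] by (simp add: I_eq powr_divide powr_mult)
    also have "\<dots> \<le> a Q powr p * sm Q * (C * measure M Q powr p) / measure M Q powr p"
      using A sm[OF Q] by (intro divide_right_mono mult_left_mono) auto
    also have "\<dots> = C * (a Q powr p * sm Q)" using m by simp
    finally have "(I Q / measure M Q) powr p * wq \<le> C * (a Q powr p * sm Q)" .
    then have "ennreal ((I Q / measure M Q) powr p * wq) \<le> ennreal (C * (a Q powr p * sm Q))" by (rule ennreal_leI)
    moreover have "avg M F Q = ennreal (I Q / measure M Q)"
      unfolding avg_def using I[OF Q] I0[of Q] m by (simp add: divide_ennreal)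
    ultimately show "ennpowr (avg M F Q) p * wint M w Q \<le> ennreal C * ennreal (a Q powr p * sm Q)"
      using wq I0[of Q] m ennreal_mult'[OF C, of "a Q powr p * sm Q"] by (simp add: ennpowr_ennreal ennreal_mult'')
  qed
  also have "\<dots> = ennreal C * ennreal X"
    unfolding X_def sum_distrib_left[symmetric]
    by (subst sum_ennreal) (auto intro!: mult_nonneg_nonneg sm(2)[THEN less_imp_le])
  also have "\<dots> \<le> ennreal C * (ennreal ((q * K) powr p) * ?I)"
    by (intro mult_left_mono X_le) auto
  also have "\<dots> = ennreal (carleson_const p C) * ?I"
    using C by (simp add: carleson_const_def q_def K_def ennreal_mult mult.assoc)
  finally show ?thesis .
qed

end

section \<open>Sparse domination\<close>

definition dmax :: "'a measure \<Rightarrow> 'a set set \<Rightarrow> ('a \<Rightarrow> ennreal) \<Rightarrow> 'a \<Rightarrow> ennreal" where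
  "dmax M D f x = (SUP Q\<in>D. avg M f Q * indicator Q x)"

text \<open>The \<open>r\<close>-th power of the sequence norm rather than the norm: contributions
  of different stopping levels then simply add.\<close>

definition vmax :: "'a measure \<Rightarrow> real \<Rightarrow> 'a set set \<Rightarrow> (nat \<Rightarrow> 'a \<Rightarrow> ennreal) \<Rightarrow> 'a \<Rightarrow> ennreal" where
  "vmax M r D f x = (\<Sum>k. ennpowr (dmax M D (f k) x) r)"

definition below :: "'a set set \<Rightarrow> 'a set \<Rightarrow> 'a set set" where
  "below D Q = {P\<in>D. P \<subseteq> Q}"

definition maximal :: "'a set set \<Rightarrow> 'a set set" where
  "maximal D = {Q\<in>D. \<forall>P\<in>D. Q \<subseteq> P \<longrightarrow> P = Q}"

lemma dmax_upper: "Q \<in> D \<Longrightarrow> x \<in> Q \<Longrightarrow> avg M f Q \<le> dmax M D f x"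
  unfolding dmax_def by (rule SUP_upper2[of Q]) auto

lemma dmax_least: "(\<And>Q. Q \<in> D \<Longrightarrow> x \<in> Q \<Longrightarrow> avg M f Q \<le> u) \<Longrightarrow> dmax M D f x \<le> u"
  unfolding dmax_def by (rule SUP_least) (auto simp: indicator_def)

lemma less_dmax_iff: "u < dmax M D f x \<longleftrightarrow> (\<exists>Q\<in>D. x \<in> Q \<and> u < avg M f Q)"
  unfolding dmax_def by (auto simp: less_SUP_iff indicator_def split: if_splits)

lemma dmax_cong: "(\<And>Q. Q \<in> D \<Longrightarrow> x \<in> Q \<Longrightarrow> avg M f Q = avg M g Q) \<Longrightarrow> dmax M D f x = dmax M D g x"
  unfolding dmax_def by (intro SUP_cong) (auto simp: indicator_def)

lemma vmax_mono:
  "0 \<le> r \<Longrightarrow> (\<And>k. dmax M D (f k) x \<le> dmax M E (g k) y) \<Longrightarrow> vmax M r D f x \<le> vmax M r E g y"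
  unfolding vmax_def by (intro suminf_le ennpowr_mono) auto

lemma maximal_exists:
  assumes "finite D" "Q \<in> D"
  obtains P where "P \<in> maximal D" "Q \<subseteq> P"
proof -
  obtain P where P: "P \<in> D" "Q \<subseteq> P" "\<forall>R\<in>D. P \<subseteq> R \<longrightarrow> P = R"
    using finite_has_maximal2[OF assms] by auto
  then have "P \<in> maximal D" unfolding maximal_def by blast
  then show thesis using that P(2) by blast
qed

lemma maximal_subset: "maximal D \<subseteq> D"
  unfolding maximal_def by blast

lemma maximal_disjoint:
  "laminar D \<Longrightarrow> P \<in> maximal D \<Longrightarrow> Q \<in> maximal D \<Longrightarrow> x \<in> P \<Longrightarrow> x \<in> Q \<Longrightarrow> P = Q"
  using laminarD[of D P Q x] unfolding maximal_def by blast

context finite_laminar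
begin

lemma nonempty: "Q \<in> D \<Longrightarrow> Q \<noteq> {}"
  using nonnull by auto

lemma measurable_dmax [measurable]: "dmax M D f \<in> borel_measurable M"
proof -
  have "countable D" using finite by (rule countable_finite)
  then show ?thesis unfolding dmax_def[abs_def] by measurable
qed

lemma measurable_vmax [measurable]: "vmax M r D f \<in> borel_measurable M"
  unfolding vmax_def[abs_def] by measurable

text \<open>Sparseness at \<open>Q\<close> only looks at smaller members, and a nonempty set below
  one element of \<open>T\<close> cannot lie below another one, which is disjoint. So the families
  do not interact.\<close>

lemma sparse_Union:
  assumes T: "T \<subseteq> D" "\<And>P Q x. P \<in> T \<Longrightarrow> Q \<in> T \<Longrightarrow> x \<in> P \<Longrightarrow> x \<in> Q \<Longrightarrow> P = Q"
    and S: "\<And>P. P \<in> T \<Longrightarrow> S P \<subseteq> below D P" "\<And>P. P \<in> T \<Longrightarrow> sparse M (S P)"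
  shows "sparse M (\<Union>P\<in>T. S P)"
  unfolding sparse_def
proof
  fix Q assume "Q \<in> (\<Union>P\<in>T. S P)"
  then obtain P where P: "P \<in> T" "Q \<in> S P" by blast
  have "R \<in> S P" if R: "R \<in> S P'" "P' \<in> T" "R \<subset> Q" for R P'
  proof -
    have "Q \<subseteq> P" "R \<in> D" "R \<subseteq> P'" using R S(1)[of P'] S(1)[of P] P by (auto simp: below_def)
    moreover have "R \<subseteq> P" using R(3) \<open>Q \<subseteq> P\<close> by blast
    ultimately have "P' = P" using nonempty[of R] T(2)[OF R(2) P(1)] by blast
    then show ?thesis using R by simp
  qed
  then have "{R \<in> \<Union> (S ` T). R \<subset> Q} = {R \<in> S P. R \<subset> Q}" using P by blast
  then show "2 * emeasure M (\<Union> {R \<in> \<Union> (S ` T). R \<subset> Q}) \<le> emeasure M Q"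
    using S(2)[OF P(1)] P(2) by (simp add: sparse_def)
qed

text \<open>\<open>T\<close> plays the smallest member strictly above \<open>P\<close>. A member
  through \<open>x\<close> either lies below \<open>P\<close>, or contains \<open>T\<close> and with
  it \<open>y\<close>. Hence each maximum at \<open>x\<close> is at most the maximum at
  \<open>y\<close> or the one below \<open>P\<close>, and the larger of two powers is at most their
  sum.\<close>

lemma vmax_below_split:
  assumes P: "P \<in> below D Q" "x \<in> P" and Tx: "T \<in> below D Q" "\<And>R. R \<in> below D Q \<Longrightarrow> P \<subset> R \<Longrightarrow> T \<subseteq> R" "y \<in> T"
    and r: "0 < r"
  shows "vmax M r (below D Q) f x \<le> vmax M r (below D Q) f y + vmax M r (below D P) f x"
proof -
  have "ennpowr (dmax M (below D Q) (f k) x) r \<le> ennpowr (dmax M (below D Q) (f k) y) r + ennpowr (dmax M (below D P) (f k) x) r" for k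
  proof -
    have "dmax M (below D Q) (f k) x \<le> max (dmax M (below D Q) (f k) y) (dmax M (below D P) (f k) x)"
    proof (rule dmax_least)
      fix R assume R: "R \<in> below D Q" "x \<in> R"
      then consider "R \<subseteq> P" | "P \<subset> R"
        using laminarD[OF lam, of R P x] P by (auto simp: below_def)
      then show "avg M (f k) R \<le> max (dmax M (below D Q) (f k) y) (dmax M (below D P) (f k) x)"
      proof cases
        case 1
        then show ?thesis using R by (intro max.coboundedI2 dmax_upper) (auto simp: below_def)
      next
        case 2
        then show ?thesis using R Tx by (intro max.coboundedI1 dmax_upper) auto
      qed
    qed
    then have "ennpowr (dmax M (below D Q) (f k) x) r \<le> ennpowr (max (dmax M (below D Q) (f k) y) (dmax M (below D P) (f k) x)) r"
      using r by (intro ennpowr_mono) auto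
    also have "\<dots> \<le> ennpowr (dmax M (below D Q) (f k) y) r + ennpowr (dmax M (below D P) (f k) x) r"
      by (auto simp: max_def)
    finally show ?thesis .
  qed
  then show ?thesis unfolding vmax_def by (subst suminf_add) (auto intro: suminf_le)
qed

text \<open>Stopping argument, by induction on the number of members inside \<open>Q\<close>. The
  set \<open>E\<close> where \<open>c Q\<close> is exceeded fills at most half of \<open>Q\<close>
  and is a union of members. The term of \<open>Q\<close> pays for points outside \<open>E\<close>;
  inside, the induction hypothesis for the maximal members contained in \<open>E\<close> is added to
  it. Smallness of \<open>E\<close> is sparseness at \<open>Q\<close>.\<close>

lemma sparse_domination_below:
  assumes r: "0 < r"
    and weak: "\<And>Q. Q \<in> D \<Longrightarrow> 2 * emeasure M {x\<in>Q. c Q < vmax M r (below D Q) f x} \<le> emeasure M Q"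
    and "Q \<in> D"
  shows "\<exists>S\<subseteq>below D Q. sparse M S \<and> (\<forall>x\<in>Q. vmax M r (below D Q) f x \<le> (\<Sum>R\<in>S. c R * indicator R x))"
  using \<open>Q \<in> D\<close>
proof (induction "card (below D Q)" arbitrary: Q rule: less_induct)
  case less
  note Q = \<open>Q \<in> D\<close>
  let ?B = "below D Q"
  have finB: "finite ?B" and subB: "?B \<subseteq> D" and QB: "Q \<in> ?B" using finite Q by (auto simp: below_def)
  have lamB: "laminar ?B" using lam subB by (rule laminar_subset)
  define E where "E = {x\<in>Q. c Q < vmax M r ?B f x}"
  define T where "T = maximal {P\<in>?B. P \<subseteq> E}"
  have T: "P \<in> ?B" "P \<subseteq> E" "\<And>R. R \<in> ?B \<Longrightarrow> P \<subset> R \<Longrightarrow> \<not> R \<subseteq> E" if "P \<in> T" for P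
    using that by (auto simp: T_def maximal_def)
  have T_disj: "P = R" if "P \<in> T" "R \<in> T" "x \<in> P" "x \<in> R" for P R x
    using that maximal_disjoint[of "{P\<in>?B. P \<subseteq> E}"] laminar_subset[OF lamB] by (auto simp: T_def)
  have cover: "\<exists>P\<in>T. x \<in> P" if x: "x \<in> E" for x
  proof -
    have "finite {R\<in>?B. x \<in> R}" "{R\<in>?B. x \<in> R} \<noteq> {}" using finB QB x by (auto simp: E_def)
    from finite_has_minimal[OF this] obtain R where R: "R \<in> ?B" "x \<in> R" "\<And>P. P \<in> ?B \<Longrightarrow> x \<in> P \<Longrightarrow> P \<subseteq> R \<Longrightarrow> P = R"
      by (metis (mono_tags, lifting) mem_Collect_eq)
    have R': "R \<subseteq> P" if "P \<in> ?B" "x \<in> P" for P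
      using laminarD[OF lamB that(1) R(1) that(2) R(2)] R(3)[OF that] by blast
    \<comment> \<open>\<open>R\<close> is the smallest member through \<open>x\<close>, so every
      member through \<open>x\<close> contains all of \<open>R\<close>: the maxima can only grow on
      \<open>R\<close>.\<close>
    have "R \<subseteq> E"
    proof
      fix y assume y: "y \<in> R"
      have "vmax M r ?B f x \<le> vmax M r ?B f y"
        using r R' y by (intro vmax_mono dmax_least dmax_upper) auto
      then show "y \<in> E" using x y R(1) by (auto simp: E_def below_def)
    qed
    then obtain P where "P \<in> T" "R \<subseteq> P"
      using maximal_exists[of "{P\<in>?B. P \<subseteq> E}" R] finB R unfolding T_def by auto
    then show ?thesis using R by blast
  qed
  have E_eq: "E = \<Union>T" using cover T by blast
  have finT: "finite T" using finB finite_subset[of T ?B] T by blast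
  have E_sets: "E \<in> sets M" unfolding E_eq using finT T(1) subB sets by (intro sets.finite_Union) blast+
  have E_small: "2 * emeasure M E \<le> emeasure M Q" unfolding E_def using weak[OF Q] .
  have PQ: "P \<subset> Q" if "P \<in> T" for P
  proof -
    have "P \<subseteq> Q" using T[OF that] by (auto simp: below_def)
    \<comment> \<open>Otherwise \<open>E = Q\<close> would have at most half of its own positive
      measure. Strict inclusion is what makes the induction decrease.\<close>
    moreover have "P \<noteq> Q"
    proof
      assume "P = Q"
      then have "E = Q" using T(2)[OF that] by (auto simp: E_def)
      then have "2 * emeasure M Q \<le> emeasure M Q" using E_small by simp
      then have "2 * measure M Q \<le> measure M Q"
        unfolding emeasure_eq[OF Q] by (subst (asm) numeral_mult_ennreal) auto
      then show False using measure_pos[OF Q] by simp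
    qed
    ultimately show ?thesis by blast
  qed
  have "\<exists>S\<subseteq>below D P. sparse M S \<and> (\<forall>x\<in>P. vmax M r (below D P) f x \<le> (\<Sum>R\<in>S. c R * indicator R x))" if "P \<in> T" for P
  proof (rule less.hyps)
    have "below D P \<subset> below D Q" using PQ[OF that] Q by (auto simp: below_def)
    then show "card (below D P) < card (below D Q)" using finB by (rule psubset_card_mono[rotated])
    show "P \<in> D" using T(1)[OF that] subB by blast
  qed
  then obtain S where S: "\<And>P. P \<in> T \<Longrightarrow> S P \<subseteq> below D P" "\<And>P. P \<in> T \<Longrightarrow> sparse M (S P)"
    "\<And>P x. P \<in> T \<Longrightarrow> x \<in> P \<Longrightarrow> vmax M r (below D P) f x \<le> (\<Sum>R\<in>S P. c R * indicator R x)"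
    by metis
  let ?U = "\<Union>P\<in>T. S P"
  have spU: "sparse M ?U"
    using S(1,2) T(1) subB T_disj by (intro sparse_Union) blast+
  have U_sub: "R \<subseteq> E" "R \<subset> Q" "R \<in> D" if R: "R \<in> ?U" for R
  proof -
    obtain P where P: "P \<in> T" "R \<in> S P" using R by blast
    then have "R \<in> D" "R \<subseteq> P" using S(1)[OF P(1)] by (auto simp: below_def)
    then show "R \<subseteq> E" "R \<subset> Q" "R \<in> D" using T(2)[OF P(1)] PQ[OF P(1)] by blast+
  qed
  have finU: "finite ?U" using U_sub(3) finite by (meson finite_subset subsetI)
  have QU: "Q \<notin> ?U" using U_sub(2) by blast
  show ?case
  proof (intro exI[of _ "insert Q ?U"] conjI ballI)
    have "R \<in> ?B" if "R \<in> ?U" for R using U_sub(2,3)[OF that] unfolding below_def by blast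
    then show "insert Q ?U \<subseteq> ?B" using QB by blast
    show "sparse M (insert Q ?U)"
      unfolding sparse_def
    proof
      fix R assume "R \<in> insert Q ?U"
      then consider "R = Q" | "R \<in> ?U" by blast
      then show "2 * emeasure M (\<Union> {P \<in> insert Q ?U. P \<subset> R}) \<le> emeasure M R"
      proof cases
        case 1
        have "\<Union> {P \<in> insert Q ?U. P \<subset> R} \<subseteq> E" using 1 U_sub(1) by blast
        then have "2 * emeasure M (\<Union> {P \<in> insert Q ?U. P \<subset> R}) \<le> 2 * emeasure M E"
          using E_sets by (intro mult_left_mono emeasure_mono) auto
        then show ?thesis using E_small 1 by simp
      next
        case 2
        then have eq: "{P \<in> insert Q ?U. P \<subset> R} = {P \<in> ?U. P \<subset> R}" using U_sub(2)[of R] by blast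
        have "2 * emeasure M (\<Union> {P \<in> ?U. P \<subset> R}) \<le> emeasure M R"
          using spU 2 unfolding sparse_def by (rule bspec)
        then show ?thesis by (simp only: eq)
      qed
    qed
    fix x assume x: "x \<in> Q"
    have ins: "(\<Sum>R\<in>insert Q ?U. c R * indicator R x) = c Q + (\<Sum>R\<in>?U. c R * indicator R x)"
      unfolding sum.insert[OF finU QU] using x by (simp only: indicator_simps mult_1_right)
    show "vmax M r ?B f x \<le> (\<Sum>R\<in>insert Q ?U. c R * indicator R x)"
    proof (cases "x \<in> E")
      case False
      then have "vmax M r ?B f x \<le> c Q" using x by (auto simp: E_def)
      also have "\<dots> \<le> (\<Sum>R\<in>insert Q ?U. c R * indicator R x)"
        unfolding ins by (rule add_increasing2[OF zero_le order_refl])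
      finally show ?thesis .
    next
      case True
      then obtain P where P: "P \<in> T" "x \<in> P" using cover by blast
      \<comment> \<open>The smallest member strictly above \<open>P\<close> is not contained in
        \<open>E\<close> by maximality of \<open>P\<close>, so it has a point \<open>y\<close> where
        the value is at most \<open>c Q\<close>; this bounds the influence of all members above
        \<open>P\<close>.\<close>
      let ?Z = "{R\<in>?B. P \<subset> R}"
      have "finite ?Z" "?Z \<noteq> {}" using finB QB PQ[OF P(1)] by auto
      from finite_has_minimal[OF this] obtain R where R: "R \<in> ?B" "P \<subset> R" "\<And>R'. R' \<in> ?B \<Longrightarrow> P \<subset> R' \<Longrightarrow> R' \<subseteq> R \<Longrightarrow> R' = R"
        by (metis (mono_tags, lifting) mem_Collect_eq)
      have R': "R \<subseteq> R'" if "R' \<in> ?B" "P \<subset> R'" for R'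
        using laminarD[OF lamB that(1) R(1), of x] that P(2) R by blast
      obtain y where y: "y \<in> R" "y \<notin> E" using T(3)[OF P(1) R(1,2)] by blast
      have "vmax M r ?B f x \<le> vmax M r ?B f y + vmax M r (below D P) f x"
        using T(1)[OF P(1)] P(2) R(1) R' y(1) r by (intro vmax_below_split)
      also have "\<dots> \<le> c Q + (\<Sum>R\<in>S P. c R * indicator R x)"
        using y R(1) S(3)[OF P] by (intro add_mono) (auto simp: E_def below_def)
      also have "\<dots> \<le> c Q + (\<Sum>R\<in>?U. c R * indicator R x)"
        using P(1) finU by (intro add_left_mono sum_mono2) auto
      finally show ?thesis unfolding ins .
    qed
  qed
qed

text \<open>One application of \<open>sparse_domination_below\<close> for each maximal member; these
  are disjoint, and all members through a point of one of them lie below it.\<close>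

lemma sparse_domination:
  assumes r: "0 < r"
    and weak: "\<And>Q. Q \<in> D \<Longrightarrow> 2 * emeasure M {x\<in>Q. c Q < vmax M r (below D Q) f x} \<le> emeasure M Q"
  obtains S where "S \<subseteq> D" "sparse M S" "\<And>x. vmax M r D f x \<le> (\<Sum>R\<in>S. c R * indicator R x)"
proof -
  let ?T = "maximal D"
  have T: "P \<in> D" if "P \<in> ?T" for P using that maximal_subset by blast
  have "\<exists>S\<subseteq>below D P. sparse M S \<and> (\<forall>x\<in>P. vmax M r (below D P) f x \<le> (\<Sum>R\<in>S. c R * indicator R x))" if "P \<in> ?T" for P
    using r weak T[OF that] by (rule sparse_domination_below)
  then obtain S where S: "\<And>P. P \<in> ?T \<Longrightarrow> S P \<subseteq> below D P" "\<And>P. P \<in> ?T \<Longrightarrow> sparse M (S P)"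
    "\<And>P x. P \<in> ?T \<Longrightarrow> x \<in> P \<Longrightarrow> vmax M r (below D P) f x \<le> (\<Sum>R\<in>S P. c R * indicator R x)"
    by metis
  let ?U = "\<Union>P\<in>?T. S P"
  have UD: "?U \<subseteq> D" using S(1) by (auto simp: below_def)
  show ?thesis
  proof
    show "?U \<subseteq> D" by (rule UD)
    show "sparse M ?U"
      using S(1,2) T maximal_disjoint[OF lam] by (intro sparse_Union) blast+
    fix x
    show "vmax M r D f x \<le> (\<Sum>R\<in>?U. c R * indicator R x)"
    proof (cases "\<exists>Q\<in>D. x \<in> Q")
      case True
      then obtain P where P: "P \<in> ?T" "x \<in> P" using maximal_exists[OF finite] by (metis subsetD)
      have "R \<subseteq> P" if "R \<in> D" "x \<in> R" for R
        using laminarD[OF lam that(1) T[OF P(1)] that(2) P(2)] P(1) that by (auto simp: maximal_def)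
      then have "vmax M r D f x \<le> vmax M r (below D P) f x"
        using r by (intro vmax_mono dmax_least dmax_upper) (auto simp: below_def)
      also have "\<dots> \<le> (\<Sum>R\<in>S P. c R * indicator R x)" by (rule S(3)[OF P])
      also have "\<dots> \<le> (\<Sum>R\<in>?U. c R * indicator R x)"
        using P(1) finite_subset[OF UD finite] by (intro sum_mono2) auto
      finally show ?thesis .
    next
      case False
      then have "dmax M D (f k) x = 0" for k by (intro antisym dmax_least) auto
      then show ?thesis by (simp add: vmax_def)
    qed
  qed
qed

end

text \<open>\<open>A\<close> is the factor in front of the averages in the weak bound. The maximum
  covers both \<open>p \<le> r\<close>, where 1 suffices, and \<open>p > r\<close>, where absorption
  with exponent \<open>p / r\<close> gives the other value. The last factor comes from the Carleson
  sum.\<close>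

definition strong_const :: "real \<Rightarrow> real \<Rightarrow> real \<Rightarrow> real \<Rightarrow> real" where
  "strong_const r p A C = A powr p * max 1 ((p / r * (C * 2 powr p)) powr (p / r)) * carleson_const p C"

text \<open>The first \<open>C\<close> comes from the stopped set. The other term is the bound for
  exponent \<open>r\<close> applied to the good part, whose averages are at most \<open>d\<close>
  times the level; this produces \<open>d powr (r - 1)\<close>.\<close>

definition weak_const :: "real \<Rightarrow> real \<Rightarrow> real \<Rightarrow> real" where
  "weak_const r d C = C + strong_const 1 r 2 C * (d powr (r - 1) * C)"

text \<open>The exceptional null set may depend on \<open>Q\<close>; each later use concerns one
  member at a time.\<close>

definition A1_on :: "'a measure \<Rightarrow> 'a set set \<Rightarrow> real \<Rightarrow> ('a \<Rightarrow> real) \<Rightarrow> bool" where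
  "A1_on M D C w \<longleftrightarrow> (\<forall>Q\<in>D. AE x in M. x \<in> Q \<longrightarrow> wint M w Q \<le> ennreal (C * w x) * emeasure M Q)"

lemma carleson_const_pos: "1 < p \<Longrightarrow> 0 < C \<Longrightarrow> 0 < carleson_const p C"
  by (simp add: carleson_const_def)

lemma strong_const_pos: "1 < p \<Longrightarrow> 0 < C \<Longrightarrow> 0 < A \<Longrightarrow> 0 < strong_const r p A C"
  by (simp add: strong_const_def carleson_const_pos)

lemma weak_const_pos: "1 < r \<Longrightarrow> 0 < C \<Longrightarrow> 0 < d \<Longrightarrow> 0 < weak_const r d C"
  using strong_const_pos[of r C 2 1] by (simp add: weak_const_def add_pos_pos)

lemma nn_integral_disjoint_Union:
  assumes "finite T" "\<And>P. P \<in> T \<Longrightarrow> P \<in> sets M" "\<And>P Q x. P \<in> T \<Longrightarrow> Q \<in> T \<Longrightarrow> x \<in> P \<Longrightarrow> x \<in> Q \<Longrightarrow> P = Q"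
    "g \<in> borel_measurable M"
  shows "(\<integral>\<^sup>+x\<in>\<Union>T. g x \<partial>M) = (\<Sum>P\<in>T. \<integral>\<^sup>+x\<in>P. g x \<partial>M)"
proof -
  have disj: "disjoint_family_on (\<lambda>P. P) T"
    using assms(3) unfolding disjoint_family_on_def by blast
  have "indicator (\<Union>T) x = (\<Sum>P\<in>T. indicator P x :: ennreal)" for x
    using indicator_UN_disjoint[OF assms(1) disj, of x] by (simp only: image_ident)
  then have "(\<integral>\<^sup>+x\<in>\<Union>T. g x \<partial>M) = (\<integral>\<^sup>+x. (\<Sum>P\<in>T. g x * indicator P x) \<partial>M)"
    by (simp only: sum_distrib_left)
  also have "\<dots> = (\<Sum>P\<in>T. \<integral>\<^sup>+x\<in>P. g x \<partial>M)"
    using assms by (intro nn_integral_sum) auto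
  finally show ?thesis .
qed

context finite_laminar
begin

lemma avg_eq: "Q \<in> D \<Longrightarrow> avg M f Q = ennreal (1 / measure M Q) * (\<integral>\<^sup>+x\<in>Q. f x \<partial>M)"
  unfolding avg_def using emeasure_eq[of Q] measure_pos[of Q]
  by (simp add: divide_ennreal_def inverse_ennreal mult.commute field_simps)

lemma maximal_sum_le:
  assumes "T \<subseteq> D" "\<And>P Q x. P \<in> T \<Longrightarrow> Q \<in> T \<Longrightarrow> x \<in> P \<Longrightarrow> x \<in> Q \<Longrightarrow> P = Q"
    "g \<in> borel_measurable M" "\<And>P. P \<in> T \<Longrightarrow> P \<subseteq> X"
  shows "(\<Sum>P\<in>T. \<integral>\<^sup>+x\<in>P. g x \<partial>M) \<le> (\<integral>\<^sup>+x\<in>X. g x \<partial>M)"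
proof -
  have "(\<Sum>P\<in>T. \<integral>\<^sup>+x\<in>P. g x \<partial>M) = (\<integral>\<^sup>+x\<in>\<Union>T. g x \<partial>M)"
  proof (rule nn_integral_disjoint_Union[symmetric])
    show "finite T" using assms(1) finite by (rule finite_subset)
    show "P \<in> sets M" if "P \<in> T" for P using that assms(1) by auto
  qed (fact assms(2,3))+
  also have "\<dots> \<le> (\<integral>\<^sup>+x\<in>X. g x \<partial>M)"
    using assms(4) by (intro nn_integral_mono) (auto simp: indicator_def)
  finally show ?thesis .
qed

text \<open>Sparse domination with the threshold \<open>ennpowr (ennreal A * avg M F Q) r\<close>
  reduces the integrand to the power \<open>p / r\<close> of a sum over a sparse family. If
  \<open>p \<le> r\<close> this power is subadditive; if \<open>p > r\<close> the absorption lemma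
  applies in the measure with density \<open>w\<close>, where cores stay comparable to members by
  \<open>sparse_Ap_core\<close>. Both cases lead to the same Carleson sum.\<close>

lemma strong_of_weak:
  assumes r: "0 < r" and p: "1 < p" and A: "0 < A" and C: "0 < C"
    and [measurable]: "w \<in> borel_measurable M" "F \<in> borel_measurable M" and w: "\<And>x. 0 < w x"
    and Ap: "Ap_on M D p C w"
    and weak: "\<And>Q. Q \<in> D \<Longrightarrow> 2 * emeasure M {x\<in>Q. ennpowr (ennreal A * avg M F Q) r < vmax M r (below D Q) f x} \<le> emeasure M Q"
  shows "(\<integral>\<^sup>+x. ennpowr (vmax M r D f x) (p / r) * ennreal (w x) \<partial>M)
    \<le> ennreal (strong_const r p A C) * (\<integral>\<^sup>+x. ennpowr (F x) p * ennreal (w x) \<partial>M)"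
proof (cases "(\<integral>\<^sup>+x. ennpowr (F x) p * ennreal (w x) \<partial>M) = top")
  case True
  then show ?thesis using strong_const_pos[OF p C A, of r] by (simp add: ennreal_mult_top)
next
  case False
  let ?I = "\<integral>\<^sup>+x. ennpowr (F x) p * ennreal (w x) \<partial>M"
  let ?m = "max 1 ((p / r * (C * 2 powr p)) powr (p / r))"
  obtain S where S: "S \<subseteq> D" "sparse M S"
    "\<And>x. vmax M r D f x \<le> (\<Sum>R\<in>S. ennpowr (ennreal A * avg M F R) r * indicator R x)"
    using sparse_domination[OF r weak] by metis
  interpret S: finite_laminar M S using S(1) by (rule finite_laminar_subset)
  have ApS: "Ap_on M S p C w" using Ap S(1) by (auto simp: Ap_on_def)
  have C0: "0 \<le> C" using C by simp
  note carl = S.sparse_carleson[OF p assms(5,6) w C0 ApS S(2)]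
  note finS = S.Ap_on_finite[OF p assms(5) w ApS]
  have "(\<integral>\<^sup>+x. ennpowr (vmax M r D f x) (p / r) * ennreal (w x) \<partial>M)
    \<le> (\<integral>\<^sup>+x. ennpowr (\<Sum>R\<in>S. ennpowr (ennreal A * avg M F R) r * indicator R x) (p / r) * ennreal (w x) \<partial>M)"
    using p r by (intro nn_integral_mono mult_right_mono ennpowr_mono S(3)) auto
  also have "\<dots> \<le> ennreal (A powr p * ?m) * (\<Sum>Q\<in>S. ennpowr (avg M F Q) p * wint M w Q)"
  proof (cases "p \<le> r")
    case True
    have "ennpowr (\<Sum>R\<in>S. ennpowr (ennreal A * avg M F R) r * indicator R x) (p / r) * ennreal (w x)
      \<le> (\<Sum>R\<in>S. ennreal (A powr p) * ennpowr (avg M F R) p * (ennreal (w x) * indicator R x))" for x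
    proof -
      have "ennpowr (\<Sum>R\<in>S. ennpowr (ennreal A * avg M F R) r * indicator R x) (p / r)
        \<le> (\<Sum>R\<in>S. ennpowr (ennpowr (ennreal A * avg M F R) r * indicator R x) (p / r))"
        using True p r by (intro ennpowr_sum_le) auto
      also have "\<dots> = (\<Sum>R\<in>S. ennreal (A powr p) * ennpowr (avg M F R) p * indicator R x)"
        using A p r by (intro sum.cong refl) (auto simp: ennpowr_mult ennpowr_ennpowr ennpowr_ennreal indicator_def powr_powr)
      finally have "ennpowr (\<Sum>R\<in>S. ennpowr (ennreal A * avg M F R) r * indicator R x) (p / r) * ennreal (w x)
        \<le> (\<Sum>R\<in>S. ennreal (A powr p) * ennpowr (avg M F R) p * indicator R x) * ennreal (w x)"
        by (rule mult_right_mono) simp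
      also have "\<dots> = (\<Sum>R\<in>S. ennreal (A powr p) * ennpowr (avg M F R) p * (ennreal (w x) * indicator R x))"
        unfolding sum_distrib_right by (intro sum.cong refl) (simp add: mult_ac)
      finally show ?thesis .
    qed
    then have "(\<integral>\<^sup>+x. ennpowr (\<Sum>R\<in>S. ennpowr (ennreal A * avg M F R) r * indicator R x) (p / r) * ennreal (w x) \<partial>M)
      \<le> (\<integral>\<^sup>+x. (\<Sum>R\<in>S. ennreal (A powr p) * ennpowr (avg M F R) p * (ennreal (w x) * indicator R x)) \<partial>M)"
      by (rule nn_integral_mono)
    also have "\<dots> = ennreal (A powr p) * (\<Sum>Q\<in>S. ennpowr (avg M F Q) p * wint M w Q)"
      unfolding wint_def sum_distrib_left
      by (subst nn_integral_sum) (auto simp: nn_integral_cmult mult.assoc intro!: sum.cong)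
    also have "\<dots> \<le> ennreal (A powr p * ?m) * (\<Sum>Q\<in>S. ennpowr (avg M F Q) p * wint M w Q)"
      by (intro mult_right_mono ennreal_leI mult_le_cancel_left1[THEN iffD2]) auto
    finally show ?thesis .
  next
    case False
    define q where "q = p / r"
    have q1: "1 \<le> q" using False r by (simp add: q_def)
    \<comment> \<open>An infinite average would make the Carleson sum infinite although its bound is
      finite; so the coefficients \<open>b\<close> are real.\<close>
    have avg_fin: "avg M F Q \<noteq> top" if "Q \<in> S" for Q
    proof
      assume "avg M F Q = top"
      then have "ennpowr (avg M F Q) p * wint M w Q = top" using finS[OF that] by (simp add: ennreal_top_mult)
      then have "(\<Sum>Q\<in>S. ennpowr (avg M F Q) p * wint M w Q) = top"
        using that S.finite ennreal_sum_eq_top by blast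
      then show False using carl \<open>?I \<noteq> top\<close> by (simp add: top_unique ennreal_mult_eq_top_iff)
    qed
    define b where "b Q = (A * enn2real (avg M F Q)) powr r" for Q
    have b: "ennpowr (ennreal A * avg M F Q) r = ennreal (b Q)" if "Q \<in> S" for Q
      using avg_fin[OF that] A unfolding b_def
      by (cases "avg M F Q") (auto simp: ennpowr_ennreal simp flip: ennreal_mult)
    let ?N = "density M (\<lambda>x. ennreal (w x))"
    have N: "emeasure ?N Q = wint M w Q" if "Q \<in> sets M" for Q using that by (simp add: wint_eq_density)
    have "(\<integral>\<^sup>+x. ennpowr (\<Sum>R\<in>S. ennpowr (ennreal A * avg M F R) r * indicator R x) (p / r) * ennreal (w x) \<partial>M)
      = (\<integral>\<^sup>+x. ennreal ((\<Sum>Q\<in>S. b Q * indicator Q x) powr q) \<partial>?N)"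
    proof (subst nn_integral_density)
      have "(\<Sum>R\<in>S. ennpowr (ennreal A * avg M F R) r * indicator R x) = ennreal (\<Sum>Q\<in>S. b Q * indicator Q x)" for x
        by (subst sum_ennreal[symmetric]) (auto simp: b b_def indicator_def intro!: sum.cong simp del: sum_ennreal)
      moreover have "0 \<le> (\<Sum>Q\<in>S. b Q * indicator Q x)" for x by (intro sum_nonneg) (auto simp: b_def)
      ultimately show "(\<integral>\<^sup>+x. ennpowr (\<Sum>R\<in>S. ennpowr (ennreal A * avg M F R) r * indicator R x) (p / r) * ennreal (w x) \<partial>M)
        = (\<integral>\<^sup>+x. ennreal (w x) * ennreal ((\<Sum>Q\<in>S. b Q * indicator Q x) powr q) \<partial>M)"
        by (simp add: ennpowr_ennreal q_def mult.commute)
    qed auto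
    also have "\<dots> \<le> ennreal ((q * (C * 2 powr p)) powr q * (\<Sum>Q\<in>S. b Q powr q * measure ?N Q))"
    proof (intro laminar_sum_powr_nn_integral_le)
      fix Q assume Q: "Q \<in> S"
      show "Q \<in> sets ?N" using Q by simp
      show "emeasure ?N Q < top" using Q finS[OF Q] by (simp add: N less_top)
      have [measurable]: "core S Q \<in> sets M" using S.finite S.sets Q by (rule core_sets)
      have "wint M w (core S Q) \<le> wint M w Q" by (intro wint_mono) (auto simp: core_def)
      then have cfin: "wint M w (core S Q) < top" using finS[OF Q] by (simp add: less_top[symmetric] neq_top_trans)
      have "ennreal (measure ?N Q) \<le> ennreal (C * 2 powr p) * wint M w (core S Q)"
        using S.sparse_Ap_core(1)[OF p assms(5) w C0 ApS S(2) Q] finS[OF Q] Q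
        by (simp add: measure_def N less_top[symmetric])
      also have "\<dots> = ennreal (C * 2 powr p * measure ?N (core S Q))"
        using cfin C by (simp add: measure_def N ennreal_mult)
      finally show "measure ?N Q \<le> C * 2 powr p * measure ?N (core S Q)"
        using C by simp
    qed (use S.finite S.lam q1 C in \<open>auto simp: b_def\<close>)
    also have "\<dots> = ennreal ((q * (C * 2 powr p)) powr q) * (\<Sum>Q\<in>S. ennreal (A powr p) * (ennpowr (avg M F Q) p * wint M w Q))"
    proof -
      have "ennreal (b Q powr q * measure ?N Q) = ennreal (A powr p) * (ennpowr (avg M F Q) p * wint M w Q)" if Q: "Q \<in> S" for Q
      proof -
        have "b Q powr q = A powr p * enn2real (avg M F Q) powr p"
          using A r by (simp add: b_def powr_powr q_def powr_mult)
        moreover have "ennpowr (avg M F Q) p = ennreal (enn2real (avg M F Q) powr p)"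
          using avg_fin[OF Q] by (simp add: ennpowr_def)
        moreover have "wint M w Q = ennreal (measure ?N Q)"
          using finS[OF Q] Q by (simp add: measure_def N less_top)
        ultimately show ?thesis by (simp add: ennreal_mult mult.assoc)
      qed
      then show ?thesis
        by (simp add: ennreal_mult sum_nonneg flip: sum_ennreal)
    qed
    also have "\<dots> = ennreal (A powr p * (q * (C * 2 powr p)) powr q) * (\<Sum>Q\<in>S. ennpowr (avg M F Q) p * wint M w Q)"
      unfolding sum_distrib_left[symmetric] by (simp add: ennreal_mult mult_ac)
    also have "\<dots> \<le> ennreal (A powr p * ?m) * (\<Sum>Q\<in>S. ennpowr (avg M F Q) p * wint M w Q)"
      unfolding q_def by (intro mult_right_mono ennreal_leI mult_left_mono) auto
    finally show ?thesis .
  qed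
  also have "\<dots> \<le> ennreal (A powr p * ?m) * (ennreal (carleson_const p C) * ?I)"
    by (intro mult_left_mono carl) auto
  also have "\<dots> = ennreal (strong_const r p A C) * ?I"
    using carleson_const_pos[OF p C] by (simp add: strong_const_def ennreal_mult mult.assoc)
  finally show ?thesis .
qed

text \<open>The stopping members of a Calderon-Zygmund argument: maximality keeps the averages over
  all larger members under control, and finiteness of \<open>D\<close> guarantees that maximal ones
  exist.\<close>

lemma stopping_family:
  fixes t :: ennreal and g :: "'a \<Rightarrow> ennreal"
  defines "T \<equiv> maximal {P\<in>D. t < avg M g P}"
  shows "\<Union>T = {x. t < dmax M D g x}" "P \<in> T \<Longrightarrow> P \<in> D" "P \<in> T \<Longrightarrow> t < avg M g P"
    "P \<in> T \<Longrightarrow> Q \<in> D \<Longrightarrow> P \<subset> Q \<Longrightarrow> avg M g Q \<le> t"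
    "P \<in> T \<Longrightarrow> Q \<in> T \<Longrightarrow> x \<in> P \<Longrightarrow> x \<in> Q \<Longrightarrow> P = Q"
proof -
  let ?E = "{P\<in>D. t < avg M g P}"
  show TD: "P \<in> T \<Longrightarrow> P \<in> D" and Tt: "P \<in> T \<Longrightarrow> t < avg M g P" for P
    unfolding T_def maximal_def by blast+
  show "\<Union>T = {x. t < dmax M D g x}"
  proof (intro equalityI subsetI CollectI)
    fix x assume "x \<in> \<Union>T"
    then show "t < dmax M D g x" using TD Tt unfolding less_dmax_iff by blast
  next
    fix x assume "x \<in> {x. t < dmax M D g x}"
    then obtain Q where Q: "Q \<in> ?E" "x \<in> Q" unfolding less_dmax_iff mem_Collect_eq by blast
    have "finite ?E" using finite by simp
    then obtain P where "P \<in> maximal ?E" "Q \<subseteq> P" using Q(1) by (rule maximal_exists)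
    then show "x \<in> \<Union>T" using Q(2) unfolding T_def by blast
  qed
  show "avg M g Q \<le> t" if "P \<in> T" "Q \<in> D" "P \<subset> Q" for P Q
  proof (rule ccontr)
    assume "\<not> avg M g Q \<le> t"
    then have "Q \<in> ?E" using that by (simp add: not_le)
    then show False using that unfolding T_def maximal_def by blast
  qed
  show "P \<in> T \<Longrightarrow> Q \<in> T \<Longrightarrow> x \<in> P \<Longrightarrow> x \<in> Q \<Longrightarrow> P = Q" for P Q x
    unfolding T_def by (rule maximal_disjoint[OF laminar_subset[OF lam]]) auto
qed

text \<open>The level is exceeded exactly on disjoint stopping members inside \<open>Q\<close>,
  whose integrals add up to at most the integral over \<open>Q\<close>. In the form given it is the
  hypothesis of \<open>strong_of_weak\<close> for scalar functions, with
  \<open>A = 2\<close>.\<close>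

lemma dmax_weak_type:
  assumes [measurable]: "g \<in> borel_measurable M" and Q: "Q \<in> D"
  shows "2 * emeasure M {x\<in>Q. 2 * avg M g Q < dmax M (below D Q) g x} \<le> emeasure M Q"
proof -
  interpret B: finite_laminar M "below D Q" by (rule finite_laminar_subset) (auto simp: below_def)
  define T where "T = maximal {P\<in>below D Q. 2 * avg M g Q < avg M g P}"
  note T = B.stopping_family[where t = "2 * avg M g Q" and g = g, folded T_def]
  have TQ: "P \<subseteq> Q" if "P \<in> T" for P using T(2)[OF that] by (simp add: below_def)
  have eq: "{x\<in>Q. 2 * avg M g Q < dmax M (below D Q) g x} = \<Union>T" using T(1) TQ by auto
  have TD: "T \<subseteq> D" using T(2) by (auto simp: below_def)
  have finT: "finite T" using TD finite by (rule finite_subset)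
  have le: "avg M g P * emeasure M P \<le> avg M g Q * emeasure M Q" if "P \<in> T" for P
  proof -
    have "P \<in> D" using that TD by blast
    have "(\<integral>\<^sup>+x\<in>P. g x \<partial>M) \<le> (\<integral>\<^sup>+x\<in>Q. g x \<partial>M)"
      using TQ[OF that] by (intro nn_integral_mono) (auto simp: indicator_def)
    then show ?thesis by (simp only: avg_mult_emeasure[OF Q] avg_mult_emeasure[OF \<open>P \<in> D\<close>])
  qed
  consider "T = {}" | P where "P \<in> T" by blast
  then show ?thesis
  proof cases
    case 1
    then show ?thesis unfolding eq by simp
  next
    case (2 P)
    have P_gt: "2 * avg M g Q < avg M g P" using T(3)[OF 2] .
    then have fin: "avg M g Q \<noteq> top" by auto
    \<comment> \<open>Cancelling the average at the end needs it to be neither 0 nor infinite; in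
      both of these cases no stopping member could exist.\<close>
    have pos: "avg M g Q \<noteq> 0"
    proof
      assume "avg M g Q = 0"
      then have "avg M g P = 0" using le[OF 2] nonnull[of P] TD 2 by auto
      then show False using P_gt by simp
    qed
    have "avg M g Q * (2 * emeasure M (\<Union>T)) \<le> avg M g Q * (2 * (\<Sum>P\<in>T. emeasure M P))"
    proof (intro mult_left_mono)
      have "T \<subseteq> sets M" using TD sets by blast
      then show "emeasure M (\<Union>T) \<le> (\<Sum>P\<in>T. emeasure M P)"
        using emeasure_subadditive_finite[OF finT, of "\<lambda>P. P" M] by simp
    qed auto
    also have "\<dots> = (\<Sum>P\<in>T. 2 * avg M g Q * emeasure M P)"
      by (simp add: sum_distrib_left mult_ac)
    also have "\<dots> \<le> (\<Sum>P\<in>T. avg M g P * emeasure M P)"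
      using T(3) by (intro sum_mono mult_right_mono) (auto intro: less_imp_le)
    also have "\<dots> = (\<Sum>P\<in>T. \<integral>\<^sup>+x\<in>P. g x \<partial>M)"
      using TD by (intro sum.cong refl avg_mult_emeasure) auto
    also have "\<dots> \<le> (\<integral>\<^sup>+x\<in>Q. g x \<partial>M)"
      using TD T(5) TQ by (intro maximal_sum_le) auto
    also have "\<dots> = avg M g Q * emeasure M Q" using avg_mult_emeasure[OF Q] by simp
    finally show ?thesis unfolding eq using fin pos by (subst (asm) ennreal_mult_le_mult_iff) auto
  qed
qed

text \<open>A single function is a sequence with one nonzero entry, and for \<open>r = 1\<close> the
  vector maximal function is then the scalar one.\<close>

lemma dmax_strong:
  assumes p: "1 < p" and C: "0 < C"
    and [measurable]: "w \<in> borel_measurable M" "g \<in> borel_measurable M" and w: "\<And>x. 0 < w x"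
    and Ap: "Ap_on M D p C w"
  shows "(\<integral>\<^sup>+x. ennpowr (dmax M D g x) p * ennreal (w x) \<partial>M)
    \<le> ennreal (strong_const 1 p 2 C) * (\<integral>\<^sup>+x. ennpowr (g x) p * ennreal (w x) \<partial>M)"
proof -
  define f where "f k = (if k = 0 then g else (\<lambda>_. 0))" for k :: nat
  have z: "dmax M E (\<lambda>_. 0) x = 0" for E x
    by (intro antisym dmax_least) (auto simp: avg_def)
  have v: "vmax M 1 E f x = dmax M E g x" for E x
    unfolding vmax_def by (subst suminf_finite[of "{0}"]) (auto simp: f_def z)
  show ?thesis
    using strong_of_weak[of 1 p 2 C w g f] p C w Ap dmax_weak_type[of g] by (simp add: v)
qed

text \<open>For exponent \<open>r\<close> the sum over the sequence commutes with the integral, so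
  the scalar bound is summed term by term. It will handle the good part of the decomposition
  below.\<close>

lemma vmax_strong_diagonal:
  assumes r: "1 < r" and C: "0 < C"
    and [measurable]: "w \<in> borel_measurable M" "\<And>k. f k \<in> borel_measurable M" and w: "\<And>x. 0 < w x"
    and Ap: "Ap_on M D r C w"
  shows "(\<integral>\<^sup>+x. vmax M r D f x * ennreal (w x) \<partial>M)
    \<le> ennreal (strong_const 1 r 2 C) * (\<integral>\<^sup>+x. (\<Sum>k. ennpowr (f k x) r) * ennreal (w x) \<partial>M)"
proof -
  have "(\<integral>\<^sup>+x. vmax M r D f x * ennreal (w x) \<partial>M) = (\<Sum>k. \<integral>\<^sup>+x. ennpowr (dmax M D (f k) x) r * ennreal (w x) \<partial>M)"
    unfolding vmax_def by (subst nn_integral_suminf[symmetric]) auto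
  also have "\<dots> \<le> (\<Sum>k. ennreal (strong_const 1 r 2 C) * (\<integral>\<^sup>+x. ennpowr (f k x) r * ennreal (w x) \<partial>M))"
    using assms by (intro suminf_le dmax_strong) auto
  also have "\<dots> = ennreal (strong_const 1 r 2 C) * (\<integral>\<^sup>+x. (\<Sum>k. ennpowr (f k x) r) * ennreal (w x) \<partial>M)"
    by (simp add: nn_integral_suminf[symmetric])
  finally show ?thesis .
qed

text \<open>The pointwise \<open>A_1\<close> inequality is multiplied by \<open>F\<close> and
  integrated over \<open>Q\<close>; then the measure of \<open>Q\<close> cancels.\<close>

lemma A1_on_avg:
  assumes [measurable]: "w \<in> borel_measurable M" "F \<in> borel_measurable M" and A1: "A1_on M D C w" and Q: "Q \<in> D" and C: "0 < C"
  shows "avg M F Q * wint M w Q \<le> ennreal C * (\<integral>\<^sup>+x\<in>Q. F x * ennreal (w x) \<partial>M)"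
proof -
  have ae: "AE x in M. x \<in> Q \<longrightarrow> wint M w Q \<le> ennreal (C * w x) * emeasure M Q"
    using A1 Q by (auto simp: A1_on_def)
  have "emeasure M Q * (avg M F Q * wint M w Q) = (\<integral>\<^sup>+x\<in>Q. F x \<partial>M) * wint M w Q"
    using avg_mult_emeasure[OF Q, of F] by (simp add: mult_ac flip: avg_mult_emeasure[OF Q])
  also have "\<dots> = (\<integral>\<^sup>+x. F x * indicator Q x * wint M w Q \<partial>M)"
    using Q by (simp add: nn_integral_multc)
  also have "\<dots> \<le> (\<integral>\<^sup>+x. ennreal C * emeasure M Q * (F x * ennreal (w x) * indicator Q x) \<partial>M)"
  proof (intro nn_integral_mono_AE eventually_mono[OF ae])
    fix x assume *: "x \<in> Q \<longrightarrow> wint M w Q \<le> ennreal (C * w x) * emeasure M Q"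
    show "F x * indicator Q x * wint M w Q \<le> ennreal C * emeasure M Q * (F x * ennreal (w x) * indicator Q x)"
    proof (cases "x \<in> Q")
      case True
      then have "F x * wint M w Q \<le> F x * (ennreal (C * w x) * emeasure M Q)" using * by (intro mult_left_mono) auto
      then show ?thesis using True C by (simp add: ennreal_mult' mult_ac)
    qed simp
  qed
  also have "\<dots> = emeasure M Q * (ennreal C * (\<integral>\<^sup>+x\<in>Q. F x * ennreal (w x) \<partial>M))"
    using Q by (subst nn_integral_cmult) (auto simp: mult_ac)
  finally show ?thesis
    using nonnull[OF Q] finite_measure[OF Q] by (subst (asm) ennreal_mult_le_mult_iff) auto
qed

text \<open>Almost everywhere on \<open>Q\<close> the weight is at least its average divided by
  \<open>C\<close>, so the dual weight is bounded above there by the corresponding negative power.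
  The constant stays the same.\<close>

lemma A1_on_imp_Ap_on:
  assumes r: "1 < r" and C: "0 < C" and [measurable]: "w \<in> borel_measurable M" and w: "\<And>x. 0 < w x"
    and A1: "A1_on M D C w"
  shows "Ap_on M D r C w"
  unfolding Ap_on_def
proof
  fix Q assume Q: "Q \<in> D"
  let ?s = "dual_weight r w"
  have ae: "AE x in M. x \<in> Q \<longrightarrow> wint M w Q \<le> ennreal (C * w x) * emeasure M Q"
    using A1 Q by (auto simp: A1_on_def)
  define m where "m = measure M Q"
  have m: "emeasure M Q = ennreal m" "0 < m" using emeasure_eq[OF Q] measure_pos[OF Q] by (auto simp: m_def)
  have "wint M w Q \<noteq> top"
  proof
    assume "wint M w Q = top"
    then have "AE x in M. x \<notin> Q" using ae m by (auto simp: top_unique ennreal_mult_eq_top_iff)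
    then show False using nonnull[OF Q] Q
      by (simp add: AE_iff_measurable[OF _ refl] sets.sets_into_space Int_absorb1 Collect_conj_eq emeasure_eq_0_AE)
  qed
  moreover have "wint M w Q \<noteq> 0" using w Q nonnull by (intro wint_pos) auto
  ultimately obtain a where a: "wint M w Q = ennreal a" "0 < a"
    by (cases "wint M w Q") auto
  define b where "b = a / (C * m)"
  have b: "0 < b" using a m C by (simp add: b_def)
  have "wint M ?s Q \<le> (\<integral>\<^sup>+x\<in>Q. ennreal (b powr (- 1 / (r - 1))) \<partial>M)"
    unfolding wint_def
  proof (intro nn_integral_mono_AE eventually_mono[OF ae])
    fix x assume *: "x \<in> Q \<longrightarrow> wint M w Q \<le> ennreal (C * w x) * emeasure M Q"
    show "ennreal (?s x) * indicator Q x \<le> ennreal (b powr (- 1 / (r - 1))) * indicator Q x"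
    proof (cases "x \<in> Q")
      case True
      have "ennreal a \<le> ennreal (C * w x * m)"
        using * True a m w[of x] C by (simp add: ennreal_mult)
      then have "b \<le> w x" using m C w[of x] by (simp add: b_def field_simps ennreal_le_iff less_imp_le)
      then have "?s x \<le> b powr (- 1 / (r - 1))"
        using r b unfolding dual_weight_def by (intro powr_mono2') auto
      then show ?thesis using True by (simp add: ennreal_leI)
    qed simp
  qed
  also have "\<dots> = ennreal (b powr (- 1 / (r - 1)) * m)"
    using Q m by (simp add: nn_integral_cmult_indicator ennreal_mult)
  finally have "ennpowr (wint M ?s Q) (r - 1) \<le> ennpowr (ennreal (b powr (- 1 / (r - 1)) * m)) (r - 1)"
    using r by (intro ennpowr_mono) auto
  also have "\<dots> = ennreal (b powr (- 1) * m powr (r - 1))"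
    using r m b by (simp add: ennpowr_ennreal powr_mult powr_powr)
  finally have "wint M w Q * ennpowr (wint M ?s Q) (r - 1) \<le> ennreal a * ennreal (b powr (- 1) * m powr (r - 1))"
    unfolding a(1) by (intro mult_left_mono) auto
  also have "\<dots> = ennreal (C * m powr r)"
  proof -
    have "m powr r = m * m powr (r - 1)" using m powr_add[of m 1 "r - 1"] by simp
    then have "a * (b powr (- 1) * m powr (r - 1)) = C * m powr r"
      using a m C b by (simp add: powr_minus b_def field_simps)
    then show ?thesis using a by (simp flip: ennreal_mult)
  qed
  finally show "wint M w Q * ennpowr (wint M ?s Q) (r - 1) \<le> ennreal C * ennpowr (emeasure M Q) r"
    using m C by (simp add: ennpowr_ennreal ennreal_mult)
qed

end

text \<open>Abstract dyadic cubes: \<open>d\<close> bounds the growth of measure to the next larger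
  member, and by \<open>minimal_cell\<close> every member is covered by minimal ones. The latter
  allows functions to be replaced by averages over cells without changing their averages over larger
  members.\<close>

locale dyadic_family = finite_laminar +
  fixes d :: real
  assumes d: "1 \<le> d"
    and doubling: "Q \<in> D \<Longrightarrow> P \<in> D \<Longrightarrow> Q \<subset> P \<Longrightarrow> \<exists>R\<in>D. Q \<subset> R \<and> R \<subseteq> P \<and> emeasure M R \<le> ennreal d * emeasure M Q"
    and minimal_cell: "Q \<in> D \<Longrightarrow> x \<in> Q \<Longrightarrow> \<exists>R\<in>D. x \<in> R \<and> (\<forall>P\<in>D. P \<subseteq> R \<longrightarrow> P = R)"
begin

lemma dyadic_family_below: "dyadic_family M (below D Q) d"
proof -
  interpret B: finite_laminar M "below D Q" by (rule finite_laminar_subset) (auto simp: below_def)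
  show ?thesis
  proof
    show "1 \<le> d" by (rule d)
    show "\<exists>R\<in>below D Q. A \<subset> R \<and> R \<subseteq> B \<and> emeasure M R \<le> ennreal d * emeasure M A"
      if "A \<in> below D Q" "B \<in> below D Q" "A \<subset> B" for A B
      using doubling[of A B] that unfolding below_def by blast
    show "\<exists>R\<in>below D Q. x \<in> R \<and> (\<forall>P\<in>below D Q. P \<subseteq> R \<longrightarrow> P = R)"
      if A: "A \<in> below D Q" "x \<in> A" for A x
    proof -
      have AD: "A \<in> D" "A \<subseteq> Q" using A by (auto simp: below_def)
      obtain R where R: "R \<in> D" "x \<in> R" "\<And>P. P \<in> D \<Longrightarrow> P \<subseteq> R \<Longrightarrow> P = R"
        using minimal_cell[OF AD(1) A(2)] by blast
      have "R \<subseteq> Q" using laminarD[OF lam R(1) AD(1) R(2) A(2)] R(3)[OF AD(1)] AD(2) by blast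
      then show ?thesis using R unfolding below_def by blast
    qed
  qed
qed

text \<open>Calderon-Zygmund decomposition. Stopped members that are maximal in \<open>D\<close> have no control on
  their averages, but no member of \<open>D\<close> leaving the stopped set meets them, so they are dropped
  from the good part.\<close>

lemma vmax_weak_type:
  assumes r: "1 < r" and C: "0 < C" and t: "0 < t"
    and [measurable]: "w \<in> borel_measurable M" "\<And>k. f k \<in> borel_measurable M" and w: "\<And>x. 0 < w x"
    and A1: "A1_on M D C w"
  shows "wint M w {x. ennreal (t powr r) < vmax M r D f x}
    \<le> ennreal (weak_const r d C / t) * (\<integral>\<^sup>+x\<in>\<Union>D. lr_norm r (\<lambda>k. f k x) * ennreal (w x) \<partial>M)"
proof -
  define F where "F x = lr_norm r (\<lambda>k. f k x)" for x
  have [measurable]: "F \<in> borel_measurable M" unfolding F_def by measurable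
  let ?I = "\<integral>\<^sup>+x\<in>\<Union>D. F x * ennreal (w x) \<partial>M"
  define T where "T = maximal {P\<in>D. ennreal t < avg M F P}"
  note T = stopping_family[where t = "ennreal t" and g = F, folded T_def]
  define \<Omega> where "\<Omega> = \<Union>T"
  \<comment> \<open>The cells over which the functions are averaged: stopped members that have a
    larger member above them, and minimal members outside the stopped set.\<close>
  define G where "G = {Q\<in>T. Q \<notin> maximal D} \<union> {R\<in>D. (\<forall>P\<in>D. P \<subseteq> R \<longrightarrow> P = R) \<and> R \<inter> \<Omega> = {}}"
  have GD: "R \<in> D" if "R \<in> G" for R using that T(2) by (auto simp: G_def)
  have finT: "finite T" using T(2) finite by (meson finite_subset subsetI)
  have finG: "finite G" using GD finite by (meson finite_subset subsetI)
  have [measurable]: "R \<in> sets M" if "R \<in> G" for R using GD[OF that] by (rule sets)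
  have G_disj: "P = R" if "P \<in> G" "R \<in> G" "x \<in> P" "x \<in> R" for P R x
    using that laminarD[OF lam GD[OF that(1)] GD[OF that(2)] that(3,4)] T(5)[of P R x] T(2)
    unfolding G_def \<Omega>_def by blast
  have G_avg: "avg M F R \<le> ennreal (d * t)" if R: "R \<in> G" for R
  proof (cases "R \<in> T")
    case True
    then have RT: "R \<in> T" "R \<notin> maximal D"
      using R nonempty[OF GD[OF R]] by (auto simp: G_def \<Omega>_def)
    then obtain P where P: "P \<in> D" "R \<subset> P" using GD[OF R] unfolding maximal_def by blast
    \<comment> \<open>A larger member is not stopped, so its average is at most \<open>t\<close>;
      the one chosen here has at most \<open>d\<close> times the measure of
      \<open>R\<close>.\<close>
    obtain P' where P': "P' \<in> D" "R \<subset> P'" "emeasure M P' \<le> ennreal d * emeasure M R"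
      using doubling[OF GD[OF R] P] by blast
    have "avg M F R * emeasure M R = (\<integral>\<^sup>+x\<in>R. F x \<partial>M)" by (rule avg_mult_emeasure[OF GD[OF R]])
    also have "\<dots> \<le> (\<integral>\<^sup>+x\<in>P'. F x \<partial>M)" using P' by (intro nn_integral_mono) (auto simp: indicator_def)
    also have "\<dots> = avg M F P' * emeasure M P'" by (rule avg_mult_emeasure[OF P'(1), symmetric])
    also have "\<dots> \<le> ennreal t * (ennreal d * emeasure M R)"
      using T(4)[OF RT(1) P'(1,2)] P'(3) by (rule mult_mono) auto
    finally have "emeasure M R * avg M F R \<le> emeasure M R * ennreal (d * t)"
      using d t by (simp add: ennreal_mult mult_ac)
    then show ?thesis using nonnull[OF GD[OF R]] finite_measure[OF GD[OF R]]
      by (subst (asm) ennreal_mult_le_mult_iff) auto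
  next
    case False
    then have "R \<inter> \<Omega> = {}" using R by (auto simp: G_def)
    moreover obtain x where "x \<in> R" using nonempty[OF GD[OF R]] by blast
    ultimately have "\<not> ennreal t < dmax M D F x" using T(1) unfolding \<Omega>_def by blast
    then have "avg M F R \<le> ennreal t" using dmax_upper[OF GD[OF R] \<open>x \<in> R\<close>, of M F] by simp
    also have "\<dots> \<le> ennreal (d * t)" using d t by (intro ennreal_leI) (simp add: mult_le_cancel_right1)
    finally show ?thesis .
  qed
  define g where "g k x = (\<Sum>R\<in>G. avg M (f k) R * indicator R x)" for k x
  have [measurable]: "g k \<in> borel_measurable M" for k unfolding g_def[abs_def] by measurable
  \<comment> \<open>A member leaving the stopped set is the disjoint union of the cells of
    \<open>G\<close> inside it, and averaging over cells keeps the integral. So off the stopped set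
    the maximal functions of \<open>f\<close> and \<open>g\<close> agree.\<close>
  have avg_g: "avg M (f k) Q = avg M (g k) Q" if Q: "Q \<in> D" "x \<in> Q" "x \<notin> \<Omega>" for k Q x
  proof -
    let ?H = "{R\<in>G. R \<subseteq> Q}"
    have out: "R \<inter> Q = {}" if R: "R \<in> G" "\<not> R \<subseteq> Q" for R
    proof (rule ccontr)
      assume "R \<inter> Q \<noteq> {}"
      then have "Q \<subseteq> R" using laminarD[OF lam GD[OF R(1)] Q(1)] R(2) by blast
      then have "x \<in> R" using Q by blast
      then have "R \<notin> T" using Q(3) by (auto simp: \<Omega>_def)
      then show False using \<open>Q \<subseteq> R\<close> R Q(1) by (auto simp: G_def)
    qed
    have cover: "\<exists>R\<in>?H. y \<in> R" if y: "y \<in> Q" for y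
    proof (cases "y \<in> \<Omega>")
      case True
      then obtain P where P: "P \<in> T" "y \<in> P" by (auto simp: \<Omega>_def)
      have "\<not> Q \<subseteq> P" using P(1) Q by (auto simp: \<Omega>_def)
      then have PQ: "P \<subset> Q" using laminarD[OF lam T(2)[OF P(1)] Q(1) P(2) y] by blast
      then have "P \<notin> maximal D" using Q(1) unfolding maximal_def by blast
      then show ?thesis using P PQ unfolding G_def by blast
    next
      case False
      obtain R where R: "R \<in> D" "y \<in> R" "\<And>P. P \<in> D \<Longrightarrow> P \<subseteq> R \<Longrightarrow> P = R"
        using minimal_cell[OF Q(1) y] by blast
      have "R \<inter> \<Omega> = {}"
      proof (rule ccontr)
        assume "R \<inter> \<Omega> \<noteq> {}"
        then obtain z P where z: "z \<in> R" "z \<in> P" "P \<in> T" by (auto simp: \<Omega>_def)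
        then have "R \<subseteq> P" using laminarD[OF lam R(1) T(2)[OF z(3)] z(1,2)] R(3)[OF T(2)[OF z(3)]] by blast
        then show False using z(3) R(2) False by (auto simp: \<Omega>_def)
      qed
      moreover have "R \<subseteq> Q" using laminarD[OF lam R(1) Q(1) R(2) y] R(3)[OF Q(1)] by blast
      ultimately show ?thesis using R unfolding G_def by blast
    qed
    have Q_eq: "Q = \<Union>?H" using cover by blast
    have finH: "finite ?H" using finG by simp
    have "(\<integral>\<^sup>+y\<in>Q. f k y \<partial>M) = (\<integral>\<^sup>+y\<in>\<Union>?H. f k y \<partial>M)" using Q_eq by (rule arg_cong)
    also have "\<dots> = (\<Sum>R\<in>?H. \<integral>\<^sup>+y\<in>R. f k y \<partial>M)"
    proof (rule nn_integral_disjoint_Union[OF finH])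
      show "R \<in> sets M" if "R \<in> ?H" for R using GD[of R] sets[of R] that by blast
      show "P = R" if "P \<in> ?H" "R \<in> ?H" "y \<in> P" "y \<in> R" for P R y using G_disj[of P R y] that by blast
    qed measurable
    also have "\<dots> = (\<Sum>R\<in>?H. avg M (f k) R * emeasure M R)"
      using GD by (intro sum.cong refl avg_mult_emeasure[symmetric]) blast
    also have "\<dots> = (\<integral>\<^sup>+y. (\<Sum>R\<in>?H. avg M (f k) R * indicator R y) \<partial>M)"
      by (subst nn_integral_sum) (auto intro!: sum.cong nn_integral_cmult_indicator[symmetric])
    also have "\<dots> = (\<integral>\<^sup>+y\<in>Q. g k y \<partial>M)"
    proof (intro nn_integral_cong)
      fix y
      have "(\<Sum>R\<in>G. avg M (f k) R * indicator R y * indicator Q y) = (\<Sum>R\<in>?H. avg M (f k) R * indicator R y * indicator Q y)"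
        using out finG by (intro sum.mono_neutral_right) (auto simp: indicator_def)
      also have "\<dots> = (\<Sum>R\<in>?H. avg M (f k) R * indicator R y)"
        by (intro sum.cong refl) (auto simp: indicator_def)
      finally show "(\<Sum>R\<in>?H. avg M (f k) R * indicator R y) = g k y * indicator Q y"
        unfolding g_def sum_distrib_right by simp
    qed
    finally show ?thesis unfolding avg_def by simp
  qed
  have vmax_g: "vmax M r D f x = vmax M r D g x" if "x \<notin> \<Omega>" for x
  proof -
    have "dmax M D (f k) x = dmax M D (g k) x" for k
      using avg_g[OF _ _ that] by (rule dmax_cong)
    then show ?thesis unfolding vmax_def by simp
  qed
  \<comment> \<open>One estimate for two disjoint families: \<open>T\<close> in the bound for the
    stopped set, and \<open>G\<close> in the bound for the good part.\<close>
  have disj_bound: "(\<Sum>R\<in>K. avg M F R * wint M w R) \<le> ennreal C * ?I"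
    if K: "K \<subseteq> D" "\<And>P R x. P \<in> K \<Longrightarrow> R \<in> K \<Longrightarrow> x \<in> P \<Longrightarrow> x \<in> R \<Longrightarrow> P = R" for K
  proof -
    have "(\<Sum>R\<in>K. avg M F R * wint M w R) \<le> (\<Sum>R\<in>K. ennreal C * (\<integral>\<^sup>+x\<in>R. F x * ennreal (w x) \<partial>M))"
      using K C A1 by (intro sum_mono A1_on_avg) auto
    also have "\<dots> = ennreal C * (\<Sum>R\<in>K. \<integral>\<^sup>+x\<in>R. F x * ennreal (w x) \<partial>M)"
      by (simp only: sum_distrib_left)
    also have "\<dots> \<le> ennreal C * ?I"
      using K by (intro mult_left_mono maximal_sum_le) auto
    finally show ?thesis .
  qed
  have TD: "T \<subseteq> D" using T(2) by blast
  have \<Omega>_sets [measurable]: "\<Omega> \<in> sets M"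
    unfolding \<Omega>_def using finT TD sets by (intro sets.finite_Union) blast+
  have \<Omega>_le: "ennreal t * wint M w \<Omega> \<le> ennreal C * ?I"
  proof -
    have "wint M w \<Omega> = (\<Sum>R\<in>T. wint M w R)"
      unfolding wint_def \<Omega>_def
    proof (rule nn_integral_disjoint_Union[OF finT])
      show "R \<in> sets M" if "R \<in> T" for R using TD sets that by blast
      show "P = R" if "P \<in> T" "R \<in> T" "y \<in> P" "y \<in> R" for P R y using T(5) that .
    qed measurable
    then have "ennreal t * wint M w \<Omega> = (\<Sum>R\<in>T. ennreal t * wint M w R)" by (simp only: sum_distrib_left)
    also have "\<dots> \<le> (\<Sum>R\<in>T. avg M F R * wint M w R)"
      using T(3) by (intro sum_mono mult_right_mono) (auto intro: less_imp_le)
    also have "\<dots> \<le> ennreal C * ?I" using TD T(5) by (intro disj_bound)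
    finally show ?thesis .
  qed
  \<comment> \<open>On a cell Minkowski's inequality bounds the sequence of averages by the average
    of \<open>F\<close>; of its \<open>r\<close> powers, \<open>r - 1\<close> are estimated by
    \<open>d * t\<close> and one is kept for integration.\<close>
  have g_sum: "(\<Sum>k. ennpowr (g k x) r) \<le> (\<Sum>R\<in>G. ennreal ((d * t) powr (r - 1)) * avg M F R * indicator R x)" for x
  proof (cases "\<exists>R\<in>G. x \<in> R")
    case True
    then obtain R where R: "R \<in> G" "x \<in> R" by blast
    have "{P\<in>G. x \<in> P} = {R}" using G_disj R by blast
    then have pick: "(\<Sum>P\<in>G. h P * indicator P x) = h R" for h :: "'a set \<Rightarrow> ennreal"
      by (simp add: sum_mult_indicator_eq[OF finG])
    have RD: "R \<in> D" by (rule GD[OF R(1)])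
    have "(\<Sum>k. ennpowr (g k x) r) = (\<Sum>k. ennpowr (ennreal (1 / measure M R)) r * ennpowr (\<integral>\<^sup>+y. f k y * indicator R y \<partial>M) r)"
      unfolding g_def pick avg_eq[OF RD] ennpowr_mult ..
    also have "\<dots> \<le> ennpowr (ennreal (1 / measure M R)) r * ennpowr (\<integral>\<^sup>+y. lr_norm r (\<lambda>k. f k y * indicator R y) \<partial>M) r"
      unfolding ennreal_suminf_cmult using r RD by (intro mult_left_mono Minkowski_lr_norm) auto
    also have "(\<integral>\<^sup>+y. lr_norm r (\<lambda>k. f k y * indicator R y) \<partial>M) = (\<integral>\<^sup>+y\<in>R. F y \<partial>M)"
      by (intro nn_integral_cong) (auto simp: F_def lr_norm_def indicator_def)
    also have "ennpowr (ennreal (1 / measure M R)) r * ennpowr (\<integral>\<^sup>+y\<in>R. F y \<partial>M) r = ennpowr (avg M F R) r"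
      unfolding avg_eq[OF RD] ennpowr_mult ..
    also have "\<dots> = ennpowr (avg M F R) (r - 1) * avg M F R"
      using r ennpowr_add[of "r - 1" 1 "avg M F R"] by simp
    also have "\<dots> \<le> ennpowr (ennreal (d * t)) (r - 1) * avg M F R"
      using r G_avg[OF R(1)] by (intro mult_right_mono ennpowr_mono) auto
    also have "\<dots> = (\<Sum>R\<in>G. ennreal ((d * t) powr (r - 1)) * avg M F R * indicator R x)"
      unfolding pick using d t by (simp add: ennpowr_ennreal)
    finally show ?thesis .
  next
    case False
    then have "g k x = 0" for k unfolding g_def by (intro sum.neutral) auto
    then show ?thesis by simp
  qed
  have Ap: "Ap_on M D r C w" using r C w A1 by (intro A1_on_imp_Ap_on) auto
  let ?S = "strong_const 1 r 2 C"
  have S0: "0 \<le> ?S" using strong_const_pos[OF r C, of 2 1] by simp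
  have "(\<integral>\<^sup>+x. vmax M r D g x * ennreal (w x) \<partial>M) \<le> ennreal ?S * (\<integral>\<^sup>+x. (\<Sum>k. ennpowr (g k x) r) * ennreal (w x) \<partial>M)"
    using r C w Ap by (intro vmax_strong_diagonal) auto
  also have "\<dots> \<le> ennreal ?S * (\<integral>\<^sup>+x. (\<Sum>R\<in>G. ennreal ((d * t) powr (r - 1)) * avg M F R * (ennreal (w x) * indicator R x)) \<partial>M)"
  proof (intro mult_left_mono nn_integral_mono)
    fix x
    have "(\<Sum>k. ennpowr (g k x) r) * ennreal (w x) \<le> (\<Sum>R\<in>G. ennreal ((d * t) powr (r - 1)) * avg M F R * indicator R x) * ennreal (w x)"
      by (intro mult_right_mono g_sum) auto
    also have "\<dots> = (\<Sum>R\<in>G. ennreal ((d * t) powr (r - 1)) * avg M F R * (ennreal (w x) * indicator R x))"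
      unfolding sum_distrib_right by (intro sum.cong refl) (simp add: mult_ac)
    finally show "(\<Sum>k. ennpowr (g k x) r) * ennreal (w x) \<le> \<dots>" .
  qed simp
  also have "\<dots> = ennreal ?S * (ennreal ((d * t) powr (r - 1)) * (\<Sum>R\<in>G. avg M F R * wint M w R))"
    unfolding wint_def sum_distrib_left
    by (subst nn_integral_sum) (auto simp: nn_integral_cmult mult.assoc sum_distrib_left intro!: sum.cong)
  also have "\<dots> \<le> ennreal ?S * (ennreal ((d * t) powr (r - 1)) * (ennreal C * ?I))"
    using GD G_disj by (intro mult_left_mono disj_bound) auto
  finally have good: "(\<integral>\<^sup>+x. vmax M r D g x * ennreal (w x) \<partial>M) \<le> ennreal (?S * (d * t) powr (r - 1) * C) * ?I"
    using S0 C by (simp add: ennreal_mult mult.assoc)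
  \<comment> \<open>Points of the superlevel set either are stopped or, since \<open>f\<close> may
    be replaced by \<open>g\<close> there, are counted by Chebyshev's inequality for the
    \<open>r\<close>-th power.\<close>
  have "wint M w {x. ennreal (t powr r) < vmax M r D f x}
    \<le> (\<integral>\<^sup>+x. ennreal (w x) * indicator \<Omega> x + ennreal (t powr (- r)) * (vmax M r D g x * ennreal (w x)) \<partial>M)"
    unfolding wint_def
  proof (intro nn_integral_mono)
    fix x
    show "ennreal (w x) * indicator {x. ennreal (t powr r) < vmax M r D f x} x
      \<le> ennreal (w x) * indicator \<Omega> x + ennreal (t powr (- r)) * (vmax M r D g x * ennreal (w x))"
    proof (cases "x \<in> \<Omega>")
      case True
      then show ?thesis by (auto simp: indicator_def intro: add_increasing2)
    next
      case False
      show ?thesis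
      proof (cases "ennreal (t powr r) < vmax M r D f x")
        case less: True
        have "1 = ennreal (t powr (- r)) * ennreal (t powr r)"
          using t by (simp add: powr_minus flip: ennreal_mult)
        also have "\<dots> \<le> ennreal (t powr (- r)) * vmax M r D g x"
          using less vmax_g[OF False] by (intro mult_left_mono) auto
        finally have "1 * ennreal (w x) \<le> ennreal (t powr (- r)) * vmax M r D g x * ennreal (w x)"
          by (rule mult_right_mono) simp
        then show ?thesis using less False by (simp add: mult.assoc)
      qed simp
    qed
  qed
  also have "\<dots> = wint M w \<Omega> + ennreal (t powr (- r)) * (\<integral>\<^sup>+x. vmax M r D g x * ennreal (w x) \<partial>M)"
    unfolding wint_def by (subst nn_integral_add) (auto simp: nn_integral_cmult)
  also have "\<dots> \<le> ennreal (C / t) * ?I + ennreal (t powr (- r)) * (ennreal (?S * (d * t) powr (r - 1) * C) * ?I)"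
  proof (intro add_mono mult_left_mono good)
    have "wint M w \<Omega> = ennreal (1 / t) * (ennreal t * wint M w \<Omega>)"
      using t by (simp add: mult.assoc[symmetric] flip: ennreal_mult)
    also have "\<dots> \<le> ennreal (1 / t) * (ennreal C * ?I)"
      by (intro mult_left_mono \<Omega>_le) auto
    also have "\<dots> = ennreal (C / t) * ?I" using t C by (simp add: mult.assoc[symmetric] flip: ennreal_mult)
    finally show "wint M w \<Omega> \<le> ennreal (C / t) * ?I" .
  qed simp
  also have "\<dots> = ennreal (weak_const r d C / t) * ?I"
  proof -
    have "t powr (- r) * (?S * (d * t) powr (r - 1) * C) = ?S * (d powr (r - 1) * C) / t"
      using t d powr_add[of t "- r" "r - 1"] by (simp add: powr_mult powr_minus field_simps)
    then have "ennreal (t powr (- r)) * (ennreal (?S * (d * t) powr (r - 1) * C) * ?I) = ennreal (?S * (d powr (r - 1) * C) / t) * ?I"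
      using S0 C by (simp add: mult.assoc[symmetric] flip: ennreal_mult)
    then have "ennreal (C / t) * ?I + ennreal (t powr (- r)) * (ennreal (?S * (d * t) powr (r - 1) * C) * ?I)
      = (ennreal (C / t) + ennreal (?S * (d powr (r - 1) * C) / t)) * ?I"
      by (simp only: distrib_right)
    also have "ennreal (C / t) + ennreal (?S * (d powr (r - 1) * C) / t) = ennreal (weak_const r d C / t)"
      using S0 C t by (simp add: weak_const_def add_divide_distrib)
    finally show ?thesis .
  qed
  finally show ?thesis unfolding F_def .
qed

text \<open>The weak bound with weight 1 and constant 1, at the level
  \<open>2 * weak_const r d 1\<close> times the average of the sequence norm, leaves at most half of
  \<open>Q\<close>. This is the hypothesis of \<open>strong_of_weak\<close>; the weight
  \<open>w\<close> enters only there.\<close>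

lemma vmax_strong:
  assumes r: "1 < r" and p: "1 < p" and C: "0 < C"
    and [measurable]: "w \<in> borel_measurable M" "\<And>k. f k \<in> borel_measurable M" and w: "\<And>x. 0 < w x"
    and Ap: "Ap_on M D p C w"
  shows "(\<integral>\<^sup>+x. ennpowr (vmax M r D f x) (p / r) * ennreal (w x) \<partial>M)
    \<le> ennreal (strong_const r p (2 * weak_const r d 1) C) * (\<integral>\<^sup>+x. ennpowr (lr_norm r (\<lambda>k. f k x)) p * ennreal (w x) \<partial>M)"
proof (rule strong_of_weak)
  let ?W = "weak_const r d 1" and ?F = "\<lambda>x. lr_norm r (\<lambda>k. f k x)"
  have W: "0 < ?W" using r d by (intro weak_const_pos) auto
  fix Q assume Q: "Q \<in> D"
  interpret B: dyadic_family M "below D Q" d by (rule dyadic_family_below)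
  have UQ: "\<Union>(below D Q) = Q" using Q by (auto simp: below_def)
  let ?E = "{x\<in>Q. ennpowr (ennreal (2 * ?W) * avg M ?F Q) r < vmax M r (below D Q) f x}"
  \<comment> \<open>The weak bound needs a positive finite level. For an infinite average the
    exceptional set is empty, and for a zero average all averages of the \<open>f k\<close> below
    \<open>Q\<close> vanish.\<close>
  consider "avg M ?F Q = top" | "avg M ?F Q = 0" | a where "avg M ?F Q = ennreal a" "0 < a"
    by (cases "avg M ?F Q") (auto simp: less_le)
  then show "2 * emeasure M ?E \<le> emeasure M Q"
  proof cases
    case 1
    then show ?thesis using W by (simp add: ennreal_mult_top)
  next
    case 2
    have "(\<integral>\<^sup>+x\<in>Q. ?F x \<partial>M) = 0" using avg_mult_emeasure[OF Q, of ?F] 2 by simp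
    moreover have "(\<integral>\<^sup>+x\<in>P. f k x \<partial>M) \<le> (\<integral>\<^sup>+x\<in>Q. ?F x \<partial>M)" if "P \<subseteq> Q" for P k
    proof (intro nn_integral_mono)
      fix x
      have "f k x \<le> ?F x" using r le_lr_norm[of r "\<lambda>k. f k x" k] by simp
      then show "f k x * indicator P x \<le> ?F x * indicator Q x" using that by (auto simp: indicator_def)
    qed
    ultimately have "avg M (f k) P = 0" if "P \<in> below D Q" for P k
      using that unfolding avg_def by (simp add: below_def)
    then have "dmax M (below D Q) (f k) x = 0" for k x by (intro antisym dmax_least) auto
    then show ?thesis by (simp add: vmax_def)
  next
    case (3 a)
    have t: "0 < 2 * ?W * a" using W 3 by simp
    have "?E \<subseteq> {x. ennreal ((2 * ?W * a) powr r) < vmax M r (below D Q) f x}"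
      using 3 W by (auto simp: ennpowr_ennreal simp flip: ennreal_mult)
    then have "emeasure M ?E \<le> wint M (\<lambda>_. 1) {x\<in>space M. ennreal ((2 * ?W * a) powr r) < vmax M r (below D Q) f x}"
      using sets.sets_into_space[OF sets[OF Q]]
      by (simp add: wint_def) (intro emeasure_mono, auto)
    also have "\<dots> \<le> wint M (\<lambda>_. 1) {x. ennreal ((2 * ?W * a) powr r) < vmax M r (below D Q) f x}"
      by (intro wint_mono) auto
    also have "\<dots> \<le> ennreal (?W / (2 * ?W * a)) * (\<integral>\<^sup>+x\<in>\<Union>(below D Q). ?F x * ennreal 1 \<partial>M)"
      using r t by (intro B.vmax_weak_type) (auto simp: A1_on_def wint_def B.sets)
    also have "\<dots> = ennreal (1 / (2 * a)) * (ennreal a * emeasure M Q)"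
      using W 3 avg_mult_emeasure[OF Q, of ?F] by (simp add: UQ)
    also have "\<dots> = ennreal (1 / 2) * emeasure M Q"
      using 3 by (simp add: mult.assoc[symmetric] flip: ennreal_mult)
    finally have "2 * emeasure M ?E \<le> 2 * (ennreal (1 / 2) * emeasure M Q)"
      by (rule mult_left_mono) simp
    also have "\<dots> = emeasure M Q"
      using ennreal_mult[of 2 "1/2"] by (simp add: mult.assoc[symmetric] del: ennreal_half)
    finally show ?thesis .
  qed
next
  show "0 < 2 * weak_const r d 1" using r d weak_const_pos[of r 1 d] by simp
qed (use assms in auto)

end

section \<open>Grids and the one-third trick\<close>

text \<open>Half-open cubes of side \<open>L\<close> with a corner of the grid at \<open>v\<close>,
  each named by any of its points; equality of integer parts makes the cells equivalence
  classes.\<close>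

definition grid_cell :: "real \<Rightarrow> real^'n \<Rightarrow> real^'n \<Rightarrow> (real^'n) set" where
  "grid_cell L v x = {y. \<forall>i. \<lfloor>(y$i - v$i) / L\<rfloor> = \<lfloor>(x$i - v$i) / L\<rfloor>}"

text \<open>The sides range from \<open>s\<close> to \<open>2^J * s\<close>, and \<open>b\<close>
  makes the family finite. The limit \<open>h\<close> is imposed at all points of a cell, so that
  subcells inherit membership; it will be a multiple of the critical radius.\<close>

definition grid_family :: "real \<Rightarrow> nat \<Rightarrow> real^'n \<Rightarrow> real \<Rightarrow> (real^'n \<Rightarrow> real) \<Rightarrow> (real^'n) set set" where
  "grid_family s J v b h = {Q. \<exists>j\<le>J. \<exists>x. Q = grid_cell (2^j * s) v x \<and> Q \<subseteq> cball 0 b \<and> (\<forall>y\<in>Q. 2^j * s \<le> h y)}"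

lemma grid_cell_self [simp]: "x \<in> grid_cell L v x"
  by (simp add: grid_cell_def)

lemma grid_cell_eq: "y \<in> grid_cell L v x \<Longrightarrow> grid_cell L v y = grid_cell L v x"
  by (simp add: grid_cell_def)

text \<open>The index of a coarse cell is the integer quotient of the fine index by
  \<open>2^(k - j)\<close>, so the fine cell determines the coarse one.\<close>

lemma grid_cell_mono:
  assumes "j \<le> k" "0 < s"
  shows "grid_cell (2^j * s) v x \<subseteq> grid_cell (2^k * s) v x"
proof
  fix y assume y: "y \<in> grid_cell (2^j * s) v x"
  have "\<lfloor>u / (2^k * s)\<rfloor> = \<lfloor>u / (2^j * s)\<rfloor> div 2^(k - j)" for u
  proof -
    have "(2::real)^k = 2^j * 2^(k - j)" using assms(1) by (simp flip: power_add)
    then have eq: "u / (2^k * s) = u / (2^j * s) / real_of_int (2^(k - j))" by (simp add: mult_ac)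
    show ?thesis unfolding eq by (rule floor_divide_real_eq_div) simp
  qed
  then show "y \<in> grid_cell (2^k * s) v x" using y by (simp add: grid_cell_def)
qed

lemma grid_cell_eq_box:
  assumes "0 < L"
  shows "grid_cell L v x = {y. \<forall>i. v$i + L * \<lfloor>(x$i - v$i) / L\<rfloor> \<le> y$i \<and> y$i < v$i + L * \<lfloor>(x$i - v$i) / L\<rfloor> + L}"
  unfolding grid_cell_def floor_eq_iff using assms by (auto simp: field_simps)

lemma grid_cell_measure:
  fixes v x :: "real^'n"
  assumes L: "0 < L"
  shows "grid_cell L v x \<in> sets lebesgue" "emeasure lebesgue (grid_cell L v x) = ennreal (L ^ CARD('n))"
proof -
  let ?a = "\<chi> i. v$i + L * \<lfloor>(x$i - v$i) / L\<rfloor>" and ?b = "\<chi> i. v$i + L * \<lfloor>(x$i - v$i) / L\<rfloor> + L"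
  have b: "grid_cell L v x \<in> sets borel"
    unfolding grid_cell_eq_box[OF L] by measurable
  then show "grid_cell L v x \<in> sets lebesgue" by (simp add: sets_completionI_sets)
  have 1: "box ?a ?b \<subseteq> grid_cell L v x" "grid_cell L v x \<subseteq> cbox ?a ?b"
    unfolding grid_cell_eq_box[OF L] by (auto simp: mem_box_cart less_imp_le)
  have diff: "(?b - ?a) \<bullet> e = L" if e: "e \<in> Basis" for e
  proof -
    obtain i where "e = axis i 1" using e by (auto simp: Basis_vec_def)
    then show ?thesis by (simp add: inner_axis)
  qed
  have le: "?a \<bullet> e \<le> ?b \<bullet> e" if "e \<in> Basis" for e
    using diff[OF that] L unfolding inner_diff_left by linarith
  have p: "(\<Prod>e\<in>Basis. (?b - ?a) \<bullet> e) = L ^ CARD('n)" using diff by simp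
  have c: "emeasure lborel (cbox ?a ?b) = ennreal (L ^ CARD('n))"
    using emeasure_lborel_cbox[of ?a ?b] le p by simp
  have "emeasure lborel (box ?a ?b) = ennreal (L ^ CARD('n))"
    using emeasure_lborel_box[of ?a ?b] le p by simp
  then have "emeasure lborel (grid_cell L v x) = ennreal (L ^ CARD('n))"
    using emeasure_mono[OF 1(1), of lborel] emeasure_mono[OF 1(2), of lborel] b c by simp
  then show "emeasure lebesgue (grid_cell L v x) = ennreal (L ^ CARD('n))"
    using b by (simp add: emeasure_completion)
qed

lemma grid_cell_diameter:
  fixes v x :: "real^'n" and L :: real
  assumes L: "0 < L" and "y \<in> grid_cell L v x" "z \<in> grid_cell L v x"
  shows "norm (y - z) < CARD('n) * L"
proof -
  have "\<bar>(y - z)$i\<bar> < L" for i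
  proof -
    have "v$i + L * \<lfloor>(x$i - v$i) / L\<rfloor> \<le> y$i" "y$i < v$i + L * \<lfloor>(x$i - v$i) / L\<rfloor> + L"
      "v$i + L * \<lfloor>(x$i - v$i) / L\<rfloor> \<le> z$i" "z$i < v$i + L * \<lfloor>(x$i - v$i) / L\<rfloor> + L"
      using assms unfolding grid_cell_eq_box[OF L] by auto
    then show ?thesis by simp
  qed
  then have "(\<Sum>i\<in>UNIV. \<bar>(y - z)$i\<bar>) < (\<Sum>i\<in>(UNIV::'n set). L)"
    by (intro sum_strict_mono) auto
  then show ?thesis using norm_le_l1_cart[of "y - z"] by simp
qed

text \<open>A cell is determined by its scale and its vector of integer indices, and in a bounded
  region only indices between \<open>-K\<close> and \<open>K\<close> occur.\<close>

lemma grid_family_finite: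
  fixes v :: "real^'n"
  assumes s: "0 < s"
  shows "finite (grid_family s J v b h)"
proof -
  define K where "K = \<lceil>(b + norm v) / s\<rceil> + 1"
  let ?M = "{m :: 'n \<Rightarrow> int. \<forall>i. m i \<in> {-K..K}}"
  have "?M = PiE UNIV (\<lambda>_. {-K..K})" by (auto simp: PiE_def Pi_def)
  then have finM: "finite ?M" by (simp add: finite_PiE)
  have "grid_family s J v b h \<subseteq> (\<lambda>(j, m). {y. \<forall>i. \<lfloor>(y$i - v$i) / (2^j * s)\<rfloor> = m i}) ` ({..J} \<times> ?M)"
  proof
    fix Q assume "Q \<in> grid_family s J v b h"
    then obtain j x where Q: "j \<le> J" "Q = grid_cell (2^j * s) v x" "Q \<subseteq> cball 0 b" by (auto simp: grid_family_def)
    have "x \<in> Q" using Q by simp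
    then have "norm x \<le> b" using Q(3) by auto
    have "\<lfloor>(x$i - v$i) / (2^j * s)\<rfloor> \<in> {-K..K}" for i
    proof -
      have "\<bar>x$i - v$i\<bar> \<le> b + norm v"
        using component_le_norm_cart[of x i] component_le_norm_cart[of v i] \<open>norm x \<le> b\<close> by linarith
      moreover have "s \<le> 2^j * s" using s by simp
      ultimately have "\<bar>(x$i - v$i) / (2^j * s)\<bar> \<le> (b + norm v) / s"
        using s by (simp add: abs_mult) (intro frac_le, auto)
      moreover have "(b + norm v) / s \<le> real_of_int (K - 1)" unfolding K_def by simp
      moreover have "\<lfloor>t\<rfloor> \<in> {-K..K}" if "\<bar>t\<bar> \<le> real_of_int (K - 1)" for t
        using that unfolding atLeastAtMost_iff by linarith
      ultimately show ?thesis by (meson order_trans)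
    qed
    then have "(\<lambda>i. \<lfloor>(x$i - v$i) / (2^j * s)\<rfloor>) \<in> ?M" by blast
    then show "Q \<in> (\<lambda>(j, m). {y. \<forall>i. \<lfloor>(y$i - v$i) / (2^j * s)\<rfloor> = m i}) ` ({..J} \<times> ?M)"
      using Q by (intro image_eqI[of _ _ "(j, \<lambda>i. \<lfloor>(x$i - v$i) / (2^j * s)\<rfloor>)"]) (auto simp: grid_cell_def)
  qed
  then show ?thesis using finM by (meson finite_SigmaI finite_atMost finite_imageI finite_subset)
qed

text \<open>Both restrictions in \<open>grid_family\<close> pass to subcells. Hence the next coarser
  cell inside a larger member, and the finest cell at a point of a member, belong to the
  family.\<close>

lemma grid_family_dyadic:
  fixes v :: "real^'n"
  assumes s: "0 < s"
  shows "dyadic_family lebesgue (grid_family s J v b h) (2 ^ CARD('n))"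
proof -
  let ?D = "grid_family s J v b h"
  let ?c = "\<lambda>j. grid_cell (2^j * s) v"
  have L: "0 < 2^j * s" for j using s by simp
  have D: "\<exists>j\<le>J. Q = ?c j x \<and> Q \<subseteq> cball 0 b \<and> (\<forall>y\<in>Q. 2^j * s \<le> h y)" if Q: "Q \<in> ?D" "x \<in> Q" for Q x
  proof -
    obtain j y where j: "j \<le> J" "Q = ?c j y" "Q \<subseteq> cball 0 b" "\<forall>y\<in>Q. 2^j * s \<le> h y"
      using Q unfolding grid_family_def by blast
    then have "Q = ?c j x" using Q(2) grid_cell_eq by blast
    then show ?thesis using j by blast
  qed
  have nonempty: "\<exists>x. x \<in> Q" if "Q \<in> ?D" for Q using that unfolding grid_family_def by (auto intro: grid_cell_self)
  have meas: "Q \<in> sets lebesgue" "emeasure lebesgue Q \<noteq> 0" "emeasure lebesgue Q \<noteq> top" if "Q \<in> ?D" for Q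
    using that grid_cell_measure[OF L, of _ v] s unfolding grid_family_def by auto
  show ?thesis
  proof
    show "finite ?D" using s by (rule grid_family_finite)
    show "laminar ?D"
      unfolding laminar_def
    proof (intro ballI)
      fix P Q assume PQ: "P \<in> ?D" "Q \<in> ?D"
      show "P \<subseteq> Q \<or> Q \<subseteq> P \<or> P \<inter> Q = {}"
      proof (cases "P \<inter> Q = {}")
        case False
        then obtain x where x: "x \<in> P" "x \<in> Q" by blast
        obtain j k where "P = ?c j x" "Q = ?c k x" using D[OF PQ(1) x(1)] D[OF PQ(2) x(2)] by blast
        then show ?thesis using grid_cell_mono[OF _ s, of j k v x] grid_cell_mono[OF _ s, of k j v x] by (cases "j \<le> k") auto
      qed simp
    qed
    show "1 \<le> (2::real) ^ CARD('n)" by simp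
    show "\<exists>R\<in>?D. Q \<subset> R \<and> R \<subseteq> P \<and> emeasure lebesgue R \<le> ennreal (2 ^ CARD('n)) * emeasure lebesgue Q"
      if QP: "Q \<in> ?D" "P \<in> ?D" "Q \<subset> P" for Q P
    proof -
      obtain x where x: "x \<in> Q" using nonempty[OF QP(1)] by blast
      then obtain j where j: "j \<le> J" "Q = ?c j x" using D[OF QP(1)] by blast
      obtain k where k: "k \<le> J" "P = ?c k x" "P \<subseteq> cball 0 b" "\<forall>y\<in>P. 2^k * s \<le> h y"
        using D[OF QP(2), of x] x QP(3) by blast
      have jk: "Suc j \<le> k" using grid_cell_mono[OF _ s, of k j v x] QP(3) j k by (cases "k \<le> j") auto
      let ?R = "?c (Suc j) x"
      have RP: "?R \<subseteq> P" unfolding k(2) using jk s by (rule grid_cell_mono)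
      have "2^Suc j * s \<le> h y" if "y \<in> ?R" for y
      proof -
        have "(2::real)^Suc j * s \<le> 2^k * s" using jk s by (intro mult_right_mono power_increasing) auto
        also have "\<dots> \<le> h y" using k(4) RP that by blast
        finally show ?thesis .
      qed
      then have "?R \<in> ?D" unfolding grid_family_def using RP k jk by (intro CollectI exI[of _ "Suc j"] conjI exI[of _ x]) auto
      moreover have "Q \<subseteq> ?R" unfolding j(2) using s by (intro grid_cell_mono) auto
      moreover have eq: "emeasure lebesgue ?R = ennreal (2 ^ CARD('n)) * emeasure lebesgue Q"
        unfolding j(2) grid_cell_measure(2)[OF L] using s by (simp add: power_mult_distrib flip: ennreal_mult)
      moreover have "Q \<noteq> ?R"
      proof
        assume "Q = ?R"
        then have "ennreal (2 ^ CARD('n)) * emeasure lebesgue Q = emeasure lebesgue Q" using eq by simp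
        then have "2 ^ CARD('n) * (2^j * s) ^ CARD('n) = (2^j * s) ^ CARD('n)"
          unfolding j(2) grid_cell_measure(2)[OF L] using s by (simp flip: ennreal_mult)
        then have "(2::real) ^ CARD('n) = 1" using s by simp
        then show False using power_eq_1_iff[of "2::real" "CARD('n)"] by simp
      qed
      ultimately show ?thesis using RP by (intro bexI[of _ ?R]) auto
    qed
    show "\<exists>R\<in>?D. x \<in> R \<and> (\<forall>P\<in>?D. P \<subseteq> R \<longrightarrow> P = R)" if Q: "Q \<in> ?D" "x \<in> Q" for Q x
    proof -
      obtain j where j: "j \<le> J" "Q = ?c j x" "Q \<subseteq> cball 0 b" "\<forall>y\<in>Q. 2^j * s \<le> h y" using D[OF Q] by blast
      let ?R = "?c 0 x"
      have RQ: "?R \<subseteq> Q" unfolding j(2) using s by (intro grid_cell_mono) auto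
      have "2^0 * s \<le> h y" if "y \<in> ?R" for y
      proof -
        have "(2::real)^0 * s \<le> 2^j * s" using s by (intro mult_right_mono power_increasing) auto
        also have "\<dots> \<le> h y" using j(4) RQ that by blast
        finally show ?thesis .
      qed
      then have "?R \<in> ?D" unfolding grid_family_def using RQ j by (intro CollectI exI[of _ 0] conjI exI[of _ x]) auto
      moreover have "P = ?R" if P: "P \<in> ?D" "P \<subseteq> ?R" for P
      proof -
        obtain y where y: "y \<in> P" using nonempty[OF P(1)] by blast
        obtain k where "P = ?c k y" using D[OF P(1) y] by blast
        moreover have "?c 0 y = ?R" using y P(2) by (intro grid_cell_eq) blast
        ultimately show ?thesis using P(2) grid_cell_mono[of 0 k s v y] s by auto
      qed
      ultimately show ?thesis by (intro bexI[of _ ?R]) auto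
    qed
  qed (use meas in auto)
qed

lemma floor_neq_between:
  fixes u v :: real
  assumes "\<lfloor>u\<rfloor> \<noteq> \<lfloor>v\<rfloor>"
  shows "\<exists>a::int. \<bar>a - v\<bar> \<le> \<bar>u - v\<bar>"
proof (cases "\<lfloor>u\<rfloor> < \<lfloor>v\<rfloor>")
  case True
  then have "u < \<lfloor>v\<rfloor>" "\<lfloor>v\<rfloor> \<le> v" by linarith+
  then show ?thesis by (intro exI[of _ "\<lfloor>v\<rfloor>"]) linarith
next
  case False
  then have "\<lfloor>v\<rfloor> < \<lfloor>u\<rfloor>" using assms by simp
  then have "v < \<lfloor>u\<rfloor>" "\<lfloor>u\<rfloor> \<le> u" by linarith+
  then show ?thesis by (intro exI[of _ "\<lfloor>u\<rfloor>"]) linarith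
qed

lemma not_3_dvd_power_2: "\<not> (3::int) dvd 2 ^ m"
proof -
  have "coprime (3::int) (2 ^ m)" by simp
  then show ?thesis using coprime_common_divisor[of "3::int" "2 ^ m" 3] by auto
qed

text \<open>The one-third trick for finitely many scales: since \<open>3\<close> does not divide \<open>2\<^sup>m\<close>, no interval of
  length at most \<open>L / 3\<close> contains a point of both lattices \<open>L \<int>\<close> and \<open>L \<int> + 2\<^sup>m L / 3\<close>.\<close>

lemma one_third_trick:
  fixes c R L :: real
  assumes L: "0 < L" "6 * R \<le> L"
  shows "(\<forall>y. \<bar>y - c\<bar> < R \<longrightarrow> \<lfloor>y / L\<rfloor> = \<lfloor>c / L\<rfloor>)
    \<or> (\<forall>y. \<bar>y - c\<bar> < R \<longrightarrow> \<lfloor>(y - 2^m * L / 3) / L\<rfloor> = \<lfloor>(c - 2^m * L / 3) / L\<rfloor>)"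
proof (rule ccontr)
  assume "\<not> ?thesis"
  then obtain y z where y: "\<bar>y - c\<bar> < R" "\<lfloor>y / L\<rfloor> \<noteq> \<lfloor>c / L\<rfloor>"
    and z: "\<bar>z - c\<bar> < R" "\<lfloor>(z - 2^m * L / 3) / L\<rfloor> \<noteq> \<lfloor>(c - 2^m * L / 3) / L\<rfloor>" by blast
  obtain a :: int where a: "\<bar>a - c / L\<bar> \<le> \<bar>y / L - c / L\<bar>" using floor_neq_between[OF y(2)] by blast
  obtain b :: int where b: "\<bar>b - (c - 2^m * L / 3) / L\<bar> \<le> \<bar>(z - 2^m * L / 3) / L - (c - 2^m * L / 3) / L\<bar>"
    using floor_neq_between[OF z(2)] by blast
  have "y / L - c / L = (y - c) / L" by (simp add: diff_divide_distrib)
  then have a': "\<bar>a - c / L\<bar> < R / L" using a y(1) L by (simp add: abs_divide divide_strict_right_mono order_le_less_trans)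
  have "(z - 2^m * L / 3) / L - (c - 2^m * L / 3) / L = (z - c) / L" by (simp add: diff_divide_distrib)
  then have b': "\<bar>b - (c - 2^m * L / 3) / L\<bar> < R / L" using b z(1) L by (simp add: abs_divide divide_strict_right_mono order_le_less_trans)
  have "(c - 2^m * L / 3) / L = c / L - 2^m / 3" using L by (simp add: field_simps)
  \<comment> \<open>Each lattice has a point within \<open>R\<close> of \<open>c\<close>, so these
    points are less than \<open>2 * R\<close> apart; after scaling, an integer would differ from
    \<open>2^m / 3\<close> by less than \<open>1 / 3\<close>.\<close>
  then have "\<bar>real_of_int a - real_of_int b - 2^m / 3\<bar> < 2 * (R / L)" using a' b' by linarith
  moreover have "R / L \<le> 1 / 6" using L by (simp add: field_simps)
  ultimately have "\<bar>real_of_int a - real_of_int b - 2^m / 3\<bar> < 1 / 3" by linarith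
  then have "\<bar>3 * (real_of_int a - real_of_int b - 2^m / 3)\<bar> < 1" unfolding abs_mult by simp
  moreover have "3 * (real_of_int a - real_of_int b - 2^m / 3) = 3 * (real_of_int a - real_of_int b) - 2^m" by simp
  ultimately have "\<bar>3 * (real_of_int a - real_of_int b) - 2^m\<bar> < 1" by simp
  then have "\<bar>real_of_int (3 * (a - b) - 2^m)\<bar> < 1" by simp
  then have "3 * (a - b) = 2 ^ m" by linarith
  then show False using not_3_dvd_power_2[of m] by (metis dvd_triv_left)
qed

text \<open>One shift serves all scales: \<open>c\<close> will be the coarsest side, so that at side
  \<open>L\<close> with \<open>c = 2^m * L\<close> the shift in the coordinates of \<open>A\<close>
  is the one of \<open>one_third_trick\<close>.\<close>

definition grid_shift :: "real \<Rightarrow> 'n set \<Rightarrow> real^'n" where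
  "grid_shift c A = (\<chi> i. if i \<in> A then c / 3 else 0)"

lemma ball_subset_grid_cell:
  fixes x0 :: "real^'n"
  assumes "0 < s" "6 * R \<le> 2^j * s" "j \<le> J"
  shows "\<exists>A. ball x0 R \<subseteq> grid_cell (2^j * s) (grid_shift (2^J * s) A) x0"
proof -
  let ?L = "2^j * s"
  \<comment> \<open>The coordinates in which the unshifted grid cuts the interval of radius
    \<open>R\<close> around \<open>x0$i\<close>; there the shifted grid does not cut it.\<close>
  define A where "A = {i. \<not> (\<forall>y. \<bar>y - x0$i\<bar> < R \<longrightarrow> \<lfloor>y / ?L\<rfloor> = \<lfloor>x0$i / ?L\<rfloor>)}"
  have J: "2^J * s = 2^(J - j) * ?L" using assms(3) by (simp flip: power_add mult.assoc)
  have "ball x0 R \<subseteq> grid_cell ?L (grid_shift (2^J * s) A) x0"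
  proof
    fix y assume "y \<in> ball x0 R"
    then have "\<bar>y$i - x0$i\<bar> < R" for i
      using component_le_norm_cart[of "y - x0" i] by (simp add: dist_norm norm_minus_commute)
    then show "y \<in> grid_cell ?L (grid_shift (2^J * s) A) x0"
      using one_third_trick[of ?L R "x0 $ _" "J - j"] assms
      unfolding grid_cell_def grid_shift_def J by (auto simp: A_def)
  qed
  then show ?thesis by blast
qed

section \<open>Slowly varying radii\<close>

definition ball_avg :: "'a::euclidean_space \<Rightarrow> real \<Rightarrow> ('a \<Rightarrow> ennreal) \<Rightarrow> ennreal" where
  "ball_avg x0 R f = (\<integral>\<^sup>+y\<in>ball x0 R. f y \<partial>lebesgue) / ennreal (measure lebesgue (ball x0 R))"

lemma measure_ball_cart:
  fixes x :: "real^'n"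
  shows "0 \<le> R \<Longrightarrow> measure lebesgue (ball x R) = unit_ball_vol (CARD('n)) * R ^ CARD('n)"
  using content_ball[of R x] by simp

lemma unit_ball_vol_pos_card: "0 < unit_ball_vol (real CARD('n::finite))"
  by (intro unit_ball_vol_pos) simp

lemma emeasure_ball_cart:
  fixes x :: "real^'n"
  shows "0 \<le> R \<Longrightarrow> emeasure lebesgue (ball x R) = ennreal (unit_ball_vol (CARD('n)) * R ^ CARD('n))"
  using emeasure_ball[of R x] by simp

text \<open>The superlevel sets are unions of open balls, hence open, whatever the coefficients
  \<open>c\<close> are.\<close>

lemma measurable_ball_SUP:
  fixes c :: "'a::euclidean_space \<Rightarrow> real \<Rightarrow> ennreal"
  shows "(\<lambda>x. SUP (x0, R)\<in>{(x0, R). P x0 R \<and> x \<in> ball x0 R}. c x0 R) \<in> borel_measurable lebesgue"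
proof (rule borel_measurableI_greater)
  fix a
  have "{x. a < (SUP (x0, R)\<in>{(x0, R). P x0 R \<and> x \<in> ball x0 R}. c x0 R)}
    = (\<Union>(x0, R)\<in>{(x0, R). P x0 R \<and> a < c x0 R}. ball x0 R)"
    by (auto simp: less_SUP_iff) blast
  moreover have "open (\<Union>(x0, R)\<in>{(x0, R). P x0 R \<and> a < c x0 R}. ball x0 R)" by (intro open_UN) auto
  ultimately show "{x \<in> space lebesgue. a < (SUP (x0, R)\<in>{(x0, R). P x0 R \<and> x \<in> ball x0 R}. c x0 R)} \<in> sets lebesgue"
    by (simp add: sets_completionI_sets)
qed

locale slowly_varying =
  fixes \<rho> :: "real^'n \<Rightarrow> real" and l0 C0 :: real
  assumes rho_pos: "0 < \<rho> x" and l0: "0 < l0" and C0: "1 < C0"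
    and rho_lower: "\<rho> x * (1 + norm (x - y) / \<rho> x) powr (- l0) \<le> C0 * \<rho> y"
    and rho_upper: "\<rho> y \<le> C0 * \<rho> x * (1 + norm (x - y) / \<rho> x) powr (l0 / (l0 + 1))"
begin

definition local_max :: "(real^'n \<Rightarrow> ennreal) \<Rightarrow> real^'n \<Rightarrow> ennreal" where
  "local_max f x = (SUP (x0, R)\<in>{(x0, R). (0 < R \<and> R \<le> \<rho> x0) \<and> x \<in> ball x0 R}. ball_avg x0 R f)"

text \<open>The conditions on \<open>6 * R\<close> keep the sides of suitable cells between the
  finest side \<open>(1/2)^N\<close> and the coarsest side \<open>2^N\<close>; with the bound on the
  centre, finitely many cells suffice.\<close>

definition truncation :: "nat \<Rightarrow> real^'n \<Rightarrow> real \<Rightarrow> bool" where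
  "truncation N x0 R \<longleftrightarrow> (0 < R \<and> R \<le> \<rho> x0) \<and> (1/2)^N \<le> 6 * R \<and> 6 * R \<le> 2^N \<and> norm x0 \<le> N"

definition local_max_trunc :: "nat \<Rightarrow> (real^'n \<Rightarrow> ennreal) \<Rightarrow> real^'n \<Rightarrow> ennreal" where
  "local_max_trunc N f x = (SUP (x0, R)\<in>{(x0, R). truncation N x0 R \<and> x \<in> ball x0 R}. ball_avg x0 R f)"

text \<open>The cell chosen for a ball \<open>B(x0, R)\<close> with \<open>R \<le> \<rho> x0\<close>
  has side at most \<open>12 * R\<close> and stays within distance \<open>12 * n * R\<close> of
  \<open>x0\<close>; slow variation then bounds its side by this multiple of \<open>\<rho> y\<close>
  at all of its points \<open>y\<close>.\<close>

definition cell_const :: real where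
  "cell_const = 12 * C0 * (1 + 12 * real CARD('n)) powr l0"

text \<open>\<open>2 * N\<close> doublings lead from \<open>(1/2)^N\<close> to \<open>2^N\<close>.
  The bound on the region adds \<open>norm x0 \<le> N\<close> and the distance
  \<open>12 * n * R \<le> 2 * n * 2^N\<close>.\<close>

definition local_cells :: "nat \<Rightarrow> 'n set \<Rightarrow> (real^'n) set set" where
  "local_cells N A = grid_family ((1/2)^N) (2 * N) (grid_shift (2^(2*N) * (1/2)^N) A)
     (real N + 2 * real CARD('n) * 2^N) (\<lambda>y. cell_const * \<rho> y)"

text \<open>Volume of a cube of side \<open>12 * R\<close> divided by that of a ball of radius
  \<open>R\<close>.\<close>

definition ball_cell_ratio :: real where
  "ball_cell_ratio = 12 ^ CARD('n) / unit_ball_vol (CARD('n))"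

lemma ball_cell_ratio_pos: "0 < ball_cell_ratio"
  unfolding ball_cell_ratio_def using unit_ball_vol_pos_card[where 'n='n] by simp

lemma cell_const_pos: "0 < cell_const"
  using C0 by (simp add: cell_const_def add_pos_pos)

lemma dyadic_local_cells: "dyadic_family lebesgue (local_cells N A) (2 ^ CARD('n))"
  unfolding local_cells_def by (rule grid_family_dyadic) simp

lemma measurable_local_max [measurable]:
  "local_max f \<in> borel_measurable lebesgue" "local_max_trunc N f \<in> borel_measurable lebesgue"
  unfolding local_max_def[abs_def] local_max_trunc_def[abs_def] by (rule measurable_ball_SUP)+

lemma truncation_mono: "M \<le> N \<Longrightarrow> truncation M x0 R \<Longrightarrow> truncation N x0 R"
proof -
  assume MN: "M \<le> N" and tr: "truncation M x0 R"
  have "(1/2::real)^N \<le> (1/2)^M" "(2::real)^M \<le> 2^N" "real M \<le> real N"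
    using MN by (auto intro: power_increasing power_decreasing simp del: power_one_over)
  then show "truncation N x0 R" using tr unfolding truncation_def by linarith
qed

lemma truncation_exists:
  assumes "0 < R" "R \<le> \<rho> x0"
  shows "\<exists>N. truncation N x0 R"
proof -
  obtain a where a: "(1/2)^a < 6 * R" using real_arch_pow_inv[of "6 * R" "1/2"] assms by auto
  obtain b where b: "6 * R < 2^b" using real_arch_pow[of 2 "6 * R"] by auto
  obtain c :: nat where c: "norm x0 \<le> c" using real_arch_simple by blast
  let ?N = "max a (max b c)"
  have "(1/2::real)^?N \<le> (1/2)^a" by (intro power_decreasing) auto
  moreover have "(2::real)^b \<le> 2^?N" by (intro power_increasing) auto
  moreover have "real c \<le> real ?N" by simp
  ultimately have "truncation ?N x0 R" unfolding truncation_def using a b c assms by linarith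
  then show ?thesis by blast
qed

lemma local_max_eq_SUP: "local_max f x = (SUP N. local_max_trunc N f x)"
proof (rule antisym)
  show "local_max f x \<le> (SUP N. local_max_trunc N f x)"
    unfolding local_max_def
  proof (intro SUP_least, clarify)
    fix x0 R assume R: "0 < R" "R \<le> \<rho> x0" "x \<in> ball x0 R"
    then obtain N where "truncation N x0 R" using truncation_exists by blast
    then have "ball_avg x0 R f \<le> local_max_trunc N f x"
      unfolding local_max_trunc_def using R by (intro SUP_upper2[of "(x0, R)"]) auto
    also have "\<dots> \<le> (SUP N. local_max_trunc N f x)" by (rule SUP_upper) simp
    finally show "ball_avg x0 R f \<le> (SUP N. local_max_trunc N f x)" .
  qed
  show "(SUP N. local_max_trunc N f x) \<le> local_max f x"
    unfolding local_max_def local_max_trunc_def truncation_def by (intro SUP_least SUP_subset_mono) auto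
qed

lemma local_max_trunc_mono: "M \<le> N \<Longrightarrow> local_max_trunc M f x \<le> local_max_trunc N f x"
  unfolding local_max_trunc_def by (intro SUP_subset_mono) (auto dest: truncation_mono)

lemma ball_subset_local_cell:
  assumes "truncation N x0 R"
  shows "\<exists>A. \<exists>Q\<in>local_cells N A. ball x0 R \<subseteq> Q \<and> emeasure lebesgue Q \<le> ennreal ((12 * R) ^ CARD('n))"
proof -
  let ?s = "(1/2::real)^N"
  note tr = assms[unfolded truncation_def]
  have top: "2^(2*N) * ?s = 2^N"
    by (simp add: mult_2 power_add power_one_over)
  \<comment> \<open>The smallest side that is at least \<open>6 * R\<close>; minimality, or
    \<open>(1/2)^N \<le> 6 * R\<close> if \<open>j = 0\<close>, makes it at most
    \<open>12 * R\<close>.\<close>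
  define j where "j = (LEAST j. 6 * R \<le> 2^j * ?s)"
  have ex: "6 * R \<le> 2^(2*N) * ?s" using tr unfolding top by simp
  then have j: "6 * R \<le> 2^j * ?s" "j \<le> 2 * N"
    unfolding j_def by (rule LeastI, rule Least_le)
  have L12: "2^j * ?s \<le> 12 * R"
  proof (cases j)
    case 0
    then show ?thesis using tr by simp
  next
    case (Suc i)
    then have "\<not> 6 * R \<le> 2^i * ?s" using not_less_Least[of i "\<lambda>j. 6 * R \<le> 2^j * ?s"] unfolding j_def by auto
    then show ?thesis using Suc by simp
  qed
  let ?L = "2^j * ?s"
  have L0: "0 < ?L" by simp
  obtain A where A: "ball x0 R \<subseteq> grid_cell ?L (grid_shift (2^(2*N) * ?s) A) x0"
    using ball_subset_grid_cell[of ?s R j "2*N" x0] j by auto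
  let ?Q = "grid_cell ?L (grid_shift (2^(2*N) * ?s) A) x0"
  have near: "norm (y - x0) \<le> 12 * real CARD('n) * R" if "y \<in> ?Q" for y
  proof -
    have "norm (y - x0) < real CARD('n) * ?L" by (rule grid_cell_diameter[OF L0 that]) simp
    also have "\<dots> \<le> real CARD('n) * (12 * R)" using L12 by (intro mult_left_mono) auto
    finally show ?thesis by simp
  qed
  have "?Q \<subseteq> cball 0 (real N + 2 * real CARD('n) * 2^N)"
  proof
    fix y assume y: "y \<in> ?Q"
    have "real CARD('n) * (6 * R) \<le> real CARD('n) * 2^N" using tr by (intro mult_left_mono) auto
    then have "norm (y - x0) \<le> 2 * real CARD('n) * 2^N" using near[OF y] by linarith
    then show "y \<in> cball 0 (real N + 2 * real CARD('n) * 2^N)"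
      using tr norm_triangle_ineq[of "y - x0" x0] by simp
  qed
  moreover have "?L \<le> cell_const * \<rho> y" if y: "y \<in> ?Q" for y
  proof -
    have r0: "0 < \<rho> x0" by (rule rho_pos)
    have "norm (x0 - y) / \<rho> x0 \<le> 12 * real CARD('n)"
    proof -
      have "12 * real CARD('n) * R \<le> 12 * real CARD('n) * \<rho> x0" using tr by (intro mult_left_mono) auto
      then have "norm (x0 - y) \<le> 12 * real CARD('n) * \<rho> x0"
        using near[OF y] unfolding norm_minus_commute[of x0 y] by linarith
      then show ?thesis using r0 by (simp add: divide_le_eq)
    qed
    then have "(1 + 12 * real CARD('n)) powr (- l0) \<le> (1 + norm (x0 - y) / \<rho> x0) powr (- l0)"
      using l0 r0 by (intro powr_mono2') (auto intro!: add_pos_nonneg)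
    then have "\<rho> x0 * (1 + 12 * real CARD('n)) powr (- l0) \<le> C0 * \<rho> y"
      using rho_lower[of x0 y] r0 by (meson mult_left_mono less_imp_le order_trans)
    then have "\<rho> x0 \<le> C0 * \<rho> y * (1 + 12 * real CARD('n)) powr l0"
      by (simp add: powr_minus divide_simps add_pos_pos split: if_splits)
    then have "R \<le> C0 * \<rho> y * (1 + 12 * real CARD('n)) powr l0" using tr by linarith
    then have "12 * R \<le> cell_const * \<rho> y" unfolding cell_const_def by (simp add: mult_ac)
    then show ?thesis using L12 by linarith
  qed
  ultimately have "?Q \<in> local_cells N A"
    unfolding local_cells_def grid_family_def using j(2) by blast
  moreover have "emeasure lebesgue ?Q \<le> ennreal ((12 * R) ^ CARD('n))"
    unfolding grid_cell_measure(2)[OF L0] using L12 L0 by (intro ennreal_leI power_mono) auto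
  ultimately show ?thesis using A by blast
qed

lemma ball_avg_le_dmax:
  assumes tr: "truncation N x0 R" and x: "x \<in> ball x0 R"
  shows "\<exists>A. ball_avg x0 R f \<le> ennreal ball_cell_ratio * dmax lebesgue (local_cells N A) f x"
proof -
  obtain A Q where Q: "Q \<in> local_cells N A" "ball x0 R \<subseteq> Q" "emeasure lebesgue Q \<le> ennreal ((12 * R) ^ CARD('n))"
    using ball_subset_local_cell[OF tr] by blast
  interpret dyadic_family lebesgue "local_cells N A" "2 ^ CARD('n)" by (rule dyadic_local_cells)
  have R: "0 < R" using tr by (simp add: truncation_def)
  define B where "B = measure lebesgue (ball x0 R)"
  have B: "0 < B" "B = unit_ball_vol (CARD('n)) * R ^ CARD('n)"
    using R unit_ball_vol_pos_card[where 'n='n] measure_ball_cart[of R x0] unfolding B_def by auto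
  have "(\<integral>\<^sup>+y\<in>ball x0 R. f y \<partial>lebesgue) \<le> (\<integral>\<^sup>+y\<in>Q. f y \<partial>lebesgue)"
    using Q by (intro nn_integral_mono) (auto simp: indicator_def)
  also have "\<dots> = avg lebesgue f Q * emeasure lebesgue Q"
    by (rule avg_mult_emeasure[OF Q(1), symmetric])
  also have "\<dots> \<le> dmax lebesgue (local_cells N A) f x * ennreal ((12 * R) ^ CARD('n))"
    using Q x by (intro mult_mono dmax_upper subsetD[OF Q(2)] zero_le) (simp_all only:)
  also have "(12 * R) ^ CARD('n) = ball_cell_ratio * B"
    using less_imp_neq[OF unit_ball_vol_pos_card[where 'n='n]] by (simp add: B(2) ball_cell_ratio_def power_mult_distrib)
  finally have "(\<integral>\<^sup>+y\<in>ball x0 R. f y \<partial>lebesgue) \<le> (ennreal ball_cell_ratio * dmax lebesgue (local_cells N A) f x) * ennreal B"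
    using B ball_cell_ratio_pos by (simp add: ennreal_mult mult_ac)
  then have "ball_avg x0 R f \<le> (ennreal ball_cell_ratio * dmax lebesgue (local_cells N A) f x) * ennreal B / ennreal B"
    unfolding ball_avg_def B_def[symmetric] by (rule divide_right_mono_ennreal)
  also have "\<dots> = ennreal ball_cell_ratio * dmax lebesgue (local_cells N A) f x"
    using B(1) by (intro mult_divide_eq_ennreal) auto
  finally show ?thesis by blast
qed

text \<open>The shift that captures a ball depends on the ball, so the sum over all shifts is taken.
  The root of order \<open>r\<close> only serves to bring the supremum to one side.\<close>

lemma local_max_trunc_le_vmax:
  assumes r: "0 < r"
  shows "(\<Sum>k. ennpowr (local_max_trunc N (f k) x) r)
    \<le> ennreal (ball_cell_ratio powr r) * (\<Sum>A\<in>UNIV. vmax lebesgue r (local_cells N A) f x)"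
proof -
  let ?S = "\<lambda>k. \<Sum>A\<in>UNIV. ennpowr (dmax lebesgue (local_cells N A) (f k) x) r"
  have "ennpowr (local_max_trunc N (f k) x) r \<le> ennreal (ball_cell_ratio powr r) * ?S k" for k
  proof -
    have "local_max_trunc N (f k) x \<le> ennpowr (ennreal (ball_cell_ratio powr r) * ?S k) (1 / r)"
      unfolding local_max_trunc_def
    proof (intro SUP_least, clarify)
      fix x0 R assume "truncation N x0 R" "x \<in> ball x0 R"
      then obtain A where "ball_avg x0 R (f k) \<le> ennreal ball_cell_ratio * dmax lebesgue (local_cells N A) (f k) x"
        using ball_avg_le_dmax by blast
      then have "ennpowr (ball_avg x0 R (f k)) r \<le> ennreal (ball_cell_ratio powr r) * ennpowr (dmax lebesgue (local_cells N A) (f k) x) r"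
        using ennpowr_mono[of _ _ r] r ball_cell_ratio_pos by (fastforce simp: ennpowr_mult ennpowr_ennreal)
      also have "\<dots> \<le> ennreal (ball_cell_ratio powr r) * ?S k"
        by (intro mult_left_mono member_le_sum) auto
      finally show "ball_avg x0 R (f k) \<le> ennpowr (ennreal (ball_cell_ratio powr r) * ?S k) (1 / r)"
        using r by (subst ennpowr_le_iff[symmetric]) auto
    qed
    then show ?thesis using r by (subst ennpowr_le_iff) auto
  qed
  then have "(\<Sum>k. ennpowr (local_max_trunc N (f k) x) r) \<le> (\<Sum>k. ennreal (ball_cell_ratio powr r) * ?S k)"
    by (intro suminf_le) auto
  also have "\<dots> = ennreal (ball_cell_ratio powr r) * (\<Sum>k. ?S k)" by simp
  also have "(\<Sum>k. ?S k) = (\<Sum>A\<in>UNIV. vmax lebesgue r (local_cells N A) f x)"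
    unfolding vmax_def by (rule suminf_sum) auto
  finally show ?thesis .
qed

lemma suminf_local_max_eq_SUP:
  assumes "0 < r"
  shows "(\<Sum>k. ennpowr (local_max (f k) x) r) = (SUP N. \<Sum>k. ennpowr (local_max_trunc N (f k) x) r)"
  unfolding local_max_eq_SUP ennpowr_SUP[OF assms]
  using assms by (intro ennreal_suminf_SUP_eq incseq_SucI ennpowr_mono local_max_trunc_mono) auto

text \<open>The dyadic bound has a constant independent of the truncation \<open>N\<close>; the
  shifts cost powers of their number, and monotone convergence removes \<open>N\<close>.\<close>

lemma local_strong:
  assumes r: "1 < r" and p: "1 < p" and C: "0 < C"
    and [measurable]: "w \<in> borel_measurable lebesgue" "\<And>k. f k \<in> borel_measurable lebesgue" and w: "\<And>x. 0 < w x"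
    and Ap: "\<And>N A. Ap_on lebesgue (local_cells N A) p C w"
  shows "(\<integral>\<^sup>+x. ennpowr (\<Sum>k. ennpowr (local_max (f k) x) r) (p / r) * ennreal (w x) \<partial>lebesgue)
    \<le> ennreal (ball_cell_ratio powr p * real (CARD('n set)) powr (p / r) * real (CARD('n set)) * strong_const r p (2 * weak_const r (2 ^ CARD('n)) 1) C)
      * (\<integral>\<^sup>+x. ennpowr (lr_norm r (\<lambda>k. f k x)) p * ennreal (w x) \<partial>lebesgue)"
proof -
  let ?I = "\<integral>\<^sup>+x. ennpowr (lr_norm r (\<lambda>k. f k x)) p * ennreal (w x) \<partial>lebesgue"
  let ?SC = "strong_const r p (2 * weak_const r (2 ^ CARD('n)) 1) C"
  let ?c = "CARD('n set)"
  have SC: "0 < ?SC" using p C r weak_const_pos[of r 1 "2 ^ CARD('n)"] by (intro strong_const_pos) auto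
  define Z where "Z N x = (\<Sum>k. ennpowr (local_max_trunc N (f k) x) r)" for N x
  have [measurable]: "Z N \<in> borel_measurable lebesgue" for N unfolding Z_def[abs_def] by measurable
  have Z_mono: "Z M x \<le> Z N x" if "M \<le> N" for M N x
    unfolding Z_def using r by (intro suminf_le ennpowr_mono local_max_trunc_mono[OF that]) auto
  have Z_le: "(\<integral>\<^sup>+x. ennpowr (Z N x) (p / r) * ennreal (w x) \<partial>lebesgue)
    \<le> ennreal (ball_cell_ratio powr p * real ?c powr (p / r) * real ?c * ?SC) * ?I" for N
  proof -
    let ?V = "\<lambda>A x. ennpowr (vmax lebesgue r (local_cells N A) f x) (p / r) * ennreal (w x)"
    have [measurable]: "vmax lebesgue r (local_cells N A) f \<in> borel_measurable lebesgue" for A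
    proof -
      interpret dyadic_family lebesgue "local_cells N A" "2 ^ CARD('n)" by (rule dyadic_local_cells)
      show ?thesis by measurable
    qed
    have "(\<integral>\<^sup>+x. ennpowr (Z N x) (p / r) * ennreal (w x) \<partial>lebesgue)
      \<le> (\<integral>\<^sup>+x. ennreal (ball_cell_ratio powr p * real ?c powr (p / r)) * (\<Sum>A\<in>UNIV. ?V A x) \<partial>lebesgue)"
    proof (intro nn_integral_mono)
      fix x
      have "ennpowr (Z N x) (p / r) \<le> ennpowr (ennreal (ball_cell_ratio powr r) * (\<Sum>A\<in>UNIV. vmax lebesgue r (local_cells N A) f x)) (p / r)"
        unfolding Z_def using r p by (intro ennpowr_mono local_max_trunc_le_vmax) auto
      also have "\<dots> = ennreal (ball_cell_ratio powr p) * ennpowr (\<Sum>A\<in>UNIV. vmax lebesgue r (local_cells N A) f x) (p / r)"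
        using r by (simp add: ennpowr_mult ennpowr_ennreal powr_powr)
      also have "\<dots> \<le> ennreal (ball_cell_ratio powr p) * (ennpowr (of_nat ?c) (p / r) * (\<Sum>A\<in>UNIV. ennpowr (vmax lebesgue r (local_cells N A) f x) (p / r)))"
        using r p by (intro mult_left_mono ennpowr_sum_le_card) auto
      also have "ennpowr (of_nat ?c) (p / r) = ennreal (real ?c powr (p / r))"
        unfolding ennreal_of_nat_eq_real_of_nat by (rule ennpowr_ennreal) simp
      finally have "ennpowr (Z N x) (p / r) * ennreal (w x) \<le> ennreal (ball_cell_ratio powr p) * (ennreal (real ?c powr (p / r)) * (\<Sum>A\<in>UNIV. ennpowr (vmax lebesgue r (local_cells N A) f x) (p / r))) * ennreal (w x)"
        by (rule mult_right_mono) simp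
      also have "\<dots> = ennreal (ball_cell_ratio powr p * real ?c powr (p / r)) * (\<Sum>A\<in>UNIV. ?V A x)"
        by (simp add: ennreal_mult sum_distrib_right mult.assoc)
      finally show "ennpowr (Z N x) (p / r) * ennreal (w x) \<le> \<dots>" .
    qed
    also have "\<dots> = ennreal (ball_cell_ratio powr p * real ?c powr (p / r)) * (\<Sum>A\<in>UNIV. \<integral>\<^sup>+x. ?V A x \<partial>lebesgue)"
      by (simp add: nn_integral_cmult nn_integral_sum)
    also have "\<dots> \<le> ennreal (ball_cell_ratio powr p * real ?c powr (p / r)) * (\<Sum>A\<in>(UNIV::'n set set). ennreal ?SC * ?I)"
    proof (intro mult_left_mono sum_mono)
      fix A :: "'n set"
      interpret dyadic_family lebesgue "local_cells N A" "2 ^ CARD('n)" by (rule dyadic_local_cells)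
      show "(\<integral>\<^sup>+x. ?V A x \<partial>lebesgue) \<le> ennreal ?SC * ?I" using r p C w Ap by (intro vmax_strong) auto
    qed simp
    also have "\<dots> = ennreal (ball_cell_ratio powr p * real ?c powr (p / r) * real ?c * ?SC) * ?I"
      using SC by (simp add: ennreal_mult ennreal_of_nat_eq_real_of_nat mult.assoc)
    finally show ?thesis .
  qed
  have "(\<integral>\<^sup>+x. ennpowr (\<Sum>k. ennpowr (local_max (f k) x) r) (p / r) * ennreal (w x) \<partial>lebesgue)
    = (\<integral>\<^sup>+x. (SUP N. ennpowr (Z N x) (p / r) * ennreal (w x)) \<partial>lebesgue)"
    using r p by (simp add: suminf_local_max_eq_SUP Z_def[symmetric] ennpowr_SUP SUP_mult_right_ennreal)
  also have "\<dots> = (SUP N. \<integral>\<^sup>+x. ennpowr (Z N x) (p / r) * ennreal (w x) \<partial>lebesgue)"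
    using r p by (intro nn_integral_monotone_convergence_SUP incseq_SucI le_funI mult_right_mono ennpowr_mono Z_mono) auto
  also have "\<dots> \<le> ennreal (ball_cell_ratio powr p * real ?c powr (p / r) * real ?c * ?SC) * ?I"
    by (intro SUP_least Z_le)
  finally show ?thesis .
qed

lemma local_weak:
  assumes r: "1 < r" and C: "0 < C" and t: "0 < t"
    and [measurable]: "w \<in> borel_measurable lebesgue" "\<And>k. f k \<in> borel_measurable lebesgue" and w: "\<And>x. 0 < w x"
    and A1: "\<And>N A. A1_on lebesgue (local_cells N A) C w"
  shows "wint lebesgue w {x. ennreal (t powr r) < (\<Sum>k. ennpowr (local_max (f k) x) r)}
    \<le> ennreal (real (CARD('n set)) * weak_const r (2 ^ CARD('n)) C * ball_cell_ratio * real (CARD('n set)) powr (1 / r) / t)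
      * (\<integral>\<^sup>+x. lr_norm r (\<lambda>k. f k x) * ennreal (w x) \<partial>lebesgue)"
proof -
  let ?I = "\<integral>\<^sup>+x. lr_norm r (\<lambda>k. f k x) * ennreal (w x) \<partial>lebesgue"
  let ?W = "weak_const r (2 ^ CARD('n)) C"
  let ?c = "CARD('n set)"
  have W: "0 < ?W" using r C by (intro weak_const_pos) auto
  have c: "0 < real ?c" using zero_less_card_finite[where 'a="'n set"] by (simp only: of_nat_0_less_iff)
  \<comment> \<open>Chosen such that dyadic values at most \<open>t' powr r\<close> for all shifts
    force the truncated sum to be at most \<open>t powr r\<close>.\<close>
  define t' where "t' = t / (ball_cell_ratio * real ?c powr (1 / r))"
  have t': "0 < t'" unfolding t'_def using t ball_cell_ratio_pos c by (intro divide_pos_pos mult_pos_pos) auto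
  have t'_eq: "real ?c * ball_cell_ratio powr r * t' powr r = t powr r"
    unfolding t'_def using t ball_cell_ratio_pos c r by (simp add: powr_divide powr_mult powr_powr)
  define Z where "Z N x = (\<Sum>k. ennpowr (local_max_trunc N (f k) x) r)" for N x
  have [measurable]: "Z N \<in> borel_measurable lebesgue" for N unfolding Z_def[abs_def] by measurable
  have Z_mono: "Z M x \<le> Z N x" if "M \<le> N" for M N x
    unfolding Z_def using r by (intro suminf_le ennpowr_mono local_max_trunc_mono[OF that]) auto
  have Z_le: "wint lebesgue w {x. ennreal (t powr r) < Z N x} \<le> ennreal (real ?c * ?W * ball_cell_ratio * real ?c powr (1 / r) / t) * ?I" for N
  proof -
    define E where "E A = {x. ennreal (t' powr r) < vmax lebesgue r (local_cells N A) f x}" for A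
    have [measurable]: "E A \<in> sets lebesgue" for A
    proof -
      interpret dyadic_family lebesgue "local_cells N A" "2 ^ CARD('n)" by (rule dyadic_local_cells)
      have "{x\<in>space lebesgue. ennreal (t' powr r) < vmax lebesgue r (local_cells N A) f x} \<in> sets lebesgue"
        by (rule borel_measurable_less[OF borel_measurable_const measurable_vmax])
      then show ?thesis unfolding E_def by (simp only: space_completion space_lborel space_borel UNIV_I simp_thms)
    qed
    have sub: "\<exists>A. x \<in> E A" if x: "ennreal (t powr r) < Z N x" for x
    proof (rule ccontr)
      assume "\<not> ?thesis"
      then have "vmax lebesgue r (local_cells N A) f x \<le> ennreal (t' powr r)" for A by (auto simp: E_def not_less)
      then have "(\<Sum>A\<in>UNIV. vmax lebesgue r (local_cells N A) f x) \<le> of_nat ?c * ennreal (t' powr r)"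
        by (intro sum_bounded_above) auto
      then have "ennreal (ball_cell_ratio powr r) * (\<Sum>A\<in>UNIV. vmax lebesgue r (local_cells N A) f x)
        \<le> ennreal (ball_cell_ratio powr r) * (of_nat ?c * ennreal (t' powr r))"
        by (rule mult_left_mono) simp
      then have "Z N x \<le> ennreal (ball_cell_ratio powr r) * (of_nat ?c * ennreal (t' powr r))"
        using local_max_trunc_le_vmax[of r N f x] r unfolding Z_def by force
      also have "\<dots> = ennreal (t powr r)"
        unfolding t'_eq[symmetric] by (simp add: ennreal_mult ennreal_of_nat_eq_real_of_nat mult_ac)
      finally show False using x by simp
    qed
    have "wint lebesgue w {x. ennreal (t powr r) < Z N x} \<le> (\<integral>\<^sup>+x. (\<Sum>A\<in>UNIV. ennreal (w x) * indicator (E A) x) \<partial>lebesgue)"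
      unfolding wint_def
    proof (intro nn_integral_mono)
      fix x
      show "ennreal (w x) * indicator {x. ennreal (t powr r) < Z N x} x \<le> (\<Sum>A\<in>UNIV. ennreal (w x) * indicator (E A) x)"
      proof (cases "ennreal (t powr r) < Z N x")
        case True
        then obtain A where A: "x \<in> E A" using sub by blast
        have "ennreal (w x) * indicator {x. ennreal (t powr r) < Z N x} x \<le> ennreal (w x) * indicator (E A) x"
          using A by (auto simp: indicator_def)
        also have "\<dots> \<le> (\<Sum>A\<in>UNIV. ennreal (w x) * indicator (E A) x)"
          by (rule member_le_sum[of A UNIV "\<lambda>A. ennreal (w x) * indicator (E A) x"]) auto
        finally show ?thesis .
      qed simp
    qed
    also have "\<dots> = (\<Sum>A\<in>UNIV. wint lebesgue w (E A))"
      unfolding wint_def by (rule nn_integral_sum) measurable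
    also have "\<dots> \<le> (\<Sum>A\<in>(UNIV::'n set set). ennreal (?W / t') * ?I)"
    proof (intro sum_mono)
      fix A :: "'n set"
      interpret dyadic_family lebesgue "local_cells N A" "2 ^ CARD('n)" by (rule dyadic_local_cells)
      have "wint lebesgue w (E A) \<le> ennreal (?W / t') * (\<integral>\<^sup>+x\<in>\<Union>(local_cells N A). lr_norm r (\<lambda>k. f k x) * ennreal (w x) \<partial>lebesgue)"
        unfolding E_def using r C t' w A1 by (intro vmax_weak_type) auto
      also have "\<dots> \<le> ennreal (?W / t') * ?I"
        by (intro mult_left_mono nn_integral_mono) (auto simp: indicator_def)
      finally show "wint lebesgue w (E A) \<le> ennreal (?W / t') * ?I" .
    qed
    also have "\<dots> = ennreal (real ?c * (?W / t')) * ?I"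
      by (simp only: sum_constant ennreal_mult'[OF of_nat_0_le_iff] ennreal_of_nat_eq_real_of_nat mult.assoc)
    also have "real ?c * (?W / t') = real ?c * ?W * ball_cell_ratio * real ?c powr (1 / r) / t"
      unfolding t'_def by simp
    finally show ?thesis .
  qed
  \<comment> \<open>The strict inequality makes the superlevel set of the supremum the increasing
    union of the superlevel sets of \<open>Z N\<close>.\<close>
  have "wint lebesgue w {x. ennreal (t powr r) < (\<Sum>k. ennpowr (local_max (f k) x) r)}
    = (\<integral>\<^sup>+x. (SUP N. ennreal (w x) * indicator {x. ennreal (t powr r) < Z N x} x) \<partial>lebesgue)"
    unfolding wint_def
  proof (intro nn_integral_cong)
    fix x
    have eq: "(\<Sum>k. ennpowr (local_max (f k) x) r) = (SUP N. Z N x)"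
      using r by (simp add: suminf_local_max_eq_SUP Z_def)
    show "ennreal (w x) * indicator {x. ennreal (t powr r) < (\<Sum>k. ennpowr (local_max (f k) x) r)} x
      = (SUP N. ennreal (w x) * indicator {x. ennreal (t powr r) < Z N x} x)"
    proof (cases "ennreal (t powr r) < (SUP N. Z N x)")
      case True
      then obtain N where "ennreal (t powr r) < Z N x" by (auto simp: less_SUP_iff)
      then show ?thesis using True
        by (intro antisym SUP_least SUP_upper2[of N]) (auto simp: eq indicator_def)
    next
      case False
      then have "\<not> ennreal (t powr r) < Z N x" for N by (auto simp: less_SUP_iff)
      then show ?thesis using False by (simp add: eq)
    qed
  qed
  also have "\<dots> = (SUP N. \<integral>\<^sup>+x. ennreal (w x) * indicator {x. ennreal (t powr r) < Z N x} x \<partial>lebesgue)"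
  proof (rule nn_integral_monotone_convergence_SUP)
    show "incseq (\<lambda>N x. ennreal (w x) * indicator {x. ennreal (t powr r) < Z N x} x)"
      by (intro incseq_SucI le_funI mult_left_mono) (auto simp: indicator_def intro: less_le_trans[OF _ Z_mono])
    show "(\<lambda>x. ennreal (w x) * indicator {x. ennreal (t powr r) < Z N x} x) \<in> borel_measurable lebesgue" for N
    proof -
      have "{x\<in>space lebesgue. ennreal (t powr r) < Z N x} \<in> sets lebesgue" by measurable
      then have [measurable]: "{x. ennreal (t powr r) < Z N x} \<in> sets lebesgue"
        by (simp only: space_completion space_lborel space_borel UNIV_I simp_thms)
      show ?thesis by measurable
    qed
  qed
  also have "\<dots> \<le> ennreal (real ?c * ?W * ball_cell_ratio * real ?c powr (1 / r) / t) * ?I"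
    using Z_le unfolding wint_def by (intro SUP_least)
  finally show ?thesis .
qed

end

lemma sigma_finite_lebesgue: "sigma_finite_measure (lebesgue :: 'a::euclidean_space measure)"
proof
  show "\<exists>A. countable A \<and> A \<subseteq> sets (lebesgue :: 'a measure) \<and> \<Union> A = space lebesgue \<and> (\<forall>a\<in>A. emeasure lebesgue a \<noteq> \<infinity>)"
  proof (intro exI[of _ "range (\<lambda>n::nat. cball (0::'a) n)"] conjI ballI)
    show "\<Union> (range (\<lambda>n::nat. cball (0::'a) n)) = space lebesgue"
      using real_arch_simple by (auto simp: cball_def)
    fix a assume "a \<in> range (\<lambda>n::nat. cball (0::'a) n)"
    then show "emeasure lebesgue a \<noteq> \<infinity>" using emeasure_bounded_finite[of a] by (auto simp: less_top)
  qed auto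
qed

lemma measurable_lebesgue_ident [measurable]: "(\<lambda>x::'a::euclidean_space. x) \<in> lebesgue \<rightarrow>\<^sub>M borel"
  by (rule measurable_completion) simp

lemma ball_in_sets_lebesgue [measurable]: "ball (x::'a::euclidean_space) R \<in> sets lebesgue"
  by (simp add: sets_completionI_sets)

lemma ennreal_suminf_swap: "(\<Sum>i. \<Sum>j. f i j :: ennreal) = (\<Sum>j. \<Sum>i. f i j)"
  using nn_integral_suminf[of "\<lambda>j i. f i j" "count_space UNIV"]
  by (simp add: nn_integral_count_space_nat)

context slowly_varying
begin

section \<open>Weight conditions on balls and what they imply on cells\<close>

definition psi_vol :: "real \<Rightarrow> real^'n \<Rightarrow> real \<Rightarrow> real" where
  "psi_vol \<theta> x R = (1 + R / \<rho> x) powr \<theta> * (unit_ball_vol (CARD('n)) * R ^ CARD('n))"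

definition ball_Ap :: "real \<Rightarrow> real \<Rightarrow> real \<Rightarrow> (real^'n \<Rightarrow> real) \<Rightarrow> bool" where
  "ball_Ap \<theta> p C w \<longleftrightarrow> (\<forall>x R. 0 < R \<longrightarrow>
    wint lebesgue w (ball x R) * ennpowr (wint lebesgue (dual_weight p w) (ball x R)) (p - 1)
    \<le> ennreal C * ennpowr (ennreal (psi_vol \<theta> x R)) p)"

text \<open>One null set serves all balls, because the condition comes from a maximal
  operator.\<close>

definition ball_A1 :: "real \<Rightarrow> real \<Rightarrow> (real^'n \<Rightarrow> real) \<Rightarrow> bool" where
  "ball_A1 \<theta> C w \<longleftrightarrow> (AE x in lebesgue. \<forall>x0 R. 0 < R \<longrightarrow> x \<in> ball x0 R \<longrightarrow>
    wint lebesgue w (ball x0 R) \<le> ennreal (C * w x) * ennreal (psi_vol \<theta> x0 R))"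

text \<open>A common consequence of \<open>ball_Ap\<close> and \<open>ball_A1\<close>, which lets
  large balls be treated for \<open>p = 1\<close> and \<open>p > 1\<close> together. Tested with the
  indicator of a smaller ball it yields doubling.\<close>

definition ball_Holder :: "real \<Rightarrow> real \<Rightarrow> real \<Rightarrow> (real^'n \<Rightarrow> real) \<Rightarrow> bool" where
  "ball_Holder \<theta> p C w \<longleftrightarrow> (\<forall>f\<in>borel_measurable lebesgue. \<forall>x R. 0 < R \<longrightarrow>
    ennpowr (\<integral>\<^sup>+y\<in>ball x R. f y \<partial>lebesgue) p * wint lebesgue w (ball x R)
    \<le> ennreal C * ennpowr (ennreal (psi_vol \<theta> x R)) p * (\<integral>\<^sup>+y\<in>ball x R. ennpowr (f y) p * ennreal (w y) \<partial>lebesgue))"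

lemma psi_vol_pos: "0 < R \<Longrightarrow> 0 < psi_vol \<theta> x R"
proof -
  assume R: "0 < R"
  then have "0 < 1 + R / \<rho> x" using rho_pos[of x] by (intro add_pos_pos) auto
  then show ?thesis using R unit_ball_vol_pos_card[where 'n='n] unfolding psi_vol_def
    by (intro mult_pos_pos) auto
qed

lemma ball_Ap_imp_ball_Holder:
  assumes "1 < p" "ball_Ap \<theta> p C w" and [measurable]: "w \<in> borel_measurable lebesgue" and w: "\<And>x. 0 < w x"
  shows "ball_Holder \<theta> p C w"
  unfolding ball_Holder_def
proof (intro ballI allI impI)
  fix f :: "real^'n \<Rightarrow> ennreal" and x :: "real^'n" and R :: real assume [measurable]: "f \<in> borel_measurable lebesgue" and R: "0 < R"
  let ?J = "\<integral>\<^sup>+y\<in>ball x R. ennpowr (f y) p * ennreal (w y) \<partial>lebesgue"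
  have "ennpowr (\<integral>\<^sup>+y\<in>ball x R. f y \<partial>lebesgue) p * wint lebesgue w (ball x R)
    \<le> (?J * ennpowr (wint lebesgue (dual_weight p w) (ball x R)) (p - 1)) * wint lebesgue w (ball x R)"
    using assms by (intro mult_right_mono weighted_Holder) auto
  also have "\<dots> = (wint lebesgue w (ball x R) * ennpowr (wint lebesgue (dual_weight p w) (ball x R)) (p - 1)) * ?J"
    by (simp only: mult_ac)
  also have "\<dots> \<le> (ennreal C * ennpowr (ennreal (psi_vol \<theta> x R)) p) * ?J"
    using assms(2) R unfolding ball_Ap_def by (intro mult_right_mono) auto
  finally show "ennpowr (\<integral>\<^sup>+y\<in>ball x R. f y \<partial>lebesgue) p * wint lebesgue w (ball x R)
    \<le> ennreal C * ennpowr (ennreal (psi_vol \<theta> x R)) p * ?J" .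
qed

lemma ball_A1_imp_ball_Holder:
  assumes C: "0 \<le> C" and "ball_A1 \<theta> C w" and [measurable]: "w \<in> borel_measurable lebesgue"
  shows "ball_Holder \<theta> 1 C w"
  unfolding ball_Holder_def
proof (intro ballI allI impI)
  fix f :: "real^'n \<Rightarrow> ennreal" and x :: "real^'n" and R :: real assume [measurable]: "f \<in> borel_measurable lebesgue" and R: "0 < R"
  let ?W = "wint lebesgue w (ball x R)" and ?P = "ennreal (psi_vol \<theta> x R)"
  have "(\<integral>\<^sup>+y\<in>ball x R. f y \<partial>lebesgue) * ?W = (\<integral>\<^sup>+y. f y * indicator (ball x R) y * ?W \<partial>lebesgue)"
    by (rule nn_integral_multc[symmetric]) measurable
  also have "\<dots> \<le> (\<integral>\<^sup>+y. ennreal C * ?P * (f y * ennreal (w y) * indicator (ball x R) y) \<partial>lebesgue)"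
  proof (intro nn_integral_mono_AE eventually_mono[OF assms(2)[unfolded ball_A1_def]])
    fix y assume *: "\<forall>x0 R. 0 < R \<longrightarrow> y \<in> ball x0 R \<longrightarrow> wint lebesgue w (ball x0 R) \<le> ennreal (C * w y) * ennreal (psi_vol \<theta> x0 R)"
    show "f y * indicator (ball x R) y * ?W \<le> ennreal C * ?P * (f y * ennreal (w y) * indicator (ball x R) y)"
    proof (cases "y \<in> ball x R")
      case True
      then have "f y * ?W \<le> f y * (ennreal (C * w y) * ?P)" using * R by (intro mult_left_mono) auto
      then show ?thesis using True C by (simp add: ennreal_mult' mult_ac)
    qed simp
  qed
  also have "\<dots> = ennreal C * ?P * (\<integral>\<^sup>+y\<in>ball x R. f y * ennreal (w y) \<partial>lebesgue)"
    by (rule nn_integral_cmult) measurable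
  finally show "ennpowr (\<integral>\<^sup>+y\<in>ball x R. f y \<partial>lebesgue) 1 * ?W
    \<le> ennreal C * ennpowr ?P 1 * (\<integral>\<^sup>+y\<in>ball x R. ennpowr (f y) 1 * ennreal (w y) \<partial>lebesgue)"
    by simp
qed

text \<open>Bound for \<open>(1 + R / \<rho> x) powr \<theta>\<close> at \<open>R = n * L\<close>,
  times the ratio of the volumes of that ball and of a cell of side \<open>L\<close>.\<close>

definition cell_psi :: "real \<Rightarrow> real" where
  "cell_psi \<theta> = (1 + real CARD('n) * cell_const) powr \<theta> * (unit_ball_vol (CARD('n)) * real CARD('n) ^ CARD('n))"

lemma cell_psi_pos: "0 < cell_psi \<theta>"
proof -
  have "0 < 1 + real CARD('n) * cell_const" using cell_const_pos by (intro add_pos_pos) auto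
  then show ?thesis using unit_ball_vol_pos_card[where 'n='n] unfolding cell_psi_def
    by (intro mult_pos_pos) auto
qed

text \<open>The ball of radius \<open>n * L\<close> around any point of a cell of side
  \<open>L\<close> covers the cell, and its radius is at most a fixed multiple of the critical
  radius at that point. So the factor with \<open>\<theta>\<close> is bounded, and on local cells
  the weight satisfies the ordinary conditions.\<close>

lemma local_cell_in_ball:
  assumes th: "0 \<le> \<theta>" and Q: "Q \<in> local_cells N A" and x: "x \<in> Q"
  obtains R where "0 < R" "Q \<subseteq> ball x R" "ennreal (psi_vol \<theta> x R) \<le> ennreal (cell_psi \<theta>) * emeasure lebesgue Q"
proof -
  obtain j y v where j: "Q = grid_cell (2^j * (1/2)^N) v y" "\<forall>y\<in>Q. 2^j * (1/2)^N \<le> cell_const * \<rho> y"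
    using Q unfolding local_cells_def grid_family_def by blast
  define L :: real where "L = 2^j * (1/2)^N"
  have L: "0 < L" by (simp add: L_def)
  let ?n = "real CARD('n)"
  have Lx: "L \<le> cell_const * \<rho> x" using j(2) x by (simp add: L_def)
  have sub: "Q \<subseteq> ball x (?n * L)"
  proof
    fix z assume "z \<in> Q"
    then have "norm (x - z) < ?n * L" using grid_cell_diameter[OF L, of x v y z] x j(1) by (simp add: L_def)
    then show "z \<in> ball x (?n * L)" by (simp add: dist_norm)
  qed
  have "?n * L / \<rho> x \<le> ?n * cell_const"
    using Lx rho_pos[of x] by (simp add: divide_le_eq mult.assoc)
  then have "(1 + ?n * L / \<rho> x) powr \<theta> \<le> (1 + ?n * cell_const) powr \<theta>"
    using th L rho_pos[of x] by (intro powr_mono2) (auto intro!: add_nonneg_nonneg)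
  then have "psi_vol \<theta> x (?n * L) \<le> (1 + ?n * cell_const) powr \<theta> * (unit_ball_vol ?n * (?n * L) ^ CARD('n))"
    unfolding psi_vol_def using L unit_ball_vol_pos_card[where 'n='n] by (intro mult_right_mono mult_nonneg_nonneg) (auto simp: less_imp_le)
  also have "\<dots> = cell_psi \<theta> * L ^ CARD('n)" by (simp add: cell_psi_def power_mult_distrib)
  finally have "ennreal (psi_vol \<theta> x (?n * L)) \<le> ennreal (cell_psi \<theta>) * emeasure lebesgue Q"
    using cell_psi_pos[of \<theta>] L unfolding j(1) L_def[symmetric] grid_cell_measure(2)[OF L]
    by (subst ennreal_mult[symmetric]) (auto intro: ennreal_leI)
  then show thesis using that[of "?n * L"] sub L by simp
qed

lemma ball_Ap_imp_Ap_on: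
  assumes p: "1 < p" and th: "0 \<le> \<theta>" and C: "0 \<le> C" and Ap: "ball_Ap \<theta> p C w"
  shows "Ap_on lebesgue (local_cells N A) p (C * cell_psi \<theta> powr p) w"
  unfolding Ap_on_def
proof
  fix Q assume Q: "Q \<in> local_cells N A"
  then obtain x where x: "x \<in> Q" unfolding local_cells_def grid_family_def using grid_cell_self by blast
  obtain R where R: "0 < R" "Q \<subseteq> ball x R" "ennreal (psi_vol \<theta> x R) \<le> ennreal (cell_psi \<theta>) * emeasure lebesgue Q"
    using local_cell_in_ball[OF th Q x] by blast
  have "wint lebesgue w Q * ennpowr (wint lebesgue (dual_weight p w) Q) (p - 1)
    \<le> wint lebesgue w (ball x R) * ennpowr (wint lebesgue (dual_weight p w) (ball x R)) (p - 1)"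
    using p R(2) by (intro mult_mono ennpowr_mono wint_mono) auto
  also have "\<dots> \<le> ennreal C * ennpowr (ennreal (psi_vol \<theta> x R)) p"
    using Ap R(1) by (auto simp: ball_Ap_def)
  also have "\<dots> \<le> ennreal C * ennpowr (ennreal (cell_psi \<theta>) * emeasure lebesgue Q) p"
    using p R(3) by (intro mult_left_mono ennpowr_mono) auto
  also have "\<dots> = ennreal (C * cell_psi \<theta> powr p) * ennpowr (emeasure lebesgue Q) p"
    using C cell_psi_pos[of \<theta>] by (simp only: ennpowr_mult ennpowr_ennreal less_imp_le ennreal_mult powr_ge_zero mult.assoc)
  finally show "wint lebesgue w Q * ennpowr (wint lebesgue (dual_weight p w) Q) (p - 1)
    \<le> ennreal (C * cell_psi \<theta> powr p) * ennpowr (emeasure lebesgue Q) p" .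
qed

lemma ball_A1_imp_A1_on:
  assumes th: "0 \<le> \<theta>" and C: "0 \<le> C" and w: "\<And>x. 0 < w x" and A1: "ball_A1 \<theta> C w"
  shows "A1_on lebesgue (local_cells N A) (C * cell_psi \<theta>) w"
  unfolding A1_on_def
proof
  fix Q assume Q: "Q \<in> local_cells N A"
  show "AE x in lebesgue. x \<in> Q \<longrightarrow> wint lebesgue w Q \<le> ennreal (C * cell_psi \<theta> * w x) * emeasure lebesgue Q"
  proof (intro eventually_mono[OF A1[unfolded ball_A1_def]] impI)
    fix x assume *: "\<forall>x0 R. 0 < R \<longrightarrow> x \<in> ball x0 R \<longrightarrow> wint lebesgue w (ball x0 R) \<le> ennreal (C * w x) * ennreal (psi_vol \<theta> x0 R)"
      and x: "x \<in> Q"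
    obtain R where R: "0 < R" "Q \<subseteq> ball x R" "ennreal (psi_vol \<theta> x R) \<le> ennreal (cell_psi \<theta>) * emeasure lebesgue Q"
      using local_cell_in_ball[OF th Q x] by blast
    have "wint lebesgue w Q \<le> wint lebesgue w (ball x R)" by (rule wint_mono[OF R(2)])
    also have "\<dots> \<le> ennreal (C * w x) * ennreal (psi_vol \<theta> x R)" using * R(1) by simp
    also have "\<dots> \<le> ennreal (C * w x) * (ennreal (cell_psi \<theta>) * emeasure lebesgue Q)"
      using R(3) by (intro mult_left_mono) auto
    also have "\<dots> = ennreal (C * cell_psi \<theta> * w x) * emeasure lebesgue Q"
      unfolding mult.assoc[symmetric] using C w[of x] cell_psi_pos[of \<theta>]
      by (subst ennreal_mult[symmetric]) (auto simp: mult_ac less_imp_le)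
    finally show "wint lebesgue w Q \<le> ennreal (C * cell_psi \<theta> * w x) * emeasure lebesgue Q" .
  qed
qed

text \<open>A Lipschitz function comparable to \<open>\<rho>\<close>, used where Fubini's theorem requires measurability.\<close>

definition rho_ratio :: real where
  "rho_ratio = 1 / (C0 * 2 powr l0)"

definition rho_reg :: "real^'n \<Rightarrow> real" where
  "rho_reg x = (INF y. \<rho> y + dist x y) / rho_ratio"

lemma rho_ratio: "0 < rho_ratio" "rho_ratio \<le> 1"
proof -
  show "0 < rho_ratio" using C0 by (simp add: rho_ratio_def)
  have "1 \<le> C0 * 2 powr l0" using C0 l0 ge_one_powr_ge_zero[of 2 l0] by (metis less_imp_le mult_ge1_I one_le_numeral)
  then show "rho_ratio \<le> 1" by (simp add: rho_ratio_def)
qed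

lemma INF_rho_bdd: "bdd_below (range (\<lambda>y. \<rho> y + dist x y))"
  using rho_pos by (intro bdd_belowI2[of _ 0]) (simp add: less_imp_le add_nonneg_nonneg)

text \<open>For the lower bound each \<open>y\<close> is tested: beyond distance
  \<open>\<rho> x\<close> the distance alone suffices, and within it slow variation bounds
  \<open>\<rho> y\<close> from below by \<open>rho_ratio * \<rho> x\<close>.\<close>

lemma rho_reg_bounds: "\<rho> x \<le> rho_reg x" "rho_reg x \<le> \<rho> x / rho_ratio"
proof -
  have "(INF y. \<rho> y + dist x y) \<le> \<rho> x + dist x x" by (rule cINF_lower[OF INF_rho_bdd]) simp
  then show "rho_reg x \<le> \<rho> x / rho_ratio" unfolding rho_reg_def using rho_ratio by (simp add: divide_right_mono)
  have "\<rho> x * rho_ratio \<le> \<rho> y + dist x y" for y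
  proof (cases "\<rho> x \<le> dist x y")
    case True
    have "\<rho> x * rho_ratio \<le> \<rho> x" using rho_ratio rho_pos[of x] by (simp add: mult_le_cancel_left2)
    then show ?thesis using True rho_pos[of y] by linarith
  next
    case False
    then have "norm (x - y) / \<rho> x \<le> 1" using rho_pos[of x] by (simp add: dist_norm)
    then have "2 powr (- l0) \<le> (1 + norm (x - y) / \<rho> x) powr (- l0)"
      using l0 rho_pos[of x] by (intro powr_mono2') (auto intro!: add_pos_nonneg)
    then have "\<rho> x * 2 powr (- l0) \<le> C0 * \<rho> y"
      using rho_lower[of x y] rho_pos[of x] by (meson mult_left_mono less_imp_le order_trans)
    then have "\<rho> x * rho_ratio \<le> \<rho> y"
      using C0 by (simp add: rho_ratio_def powr_minus field_simps)
    then show ?thesis using zero_le_dist[of x y] by linarith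
  qed
  then have "\<rho> x * rho_ratio \<le> (INF y. \<rho> y + dist x y)" by (intro cINF_greatest) auto
  then show "\<rho> x \<le> rho_reg x" unfolding rho_reg_def using rho_ratio by (simp add: le_divide_eq)
qed

lemma rho_reg_pos: "0 < rho_reg x"
  using rho_reg_bounds(1)[of x] rho_pos[of x] by linarith

lemma measurable_rho_reg [measurable]: "rho_reg \<in> borel_measurable borel"
proof -
  have le: "(INF y. \<rho> y + dist x y) \<le> (INF y. \<rho> y + dist x' y) + dist x x'" for x x'
  proof -
    have "(INF y. \<rho> y + dist x y) - dist x x' \<le> \<rho> y + dist x' y" for y
      using cINF_lower[OF INF_rho_bdd, of y x] dist_triangle[of x y x'] by simp
    then have "(INF y. \<rho> y + dist x y) - dist x x' \<le> (INF y. \<rho> y + dist x' y)" by (intro cINF_greatest) auto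
    then show ?thesis by simp
  qed
  have "dist (INF y. \<rho> y + dist x y) (INF y. \<rho> y + dist x' y) \<le> 1 * dist x x'" for x x'
    unfolding dist_real_def using le[of x x'] le[of x' x] dist_commute[of x x'] by linarith
  then have "1-lipschitz_on UNIV (\<lambda>x. INF y. \<rho> y + dist x y)" by (intro lipschitz_onI) auto
  then have "continuous_on UNIV (\<lambda>x. INF y. \<rho> y + dist x y)" by (rule lipschitz_on_continuous_on)
  then have [measurable]: "(\<lambda>x. INF y. \<rho> y + dist x y) \<in> borel_measurable borel" by (rule borel_measurable_continuous_onI)
  show ?thesis unfolding rho_reg_def[abs_def] by measurable
qed

section \<open>Balls larger than the critical radius\<close>

definition annulus_radius :: "nat \<Rightarrow> real^'n \<Rightarrow> real" where
  "annulus_radius j x = 2 ^ j * rho_reg x"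

text \<open>The averages are over full balls, with radii doubling in \<open>j\<close>. Centring them
  at \<open>x\<close> makes each operator linear, unlike the supremum that they dominate.\<close>

definition annulus_avg :: "nat \<Rightarrow> (real^'n \<Rightarrow> ennreal) \<Rightarrow> real^'n \<Rightarrow> ennreal" where
  "annulus_avg j f x = ball_avg x (annulus_radius j x) f"

definition global_max :: "real \<Rightarrow> (real^'n \<Rightarrow> ennreal) \<Rightarrow> real^'n \<Rightarrow> ennreal" where
  "global_max \<eta> f x = (SUP (x0, R)\<in>{(x0, R). \<rho> x0 < R \<and> x \<in> ball x0 R}. ennreal ((1 + R / \<rho> x0) powr (- \<eta>)) * ball_avg x0 R f)"

lemma annulus_radius_pos: "0 < annulus_radius j x"
  using rho_reg_pos by (simp add: annulus_radius_def)

lemma measurable_annulus_radius [measurable]: "annulus_radius j \<in> borel_measurable borel"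
  unfolding annulus_radius_def[abs_def] by measurable

end

lemma ball_avg_eq:
  fixes x :: "real^'n"
  assumes "0 < R"
  shows "ball_avg x R f = ennreal (1 / measure lebesgue (ball x R)) * (\<integral>\<^sup>+y\<in>ball x R. f y \<partial>lebesgue)"
    and "0 < measure lebesgue (ball x R)"
proof -
  show m: "0 < measure lebesgue (ball x R)"
    using assms unit_ball_vol_pos_card[where 'n='n] measure_ball_cart[of R x] by simp
  then show "ball_avg x R f = ennreal (1 / measure lebesgue (ball x R)) * (\<integral>\<^sup>+y\<in>ball x R. f y \<partial>lebesgue)"
    unfolding ball_avg_def divide_ennreal_def by (subst inverse_ennreal) (simp_all only: inverse_eq_divide mult.commute)
qed

lemma Minkowski_ball_avg:
  fixes x :: "real^'n"
  assumes r: "1 < r" and R: "0 < R" and [measurable]: "\<And>k. f k \<in> borel_measurable lebesgue"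
  shows "(\<Sum>k. ennpowr (ball_avg x R (f k)) r) \<le> ennpowr (ball_avg x R (\<lambda>y. lr_norm r (\<lambda>k. f k y))) r"
proof -
  let ?m = "ennpowr (ennreal (1 / measure lebesgue (ball x R))) r"
  have "(\<Sum>k. ennpowr (ball_avg x R (f k)) r) = (\<Sum>k. ?m * ennpowr (\<integral>\<^sup>+y. f k y * indicator (ball x R) y \<partial>lebesgue) r)"
    unfolding ball_avg_eq(1)[OF R] ennpowr_mult ..
  also have "\<dots> \<le> ?m * ennpowr (\<integral>\<^sup>+y. lr_norm r (\<lambda>k. f k y * indicator (ball x R) y) \<partial>lebesgue) r"
    unfolding ennreal_suminf_cmult by (intro mult_left_mono Minkowski_lr_norm r) measurable
  also have "(\<integral>\<^sup>+y. lr_norm r (\<lambda>k. f k y * indicator (ball x R) y) \<partial>lebesgue) = (\<integral>\<^sup>+y\<in>ball x R. lr_norm r (\<lambda>k. f k y) \<partial>lebesgue)"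
    by (intro nn_integral_cong) (auto simp: lr_norm_def indicator_def)
  also have "?m * ennpowr (\<integral>\<^sup>+y\<in>ball x R. lr_norm r (\<lambda>k. f k y) \<partial>lebesgue) r = ennpowr (ball_avg x R (\<lambda>y. lr_norm r (\<lambda>k. f k y))) r"
    unfolding ball_avg_eq(1)[OF R] ennpowr_mult ..
  finally show ?thesis .
qed

lemma suminf_half_powers: "(\<Sum>j. ennreal ((1/2) ^ j)) = 2"
proof -
  have "(\<lambda>j. (1/2::real) ^ j) sums 2" using geometric_sums[of "1/2::real"] by simp
  then have "(\<Sum>j. ennreal ((1/2) ^ j)) = ennreal 2"
    by (intro suminf_ennreal_eq) auto
  then show ?thesis by simp
qed

text \<open>Every \<open>b j\<close> is at most the sequence norm of exponent \<open>p\<close>, and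
  the geometric weights have sum 2. This passes from powers \<open>r\<close> to powers
  \<open>p\<close> without asking which is larger.\<close>

lemma weighted_lr_sum_le:
  assumes r: "1 \<le> r" and p: "0 < p"
  shows "ennpowr (\<Sum>j. ennreal ((1/2) ^ j) * ennpowr (b j) r) (p / r) \<le> ennreal (2 powr (p / r)) * (\<Sum>j. ennpowr (b j) p)"
proof -
  define B where "B = lr_norm p b"
  have "(\<Sum>j. ennreal ((1/2) ^ j) * ennpowr (b j) r) \<le> (\<Sum>j. ennreal ((1/2) ^ j) * ennpowr B r)"
    using r p unfolding B_def by (intro suminf_le mult_left_mono ennpowr_mono le_lr_norm) auto
  also have "\<dots> = 2 * ennpowr B r" unfolding ennreal_suminf_multc suminf_half_powers ..
  finally have "ennpowr (\<Sum>j. ennreal ((1/2) ^ j) * ennpowr (b j) r) (p / r) \<le> ennpowr (2 * ennpowr B r) (p / r)"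
    using r p by (intro ennpowr_mono) auto
  also have "\<dots> = ennreal (2 powr (p / r)) * ennpowr B p"
    using r ennpowr_ennreal[of 2 "p / r"] by (simp add: ennpowr_mult ennpowr_ennpowr)
  also have "ennpowr B p = (\<Sum>j. ennpowr (b j) p)" unfolding B_def using p by simp
  finally show ?thesis .
qed

context slowly_varying
begin

text \<open>With \<open>4 * C0 / rho_ratio\<close> bounding the ratio of the radii, the first factor
  compares volumes, and the second comes from converting decay in \<open>R / \<rho> x0\<close> into
  decay in \<open>j\<close>.\<close>

definition global_const :: "real \<Rightarrow> real" where
  "global_const \<eta> = (4 * C0 / rho_ratio) ^ CARD('n) * (4 * C0 / rho_ratio * C0) powr (\<eta> / (l0 + 1))"

lemma global_const_pos: "0 < global_const \<eta>"
  using C0 rho_ratio by (simp add: global_const_def)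

text \<open>The least \<open>j\<close> with \<open>2 * R \<le> annulus_radius j x\<close> gives a
  ball that contains \<open>B(x0, R)\<close> and has comparable radius. By slow variation
  \<open>2^j\<close> is at most a constant times \<open>(1 + R / \<rho> x0) powr (l0 + 1)\<close>,
  which turns the damping factor into decay in \<open>j\<close>.\<close>

lemma global_ball_le_annulus:
  assumes eta: "0 \<le> \<eta>" and R: "\<rho> x0 < R" and x: "x \<in> ball x0 R"
  shows "\<exists>j. ennreal ((1 + R / \<rho> x0) powr (- \<eta>)) * ball_avg x0 R f
    \<le> ennreal (global_const \<eta> * 2 powr (- (real j * (\<eta> / (l0 + 1))))) * annulus_avg j f x"
proof -
  define u where "u = R / \<rho> x0"
  define K where "K = 4 * C0 / rho_ratio"
  define e where "e = \<eta> / (l0 + 1)"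
  have r0: "0 < \<rho> x0" and rx: "0 < \<rho> x" by (rule rho_pos)+
  have R0: "0 < R" using R r0 by linarith
  have u1: "1 < u" using R r0 by (simp add: u_def)
  have uR: "\<rho> x0 * u = R" using r0 by (simp add: u_def)
  have K: "1 \<le> K" "4 \<le> K"
  proof -
    have "4 * rho_ratio \<le> 4 * C0" using rho_ratio C0 by linarith
    then show "4 \<le> K" using rho_ratio by (simp add: K_def le_divide_eq)
    then show "1 \<le> K" by simp
  qed
  have e: "0 \<le> e" using eta l0 by (simp add: e_def)
  have near: "norm (x0 - x) / \<rho> x0 \<le> u"
    using x r0 by (simp add: u_def dist_norm divide_right_mono less_imp_le)
  have "\<rho> x \<le> C0 * \<rho> x0 * (1 + norm (x0 - x) / \<rho> x0) powr (l0 / (l0 + 1))" by (rule rho_upper)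
  also have "\<dots> \<le> C0 * \<rho> x0 * (1 + u) powr 1"
  proof (rule mult_left_mono)
    have "(1 + norm (x0 - x) / \<rho> x0) powr (l0 / (l0 + 1)) \<le> (1 + u) powr (l0 / (l0 + 1))"
      using near l0 r0 by (intro powr_mono2) (auto intro!: add_nonneg_nonneg)
    also have "\<dots> \<le> (1 + u) powr 1" using u1 l0 by (intro powr_mono) auto
    finally show "(1 + norm (x0 - x) / \<rho> x0) powr (l0 / (l0 + 1)) \<le> (1 + u) powr 1" .
  qed (use C0 r0 in auto)
  also have "\<dots> \<le> C0 * \<rho> x0 * (2 * u)"
    using u1 C0 r0 by (intro mult_left_mono) auto
  also have "\<dots> = 2 * C0 * R" using uR by (simp add: algebra_simps)
  finally have rho_le: "\<rho> x \<le> 2 * C0 * R" .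
  have "(1 + u) powr (- l0) \<le> (1 + norm (x0 - x) / \<rho> x0) powr (- l0)"
    using near l0 r0 by (intro powr_mono2') (auto intro!: add_pos_nonneg)
  then have "\<rho> x0 * (1 + u) powr (- l0) \<le> C0 * \<rho> x"
    using rho_lower[of x0 x] r0 by (meson mult_left_mono less_imp_le order_trans)
  then have rho_ge: "\<rho> x0 \<le> C0 * \<rho> x * (1 + u) powr l0"
    using u1 by (simp add: powr_minus divide_simps split: if_splits)
  have Rrho: "R \<le> C0 * \<rho> x * (1 + u) powr (l0 + 1)"
  proof -
    have "R \<le> C0 * \<rho> x * (1 + u) powr l0 * u" unfolding uR[symmetric] using rho_ge u1 by (intro mult_right_mono) auto
    also have "\<dots> \<le> C0 * \<rho> x * (1 + u) powr l0 * (1 + u)" using C0 rx by (intro mult_left_mono) auto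
    also have "\<dots> = C0 * \<rho> x * (1 + u) powr (l0 + 1)" using u1 by (simp add: powr_add)
    finally show ?thesis .
  qed
  define j where "j = (LEAST j. 2 * R \<le> annulus_radius j x)"
  have ex: "\<exists>j. 2 * R \<le> annulus_radius j x"
  proof -
    obtain j where "2 * R / rho_reg x < 2 ^ j" using real_arch_pow[of 2 "2 * R / rho_reg x"] by auto
    then have "2 * R \<le> annulus_radius j x" unfolding annulus_radius_def using rho_reg_pos[of x] by (simp add: divide_less_eq)
    then show ?thesis by blast
  qed
  have jR: "2 * R \<le> annulus_radius j x" unfolding j_def by (rule LeastI_ex[OF ex])
  define S where "S = annulus_radius j x"
  have S: "0 < S" "2 * R \<le> S" using annulus_radius_pos jR by (auto simp: S_def)
  have SK: "S \<le> K * R"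
  \<comment> \<open>For \<open>j = 0\<close> the radius is comparable to \<open>\<rho> x\<close>,
    which is at most \<open>2 * C0 * R\<close>; otherwise minimality of \<open>j\<close> gives
    \<open>S \<le> 4 * R\<close>.\<close>
  proof (cases j)
    case 0
    have "S \<le> \<rho> x / rho_ratio" unfolding S_def annulus_radius_def 0 using rho_reg_bounds(2)[of x] by simp
    also have "\<dots> \<le> 2 * C0 * R / rho_ratio" using rho_le rho_ratio by (intro divide_right_mono) auto
    also have "\<dots> \<le> K * R" unfolding K_def using C0 R0 rho_ratio by (simp add: divide_right_mono)
    finally show ?thesis .
  next
    case (Suc i)
    then have "\<not> 2 * R \<le> annulus_radius i x" using not_less_Least[of i "\<lambda>j. 2 * R \<le> annulus_radius j x"] unfolding j_def by auto
    moreover have "annulus_radius (Suc i) x = 2 * annulus_radius i x" by (simp add: annulus_radius_def)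
    ultimately have "S \<le> 4 * R" unfolding S_def Suc by linarith
    also have "\<dots> \<le> K * R" using K R0 by (intro mult_right_mono) auto
    finally show ?thesis .
  qed
  have "2 ^ j * \<rho> x \<le> S" unfolding S_def annulus_radius_def using rho_reg_bounds(1)[of x] by simp
  also have "\<dots> \<le> K * (C0 * \<rho> x * (1 + u) powr (l0 + 1))" using SK Rrho K(1) by (meson mult_left_mono order_trans zero_le_one)
  finally have "2 ^ j * \<rho> x \<le> (K * C0 * (1 + u) powr (l0 + 1)) * \<rho> x" by (simp add: mult_ac)
  then have pow_j: "2 ^ j \<le> K * C0 * (1 + u) powr (l0 + 1)" using rx by simp
  have decay: "(1 + u) powr (- \<eta>) \<le> (K * C0) powr e * 2 powr (- (real j * e))"
  proof -
    have KC: "0 < K * C0" using K C0 by simp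
    have "(2 ^ j) powr e \<le> (K * C0 * (1 + u) powr (l0 + 1)) powr e"
      using pow_j e by (intro powr_mono2) auto
    also have "\<dots> = (K * C0) powr e * (1 + u) powr \<eta>"
      using KC l0 u1 by (simp add: powr_mult powr_powr e_def)
    finally have "2 powr (real j * e) \<le> (K * C0) powr e * (1 + u) powr \<eta>"
      by (simp add: powr_realpow[symmetric] powr_powr)
    then show ?thesis using u1 by (simp add: powr_minus divide_simps split: if_splits) 
  qed
  let ?m = "measure lebesgue (ball x0 R)" and ?M = "measure lebesgue (ball x S)"
  have "1 / ?m \<le> K ^ CARD('n) * (1 / ?M)"
  proof -
    have "?M \<le> K ^ CARD('n) * ?m"
      using S(1) R0 SK K unit_ball_vol_pos_card[where 'n='n] power_mono[OF SK, of "CARD('n)"]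
        measure_ball_cart[of S x] measure_ball_cart[of R x0] by (simp add: power_mult_distrib)
    then show ?thesis using ball_avg_eq(2)[OF R0, of x0] ball_avg_eq(2)[OF S(1), of x]
      by (simp only: divide_simps split: if_splits) (simp add: mult_ac)
  qed
  moreover have "ball x0 R \<subseteq> ball x S"
  proof
    fix y assume "y \<in> ball x0 R"
    then have "dist x y < 2 * R" using x dist_triangle[of x y x0] dist_commute[of x x0] by (simp only: mem_ball)
    then show "y \<in> ball x S" using S by simp
  qed
  then have "(\<integral>\<^sup>+y\<in>ball x0 R. f y \<partial>lebesgue) \<le> (\<integral>\<^sup>+y\<in>ball x S. f y \<partial>lebesgue)"
    by (intro nn_integral_mono) (auto simp: indicator_def)
  ultimately have avg_le: "ball_avg x0 R f \<le> ennreal (K ^ CARD('n) * (1 / ?M)) * (\<integral>\<^sup>+y\<in>ball x S. f y \<partial>lebesgue)"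
    unfolding ball_avg_eq(1)[OF R0] by (intro mult_mono ennreal_leI) auto
  have "ennreal (K ^ CARD('n) * (1 / ?M)) * (\<integral>\<^sup>+y\<in>ball x S. f y \<partial>lebesgue) = ennreal (K ^ CARD('n)) * annulus_avg j f x"
    unfolding annulus_avg_def S_def[symmetric] ball_avg_eq(1)[OF S(1)] mult.assoc[symmetric]
    using K(1) ball_avg_eq(2)[OF S(1), of x] by (subst ennreal_mult[symmetric]) (simp_all only: zero_le_power less_imp_le zero_le_divide_1_iff order_trans[OF zero_le_one])
  then have "ennreal ((1 + R / \<rho> x0) powr (- \<eta>)) * ball_avg x0 R f
    \<le> ennreal ((K * C0) powr e * 2 powr (- (real j * e))) * (ennreal (K ^ CARD('n)) * annulus_avg j f x)"
    using avg_le decay unfolding u_def by (intro mult_mono ennreal_leI) auto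
  also have "\<dots> = ennreal (global_const \<eta> * 2 powr (- (real j * e))) * annulus_avg j f x"
  proof -
    have "global_const \<eta> = K ^ CARD('n) * (K * C0) powr e" by (simp only: global_const_def K_def e_def)
    then show ?thesis unfolding mult.assoc[symmetric] using K C0
      by (subst ennreal_mult[symmetric]) (auto simp: mult_ac)
  qed
  finally show ?thesis unfolding e_def by blast
qed

text \<open>Each ball is dominated by one term of a series in \<open>j\<close>, so the supremum is
  dominated by the series. Exchanging the sums leaves for each \<open>j\<close> one fixed ball at
  \<open>x\<close>, where Minkowski's inequality moves the sequence norm inside.\<close>

lemma suminf_global_max_le:
  assumes r: "1 < r" and eta: "0 \<le> \<eta>" and [measurable]: "\<And>k. f k \<in> borel_measurable lebesgue"
  shows "(\<Sum>k. ennpowr (global_max \<eta> (f k) x) r)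
    \<le> ennreal (global_const \<eta> powr r) * (\<Sum>j. ennreal (2 powr (- (real j * (\<eta> / (l0 + 1)) * r))) * ennpowr (annulus_avg j (\<lambda>y. lr_norm r (\<lambda>k. f k y)) x) r)"
proof -
  define e where "e = \<eta> / (l0 + 1)"
  let ?a = "\<lambda>j g. ennreal (2 powr (- (real j * e * r))) * ennpowr (annulus_avg j g x) r"
  have "ennpowr (global_max \<eta> (f k) x) r \<le> ennreal (global_const \<eta> powr r) * (\<Sum>j. ?a j (f k))" for k
  proof -
    have "global_max \<eta> (f k) x \<le> ennpowr (ennreal (global_const \<eta> powr r) * (\<Sum>j. ?a j (f k))) (1 / r)"
      unfolding global_max_def
    proof (intro SUP_least, clarify)
      fix x0 R assume "\<rho> x0 < R" "x \<in> ball x0 R"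
      then obtain j where j: "ennreal ((1 + R / \<rho> x0) powr (- \<eta>)) * ball_avg x0 R (f k)
        \<le> ennreal (global_const \<eta> * 2 powr (- (real j * e))) * annulus_avg j (f k) x" (is "?L \<le> ?R")
        using global_ball_le_annulus[OF eta] unfolding e_def by blast
      have "ennpowr ?L r \<le> ennpowr ?R r" using j r by (intro ennpowr_mono) auto
      also have "\<dots> = ennreal (global_const \<eta> powr r) * ?a j (f k)"
        using global_const_pos[of \<eta>] by (simp add: ennpowr_mult ennpowr_ennreal powr_mult powr_powr ennreal_mult mult.assoc)
      also have "\<dots> \<le> ennreal (global_const \<eta> powr r) * (\<Sum>j. ?a j (f k))"
        using sum_le_suminf[of "\<lambda>j. ?a j (f k)" "{j}"] by (intro mult_left_mono) auto
      finally show "?L \<le> ennpowr (ennreal (global_const \<eta> powr r) * (\<Sum>j. ?a j (f k))) (1 / r)"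
        using r by (subst ennpowr_le_iff[symmetric]) auto
    qed
    then show ?thesis using r by (subst ennpowr_le_iff) auto
  qed
  then have "(\<Sum>k. ennpowr (global_max \<eta> (f k) x) r) \<le> (\<Sum>k. ennreal (global_const \<eta> powr r) * (\<Sum>j. ?a j (f k)))"
    by (intro suminf_le) auto
  also have "\<dots> = ennreal (global_const \<eta> powr r) * (\<Sum>k. \<Sum>j. ?a j (f k))"
    by (rule ennreal_suminf_cmult)
  also have "(\<Sum>k. \<Sum>j. ?a j (f k)) = (\<Sum>j. \<Sum>k. ?a j (f k))"
    by (rule ennreal_suminf_swap)
  also have "\<dots> = (\<Sum>j. ennreal (2 powr (- (real j * e * r))) * (\<Sum>k. ennpowr (annulus_avg j (f k) x) r))"
    by (simp only: ennreal_suminf_cmult)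
  also have "ennreal (global_const \<eta> powr r) * (\<Sum>j. ennreal (2 powr (- (real j * e * r))) * (\<Sum>k. ennpowr (annulus_avg j (f k) x) r))
    \<le> ennreal (global_const \<eta> powr r) * (\<Sum>j. ?a j (\<lambda>y. lr_norm r (\<lambda>k. f k y)))"
    unfolding annulus_avg_def using r annulus_radius_pos
    by (intro mult_left_mono suminf_le Minkowski_ball_avg) auto
  finally show ?thesis unfolding e_def .
qed

definition spread :: "nat \<Rightarrow> real" where
  "spread j = 1 + 2 ^ j / rho_ratio"

definition doubling_const :: "real \<Rightarrow> real" where
  "doubling_const \<theta> = (3 * C0\<^sup>2) powr \<theta> * (4 * C0\<^sup>2 / rho_ratio) ^ CARD('n)"

lemma doubling_const_pos: "0 < doubling_const \<theta>"
  using C0 rho_ratio by (simp add: doubling_const_def)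

lemma spread_gt_1: "1 < spread j"
  using rho_ratio by (simp add: spread_def)

lemma annulus_radius_le: "annulus_radius j x \<le> (spread j - 1) * \<rho> x"
  using mult_left_mono[OF rho_reg_bounds(2), of "2 ^ j" x] by (simp add: annulus_radius_def spread_def)

text \<open>Centre and point exchange roles: the ball around \<open>y\<close> has a radius depending
  on \<open>j\<close> and \<open>y\<close> alone, yet contains every \<open>x\<close> whose ball
  number \<open>j\<close> contains \<open>y\<close>. It lies, like the ball of \<open>x\<close>, in
  some \<open>B(x, R)\<close>, and \<open>ball_Holder\<close> tested with the indicator of the ball
  of \<open>x\<close> compares the weights.\<close>

lemma annulus_doubling:
  assumes p: "1 \<le> p" and th: "0 \<le> \<theta>" and C: "0 \<le> C" and H: "ball_Holder \<theta> p C w"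
    and xy: "dist x y < annulus_radius j x"
  shows "dist y x < C0 * spread j powr (l0 + 1) * \<rho> y"
    "wint lebesgue w (ball y (C0 * spread j powr (l0 + 1) * \<rho> y))
      \<le> ennreal (C * (doubling_const \<theta> * spread j powr ((l0 + 2) * \<theta> + (l0 + 1) * real CARD('n))) powr p) * wint lebesgue w (ball x (annulus_radius j x))"
proof -
  define a where "a = 2 ^ j / rho_ratio"
  define D where "D = spread j"
  have Da: "D = 1 + a" by (simp add: D_def spread_def a_def)
  have a1: "1 \<le> a"
  proof -
    have "rho_ratio \<le> 2 ^ j" using rho_ratio(2) one_le_power[of "2::real" j] by linarith
    then show ?thesis using rho_ratio(1) by (simp add: a_def le_divide_eq)
  qed
  have D: "1 < D" using a1 Da by simp
  have rx: "0 < \<rho> x" and ry: "0 < \<rho> y" by (rule rho_pos)+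
  define S where "S = annulus_radius j x"
  have S: "0 < S" "S \<le> a * \<rho> x" "2 ^ j * \<rho> x \<le> S"
    using annulus_radius_pos annulus_radius_le[of j x] rho_reg_bounds(1)[of x] unfolding S_def a_def spread_def
    by (auto simp: annulus_radius_def)
  have dS: "dist x y < a * \<rho> x" using xy S by (simp add: S_def)
  then have near: "norm (x - y) / \<rho> x \<le> a" using rx by (simp add: dist_norm divide_le_eq)
  have "D powr (- l0) \<le> (1 + norm (x - y) / \<rho> x) powr (- l0)"
    unfolding Da using near l0 rx by (intro powr_mono2') (auto intro!: add_pos_nonneg)
  then have "\<rho> x * D powr (- l0) \<le> C0 * \<rho> y"
    using rho_lower[of x y] rx by (meson mult_left_mono less_imp_le order_trans)
  then have rho_x: "\<rho> x \<le> C0 * \<rho> y * D powr l0"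
    using D by (simp add: powr_minus divide_simps split: if_splits)
  have "\<rho> y \<le> C0 * \<rho> x * (1 + norm (x - y) / \<rho> x) powr (l0 / (l0 + 1))" by (rule rho_upper)
  also have "\<dots> \<le> C0 * \<rho> x * D powr 1"
  proof (rule mult_left_mono)
    have "(1 + norm (x - y) / \<rho> x) powr (l0 / (l0 + 1)) \<le> D powr (l0 / (l0 + 1))"
      unfolding Da using near l0 rx by (intro powr_mono2) (auto intro!: add_nonneg_nonneg)
    also have "\<dots> \<le> D powr 1" using D l0 by (intro powr_mono) auto
    finally show "(1 + norm (x - y) / \<rho> x) powr (l0 / (l0 + 1)) \<le> D powr 1" .
  qed (use C0 rx in auto)
  finally have rho_y: "\<rho> y \<le> C0 * \<rho> x * D" using D by simp
  define T where "T = C0 * D powr (l0 + 1) * \<rho> y"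
  have T0: "0 < T" using C0 D ry by (simp add: T_def)
  have "dist x y < T"
  proof -
    have "a * \<rho> x \<le> D * (C0 * \<rho> y * D powr l0)" using rho_x a1 Da rx by (intro mult_mono) auto
    also have "\<dots> = T" using D by (simp add: T_def powr_add mult_ac)
    finally show ?thesis using dS by linarith
  qed
  then show dist_y: "dist y x < C0 * spread j powr (l0 + 1) * \<rho> y"
    by (simp add: T_def D_def dist_commute)
  have pw: "D powr (l0 + 2) = D powr (l0 + 1) * D"
  proof -
    have "l0 + 2 = (l0 + 1) + 1" by simp
    then show ?thesis using D by (simp only: powr_add) simp
  qed
  \<comment> \<open>Large enough for \<open>2 * T\<close>, because slow variation gives
    \<open>\<rho> y \<le> C0 * \<rho> x * D\<close>. Expressed through \<open>\<rho> x\<close>, it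
    makes \<open>R / \<rho> x\<close> and \<open>R / S\<close> bounded by powers of
    \<open>D\<close>.\<close>
  define R where "R = 2 * C0\<^sup>2 * D powr (l0 + 2) * \<rho> x"
  have R0: "0 < R" using C0 D rx by (simp add: R_def)
  have TR: "2 * T \<le> R"
  proof -
    have "2 * T \<le> 2 * (C0 * D powr (l0 + 1) * (C0 * \<rho> x * D))"
      unfolding T_def using rho_y C0 D by (intro mult_left_mono) auto
    also have "\<dots> = R" unfolding R_def pw by (simp add: power2_eq_square mult_ac)
    finally show ?thesis .
  qed
  have sub: "ball y T \<subseteq> ball x R"
  proof
    fix z assume "z \<in> ball y T"
    then have "dist x z < R" using \<open>dist x y < T\<close> TR dist_triangle[of x z y] by (simp only: mem_ball)
    then show "z \<in> ball x R" by simp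
  qed
  have SR: "S \<le> R"
  proof -
    have "1 \<le> C0\<^sup>2" using C0 by (simp add: one_le_power)
    have "S \<le> D * \<rho> x" using S(2) Da rx by (simp add: distrib_right)
    also have "\<dots> \<le> D powr (l0 + 2) * \<rho> x" using D l0 rx powr_mono[of 1 "l0 + 2" D] by (intro mult_right_mono) auto
    also have "\<dots> \<le> R" unfolding R_def using \<open>1 \<le> C0\<^sup>2\<close> rx D by (intro mult_right_mono) auto
    finally show ?thesis .
  qed
  have ind: "(\<integral>\<^sup>+z\<in>ball x R. indicator (ball x S) z \<partial>lebesgue) = emeasure lebesgue (ball x S)"
  proof -
    have "(\<integral>\<^sup>+z\<in>ball x R. indicator (ball x S) z \<partial>lebesgue) = (\<integral>\<^sup>+z. indicator (ball x S) z \<partial>lebesgue)"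
      using SR by (intro nn_integral_cong) (auto simp: indicator_def)
    also have "\<dots> = emeasure lebesgue (ball x S)" by (rule nn_integral_indicator) measurable
    finally show ?thesis .
  qed
  have ind': "(\<integral>\<^sup>+z\<in>ball x R. ennpowr (indicator (ball x S) z) p * ennreal (w z) \<partial>lebesgue) = wint lebesgue w (ball x S)"
    unfolding wint_def using SR by (intro nn_integral_cong) (auto simp: indicator_def)
  define m where "m = unit_ball_vol (real CARD('n)) * S ^ CARD('n)"
  have ub: "0 \<le> unit_ball_vol (real CARD('n))" by (rule less_imp_le[OF unit_ball_vol_pos_card])
  have m: "0 < m" "emeasure lebesgue (ball x S) = ennreal m"
  proof -
    show "0 < m" unfolding m_def by (rule mult_pos_pos[OF unit_ball_vol_pos_card zero_less_power[OF S(1)]])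
    show "emeasure lebesgue (ball x S) = ennreal m"
      unfolding m_def by (rule emeasure_ball_cart[OF less_imp_le[OF S(1)]])
  qed
  have "(indicator (ball x S) :: real^'n \<Rightarrow> ennreal) \<in> borel_measurable lebesgue"
    by (rule borel_measurable_indicator) measurable
  from H[unfolded ball_Holder_def, THEN bspec, OF this, rule_format, OF R0, of x]
  have "ennpowr (emeasure lebesgue (ball x S)) p * wint lebesgue w (ball x R)
    \<le> ennreal C * ennpowr (ennreal (psi_vol \<theta> x R)) p * wint lebesgue w (ball x S)"
    unfolding ind ind' .
  moreover have psi: "psi_vol \<theta> x R \<le> doubling_const \<theta> * D powr ((l0 + 2) * \<theta> + (l0 + 1) * real CARD('n)) * m"
  proof -
    have C2: "1 \<le> C0\<^sup>2" using C0 by (simp add: one_le_power)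
    have Rr: "R / \<rho> x = 2 * C0\<^sup>2 * D powr (l0 + 2)" using rx by (simp add: R_def)
    have "1 \<le> C0\<^sup>2 * D powr (l0 + 2)" using C2 D l0 by (intro mult_ge1_I ge_one_powr_ge_zero) auto
    then have "1 + R / \<rho> x \<le> 3 * C0\<^sup>2 * D powr (l0 + 2)" unfolding Rr by linarith
    then have "(1 + R / \<rho> x) powr \<theta> \<le> (3 * C0\<^sup>2 * D powr (l0 + 2)) powr \<theta>"
      using th R0 rx by (intro powr_mono2) (auto intro!: add_nonneg_nonneg)
    also have "\<dots> = (3 * C0\<^sup>2) powr \<theta> * D powr ((l0 + 2) * \<theta>)"
      using C0 D by (simp add: powr_mult powr_powr)
    finally have A: "(1 + R / \<rho> x) powr \<theta> \<le> (3 * C0\<^sup>2) powr \<theta> * D powr ((l0 + 2) * \<theta>)" .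
    have "R \<le> (4 * C0\<^sup>2 / rho_ratio) * D powr (l0 + 1) * S"
    proof -
      have "D * \<rho> x \<le> 2 / rho_ratio * S"
      proof -
        have "D * \<rho> x \<le> 2 * a * \<rho> x" using a1 Da rx by (intro mult_right_mono) auto
        also have "\<dots> = 2 / rho_ratio * (2 ^ j * \<rho> x)" by (simp add: a_def)
        also have "\<dots> \<le> 2 / rho_ratio * S" using S(3) rho_ratio by (intro mult_left_mono) auto
        finally show ?thesis .
      qed
      then have "2 * C0\<^sup>2 * D powr (l0 + 1) * (D * \<rho> x) \<le> 2 * C0\<^sup>2 * D powr (l0 + 1) * (2 / rho_ratio * S)"
        by (intro mult_left_mono) auto
      moreover have "2 * C0\<^sup>2 * D powr (l0 + 1) * (D * \<rho> x) = R"
        unfolding R_def pw by (simp add: mult_ac)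
      ultimately show ?thesis by (simp add: mult_ac)
    qed
    then have "R ^ CARD('n) \<le> ((4 * C0\<^sup>2 / rho_ratio) * D powr (l0 + 1) * S) ^ CARD('n)"
      using R0 by (intro power_mono) auto
    also have "\<dots> = (4 * C0\<^sup>2 / rho_ratio) ^ CARD('n) * D powr ((l0 + 1) * real CARD('n)) * S ^ CARD('n)"
    proof -
      have "(D powr (l0 + 1)) ^ CARD('n) = D powr ((l0 + 1) * real CARD('n))"
        using D by (simp add: powr_power mult.commute)
      then show ?thesis by (simp only: power_mult_distrib)
    qed
    finally have B: "unit_ball_vol (real CARD('n)) * R ^ CARD('n) \<le> unit_ball_vol (real CARD('n)) * ((4 * C0\<^sup>2 / rho_ratio) ^ CARD('n) * D powr ((l0 + 1) * real CARD('n)) * S ^ CARD('n))"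
      by (rule mult_left_mono[OF _ ub])
    have "psi_vol \<theta> x R \<le> ((3 * C0\<^sup>2) powr \<theta> * D powr ((l0 + 2) * \<theta>)) * (unit_ball_vol (real CARD('n)) * ((4 * C0\<^sup>2 / rho_ratio) ^ CARD('n) * D powr ((l0 + 1) * real CARD('n)) * S ^ CARD('n)))"
      unfolding psi_vol_def
    proof (rule mult_mono[OF A B])
      show "0 \<le> unit_ball_vol (real CARD('n)) * R ^ CARD('n)" using ub R0 by (intro mult_nonneg_nonneg) auto
    qed simp
    also have "\<dots> = doubling_const \<theta> * D powr ((l0 + 2) * \<theta> + (l0 + 1) * real CARD('n)) * m"
      by (simp add: doubling_const_def m_def powr_add mult_ac)
    finally show ?thesis .
  qed
  moreover have "wint lebesgue w (ball y T) \<le> wint lebesgue w (ball x R)" by (rule wint_mono[OF sub])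
  ultimately have "ennpowr (ennreal m) p * wint lebesgue w (ball y T)
    \<le> ennreal C * ennpowr (ennreal (doubling_const \<theta> * D powr ((l0 + 2) * \<theta> + (l0 + 1) * real CARD('n)) * m)) p * wint lebesgue w (ball x S)"
  proof -
    have "ennpowr (ennreal m) p * wint lebesgue w (ball y T) \<le> ennpowr (ennreal m) p * wint lebesgue w (ball x R)"
      by (intro mult_left_mono wint_mono sub) auto
    also have "\<dots> \<le> ennreal C * ennpowr (ennreal (psi_vol \<theta> x R)) p * wint lebesgue w (ball x S)"
      using \<open>ennpowr (emeasure lebesgue (ball x S)) p * _ \<le> _\<close> unfolding m(2) .
    also have "\<dots> \<le> ennreal C * ennpowr (ennreal (doubling_const \<theta> * D powr ((l0 + 2) * \<theta> + (l0 + 1) * real CARD('n)) * m)) p * wint lebesgue w (ball x S)"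
      using p psi by (intro mult_right_mono mult_left_mono ennpowr_mono ennreal_leI) auto
    finally show ?thesis .
  qed
  also have "\<dots> = ennpowr (ennreal m) p * (ennreal (C * (doubling_const \<theta> * D powr ((l0 + 2) * \<theta> + (l0 + 1) * real CARD('n))) powr p) * wint lebesgue w (ball x S))"
  proof -
    let ?k = "doubling_const \<theta> * D powr ((l0 + 2) * \<theta> + (l0 + 1) * real CARD('n))"
    have k: "0 \<le> ?k" using doubling_const_pos[of \<theta>] by simp
    have eq: "ennpowr (ennreal (?k * m)) p = ennreal (?k powr p) * ennpowr (ennreal m) p"
      by (simp only: ennreal_mult'[OF k] ennpowr_mult ennpowr_ennreal[OF k])
    show ?thesis unfolding eq ennreal_mult'[OF C] by (simp only: mult_ac)
  qed
  finally show "wint lebesgue w (ball y (C0 * spread j powr (l0 + 1) * \<rho> y))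
      \<le> ennreal (C * (doubling_const \<theta> * spread j powr ((l0 + 2) * \<theta> + (l0 + 1) * real CARD('n))) powr p) * wint lebesgue w (ball x (annulus_radius j x))"
    unfolding T_def[symmetric] D_def[symmetric] S_def[symmetric] using m(1)
    by (subst (asm) ennreal_mult_le_mult_iff) auto
qed

end

lemma ennreal_mult_divide_cancel: "c \<noteq> 0 \<Longrightarrow> c \<noteq> top \<Longrightarrow> c * (b / c) = (b :: ennreal)"
  by (simp add: ennreal_times_divide mult.commute[of c] mult_divide_eq_ennreal)

lemma wint_ball_nonzero:
  fixes x :: "real^'n"
  assumes "w \<in> borel_measurable lebesgue" "\<And>x. 0 < w x" "0 < R"
  shows "wint lebesgue w (ball x R) \<noteq> 0"
proof (rule wint_pos)
  show "emeasure lebesgue (ball x R) \<noteq> 0"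
    using emeasure_ball_cart[of R x] mult_pos_pos[OF unit_ball_vol_pos_card zero_less_power[OF assms(3)]] assms(3)
    by (metis ennreal_less_zero_iff less_imp_le less_irrefl)
qed (use assms in auto)

context slowly_varying
begin

text \<open>The condition \<open>dist x y < annulus_radius j x\<close> must be measurable jointly in
  both variables, which is why the radii are built from \<open>rho_reg\<close>.\<close>

lemma measurable_annulus_integral:
  assumes [measurable]: "g \<in> borel_measurable lebesgue"
  shows "(\<lambda>x. \<integral>\<^sup>+y\<in>ball x (annulus_radius j x). g y \<partial>lebesgue) \<in> borel_measurable lebesgue"
proof -
  interpret L: sigma_finite_measure "lebesgue :: (real^'n) measure" by (rule sigma_finite_lebesgue)
  have "(\<lambda>x. \<integral>\<^sup>+y. g y * (if dist x y < annulus_radius j x then 1 else 0) \<partial>lebesgue) \<in> borel_measurable lebesgue"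
    by (rule L.borel_measurable_nn_integral) measurable
  then show ?thesis by (simp add: indicator_def of_bool_def)
qed

lemma measurable_annulus_avg [measurable]:
  assumes [measurable]: "g \<in> borel_measurable lebesgue"
  shows "annulus_avg j g \<in> borel_measurable lebesgue"
proof -
  note [measurable] = measurable_annulus_integral[OF assms, of j]
  have "annulus_avg j g = (\<lambda>x. ennreal (1 / (unit_ball_vol (real CARD('n)) * annulus_radius j x ^ CARD('n))) * (\<integral>\<^sup>+y\<in>ball x (annulus_radius j x). g y \<partial>lebesgue))"
  proof
    fix x
    have "measure lebesgue (ball x (annulus_radius j x)) = unit_ball_vol (real CARD('n)) * annulus_radius j x ^ CARD('n)"
      by (rule measure_ball_cart[OF less_imp_le[OF annulus_radius_pos]])
    then show "annulus_avg j g x = ennreal (1 / (unit_ball_vol (real CARD('n)) * annulus_radius j x ^ CARD('n))) * (\<integral>\<^sup>+y\<in>ball x (annulus_radius j x). g y \<partial>lebesgue)"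
      unfolding annulus_avg_def ball_avg_eq(1)[OF annulus_radius_pos] by (simp only:)
  qed
  then show ?thesis by (simp only:) measurable
qed

text \<open>A Schur test. Pointwise, \<open>ball_Holder\<close> bounds the power of the average by
  the integral of \<open>G\<close> over the ball of \<open>x\<close>, divided by the weight
  \<open>W x\<close> of that ball. After Fubini, \<open>w x / W x\<close> is integrated over all
  \<open>x\<close> whose ball contains \<open>y\<close>; by \<open>annulus_doubling\<close> these
  \<open>x\<close> lie in one ball around \<open>y\<close> whose weight is at most a constant times
  each \<open>W x\<close>.\<close>

lemma annulus_strong:
  assumes p: "1 \<le> p" and th: "0 \<le> \<theta>" and C: "0 \<le> C" and H: "ball_Holder \<theta> p C w"
    and [measurable]: "w \<in> borel_measurable lebesgue" "F \<in> borel_measurable lebesgue" and w: "\<And>x. 0 < w x"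
    and fin: "\<And>x R. wint lebesgue w (ball x R) \<noteq> top"
  shows "(\<integral>\<^sup>+x. ennpowr (annulus_avg j F x) p * ennreal (w x) \<partial>lebesgue)
    \<le> ennreal (C\<^sup>2 * (doubling_const \<theta> * spread j powr ((l0 + 3) * \<theta> + (l0 + 1) * real CARD('n))) powr p)
      * (\<integral>\<^sup>+x. ennpowr (F x) p * ennreal (w x) \<partial>lebesgue)"
proof -
  interpret P: pair_sigma_finite "lebesgue :: (real^'n) measure" "lebesgue :: (real^'n) measure"
    by (intro pair_sigma_finite.intro sigma_finite_lebesgue)
  define S where "S = annulus_radius j"
  have S0: "0 < S x" for x unfolding S_def by (rule annulus_radius_pos)
  have [measurable]: "S \<in> borel_measurable borel" unfolding S_def by measurable
  define W where "W x = wint lebesgue w (ball x (S x))" for x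
  have [measurable]: "W \<in> borel_measurable lebesgue"
    unfolding W_def[abs_def] wint_def S_def by (rule measurable_annulus_integral) measurable
  have W: "W x \<noteq> 0" "W x \<noteq> top" for x
  proof -
    show "W x \<noteq> top" unfolding W_def by (rule fin)
    show "W x \<noteq> 0" unfolding W_def using w S0 by (intro wint_ball_nonzero) auto
  qed
  define G where "G x = ennpowr (F x) p * ennreal (w x)" for x
  have [measurable]: "G \<in> borel_measurable lebesgue" unfolding G_def[abs_def] by measurable
  define k where "k = doubling_const \<theta> * spread j powr ((l0 + 2) * \<theta> + (l0 + 1) * real CARD('n))"
  have k: "0 \<le> k" using doubling_const_pos[of \<theta>] by (simp add: k_def)
  define Cd where "Cd = C * k powr p"
  have Cd: "0 \<le> Cd" using C by (simp add: Cd_def)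
  let ?Cs = "C * spread j powr (\<theta> * p)"
  have pointwise: "ennpowr (annulus_avg j F x) p * ennreal (w x) \<le> ennreal ?Cs * (\<integral>\<^sup>+y. G y * (if dist x y < S x then 1 else 0) * (ennreal (w x) / W x) \<partial>lebesgue)" for x
  proof -
    let ?B = "ball x (S x)"
    define m where "m = measure lebesgue ?B"
    have m: "0 < m" unfolding m_def by (rule ball_avg_eq(2)[OF S0])
    have psi: "psi_vol \<theta> x (S x) \<le> spread j powr \<theta> * m"
    proof -
      have "S x / \<rho> x \<le> spread j - 1"
        using annulus_radius_le[of j x] rho_pos[of x] by (simp add: S_def divide_le_eq)
      then have "(1 + S x / \<rho> x) powr \<theta> \<le> spread j powr \<theta>"
        using th S0[of x] rho_pos[of x] by (intro powr_mono2) (auto intro!: add_nonneg_nonneg less_imp_le)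
      then have "(1 + S x / \<rho> x) powr \<theta> * m \<le> spread j powr \<theta> * m" using m by (intro mult_right_mono) auto
      then show ?thesis unfolding psi_vol_def m_def measure_ball_cart[OF less_imp_le[OF S0]] .
    qed
    have "ennpowr (annulus_avg j F x) p * W x = ennpowr (ennreal (1 / m)) p * (ennpowr (\<integral>\<^sup>+y\<in>?B. F y \<partial>lebesgue) p * W x)"
      unfolding annulus_avg_def S_def[symmetric] ball_avg_eq(1)[OF S0] ennpowr_mult m_def by (simp only: mult.assoc)
    also have "\<dots> \<le> ennpowr (ennreal (1 / m)) p * (ennreal C * ennpowr (ennreal (psi_vol \<theta> x (S x))) p * (\<integral>\<^sup>+y\<in>?B. G y \<partial>lebesgue))"
      using H S0[of x] unfolding ball_Holder_def W_def G_def by (intro mult_left_mono) auto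
    also have "\<dots> \<le> ennpowr (ennreal (1 / m)) p * (ennreal C * ennpowr (ennreal (spread j powr \<theta> * m)) p * (\<integral>\<^sup>+y\<in>?B. G y \<partial>lebesgue))"
      using psi p by (intro mult_left_mono mult_right_mono ennpowr_mono ennreal_leI) auto
    also have "\<dots> = ennreal ?Cs * (\<integral>\<^sup>+y\<in>?B. G y \<partial>lebesgue)"
    proof -
      have "ennpowr (ennreal (1 / m)) p * ennpowr (ennreal (spread j powr \<theta> * m)) p = ennpowr (ennreal (spread j powr \<theta>)) p"
        unfolding ennpowr_mult[symmetric] using m by (subst ennreal_mult[symmetric]) auto
      also have "\<dots> = ennreal (spread j powr (\<theta> * p))" by (simp add: ennpowr_ennreal powr_powr)
      finally have "ennpowr (ennreal (1 / m)) p * ennpowr (ennreal (spread j powr \<theta> * m)) p = ennreal (spread j powr (\<theta> * p))" .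
      then show ?thesis unfolding ennreal_mult'[OF C] by (simp only: mult.assoc mult.left_commute[of _ "ennreal C"])
          (simp only: mult.assoc[symmetric])
    qed
    finally have le: "ennpowr (annulus_avg j F x) p * W x \<le> ennreal ?Cs * (\<integral>\<^sup>+y\<in>?B. G y \<partial>lebesgue)" .
    have "ennpowr (annulus_avg j F x) p * ennreal (w x) = (ennpowr (annulus_avg j F x) p * W x) * (ennreal (w x) / W x)"
      by (simp only: mult.assoc ennreal_mult_divide_cancel[OF W])
    also have "\<dots> \<le> (ennreal ?Cs * (\<integral>\<^sup>+y\<in>?B. G y \<partial>lebesgue)) * (ennreal (w x) / W x)"
      by (rule mult_right_mono[OF le]) simp
    also have "\<dots> = ennreal ?Cs * (\<integral>\<^sup>+y. G y * indicator ?B y * (ennreal (w x) / W x) \<partial>lebesgue)"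
      by (subst nn_integral_multc) (measurable, simp only: mult.assoc)
    also have "(\<integral>\<^sup>+y. G y * indicator ?B y * (ennreal (w x) / W x) \<partial>lebesgue) = (\<integral>\<^sup>+y. G y * (if dist x y < S x then 1 else 0) * (ennreal (w x) / W x) \<partial>lebesgue)"
      by (intro nn_integral_cong) (simp add: indicator_def)
    finally show ?thesis .
  qed
  have inner: "(\<integral>\<^sup>+x. (if dist x y < S x then 1 else 0) * (ennreal (w x) / W x) \<partial>lebesgue) \<le> ennreal Cd" for y
  proof -
    define T where "T = C0 * spread j powr (l0 + 1) * \<rho> y"
    have T: "0 < T" using C0 spread_gt_1[of j] rho_pos[of y] by (simp add: T_def)
    define V where "V = wint lebesgue w (ball y T)"
    have V: "V \<noteq> 0" "V \<noteq> top"
    proof -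
      show "V \<noteq> top" unfolding V_def by (rule fin)
      show "V \<noteq> 0" unfolding V_def using w T by (intro wint_ball_nonzero) auto
    qed
    have "(\<integral>\<^sup>+x. (if dist x y < S x then 1 else 0) * (ennreal (w x) / W x) \<partial>lebesgue)
      \<le> (\<integral>\<^sup>+x. ennreal Cd / V * (ennreal (w x) * indicator (ball y T) x) \<partial>lebesgue)"
    proof (intro nn_integral_mono)
      fix x
      show "(if dist x y < S x then 1 else 0) * (ennreal (w x) / W x) \<le> ennreal Cd / V * (ennreal (w x) * indicator (ball y T) x)"
      proof (cases "dist x y < S x")
        case True
        note d = annulus_doubling[OF p th C H True[unfolded S_def], folded k_def, folded Cd_def T_def S_def, folded V_def, folded W_def]
        have "V * (1 / W x) \<le> ennreal Cd * W x * (1 / W x)" using d(2) by (rule mult_right_mono) simp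
        also have "\<dots> = V * (ennreal Cd / V)"
          by (simp only: mult.assoc ennreal_mult_divide_cancel[OF W] ennreal_mult_divide_cancel[OF V] mult_1_right)
        finally have "1 / W x \<le> ennreal Cd / V"
          using V by (subst (asm) ennreal_mult_le_mult_iff) auto
        then have "1 / W x * ennreal (w x) \<le> ennreal Cd / V * ennreal (w x)" by (rule mult_right_mono) simp
        then show ?thesis using True d(1) by (simp add: ennreal_divide_times)
      qed simp
    qed
    also have "\<dots> = ennreal Cd / V * V"
      unfolding V_def wint_def by (rule nn_integral_cmult) measurable
    also have "\<dots> = ennreal Cd"
      using V by (simp add: ennreal_divide_times ennreal_divide_self less_top)
    finally show ?thesis .
  qed
  have "(\<integral>\<^sup>+x. ennpowr (annulus_avg j F x) p * ennreal (w x) \<partial>lebesgue)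
    \<le> (\<integral>\<^sup>+x. ennreal ?Cs * (\<integral>\<^sup>+y. G y * (if dist x y < S x then 1 else 0) * (ennreal (w x) / W x) \<partial>lebesgue) \<partial>lebesgue)"
    by (intro nn_integral_mono pointwise)
  also have "\<dots> = ennreal ?Cs * (\<integral>\<^sup>+x. (\<integral>\<^sup>+y. G y * (if dist x y < S x then 1 else 0) * (ennreal (w x) / W x) \<partial>lebesgue) \<partial>lebesgue)"
    by (rule nn_integral_cmult) measurable
  also have "(\<integral>\<^sup>+x. (\<integral>\<^sup>+y. G y * (if dist x y < S x then 1 else 0) * (ennreal (w x) / W x) \<partial>lebesgue) \<partial>lebesgue)
    = (\<integral>\<^sup>+y. (\<integral>\<^sup>+x. G y * (if dist x y < S x then 1 else 0) * (ennreal (w x) / W x) \<partial>lebesgue) \<partial>lebesgue)"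
    by (rule P.Fubini'[symmetric]) measurable
  also have "\<dots> \<le> (\<integral>\<^sup>+y. G y * ennreal Cd \<partial>lebesgue)"
  proof (intro nn_integral_mono)
    fix y
    have "(\<integral>\<^sup>+x. G y * (if dist x y < S x then 1 else 0) * (ennreal (w x) / W x) \<partial>lebesgue)
      = G y * (\<integral>\<^sup>+x. (if dist x y < S x then 1 else 0) * (ennreal (w x) / W x) \<partial>lebesgue)"
      unfolding mult.assoc by (rule nn_integral_cmult) measurable
    also have "\<dots> \<le> G y * ennreal Cd" by (intro mult_left_mono inner) auto
    finally show "(\<integral>\<^sup>+x. G y * (if dist x y < S x then 1 else 0) * (ennreal (w x) / W x) \<partial>lebesgue) \<le> G y * ennreal Cd" .
  qed
  also have "\<dots> = (\<integral>\<^sup>+y. G y \<partial>lebesgue) * ennreal Cd" by (rule nn_integral_multc) measurable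
  finally have "(\<integral>\<^sup>+x. ennpowr (annulus_avg j F x) p * ennreal (w x) \<partial>lebesgue) \<le> ennreal ?Cs * ((\<integral>\<^sup>+y. G y \<partial>lebesgue) * ennreal Cd)"
    by (simp add: mult_left_mono)
  also have "\<dots> = ennreal (?Cs * Cd) * (\<integral>\<^sup>+y. G y \<partial>lebesgue)"
    using C Cd by (simp add: ennreal_mult mult_ac)
  \<comment> \<open>The exponent \<open>\<theta>\<close> from the average and
    \<open>(l0 + 2) * \<theta>\<close> from doubling add up to
    \<open>(l0 + 3) * \<theta>\<close>.\<close>
  also have "?Cs * Cd = C\<^sup>2 * (doubling_const \<theta> * spread j powr ((l0 + 3) * \<theta> + (l0 + 1) * real CARD('n))) powr p"
  proof -
    have "spread j powr (\<theta> * p) * k powr p = (doubling_const \<theta> * (spread j powr \<theta> * spread j powr ((l0 + 2) * \<theta> + (l0 + 1) * real CARD('n)))) powr p"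
      unfolding k_def using doubling_const_pos[of \<theta>] by (simp add: powr_mult powr_powr mult_ac)
    also have "spread j powr \<theta> * spread j powr ((l0 + 2) * \<theta> + (l0 + 1) * real CARD('n)) = spread j powr ((l0 + 3) * \<theta> + (l0 + 1) * real CARD('n))"
      unfolding powr_add[symmetric] by (simp add: algebra_simps)
    finally show ?thesis by (simp add: Cd_def power2_eq_square mult_ac)
  qed
  finally show ?thesis unfolding G_def .
qed

text \<open>The decay \<open>2 powr (- (j * e))\<close> with \<open>e = \<eta> / (l0 + 1)\<close> is
  spent in three ways: one unit provides the weights of \<open>weighted_lr_sum_le\<close>,
  \<open>N\<close> units compensate the growth of the averages, and one more makes the sum over
  \<open>j\<close> converge.\<close>

lemma global_strong:
  assumes r: "1 < r" and p: "1 \<le> p" and th: "0 \<le> \<theta>" and C: "0 < C" and H: "ball_Holder \<theta> p C w"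
    and [measurable]: "w \<in> borel_measurable lebesgue" and w: "\<And>x. 0 < w x"
    and fin: "\<And>x R. wint lebesgue w (ball x R) \<noteq> top"
    and eta: "2 + (l0 + 3) * \<theta> + (l0 + 1) * real CARD('n) \<le> \<eta> / (l0 + 1)"
  shows "\<exists>K>0. \<forall>f. (\<forall>k. f k \<in> borel_measurable lebesgue) \<longrightarrow>
    (\<integral>\<^sup>+x. ennpowr (\<Sum>k. ennpowr (global_max \<eta> (f k) x) r) (p / r) * ennreal (w x) \<partial>lebesgue)
    \<le> ennreal K * (\<integral>\<^sup>+x. ennpowr (lr_norm r (\<lambda>k. f k x)) p * ennreal (w x) \<partial>lebesgue)"
proof -
  define N where "N = (l0 + 3) * \<theta> + (l0 + 1) * real CARD('n)"
  have N0: "0 \<le> N" using th l0 by (simp add: N_def)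
  define e where "e = \<eta> / (l0 + 1)"
  have e: "2 + N \<le> e" using eta by (simp add: e_def N_def)
  have eta0: "0 \<le> \<eta>"
  proof -
    have "0 \<le> e" using e N0 by linarith
    then have "0 \<le> e * (l0 + 1)" using l0 by simp
    then show ?thesis using l0 by (simp add: e_def)
  qed
  define K0 where "K0 = C\<^sup>2 * (doubling_const \<theta> * (2 / rho_ratio) powr N) powr p"
  have K0: "0 < K0" using C doubling_const_pos[of \<theta>] rho_ratio by (simp add: K0_def)
  define K where "K = global_const \<eta> powr p * 2 powr (p / r) * (K0 * 2)"
  have K: "0 < K" using K0 global_const_pos[of \<eta>] by (simp add: K_def)
  have "(\<integral>\<^sup>+x. ennpowr (\<Sum>k. ennpowr (global_max \<eta> (f k) x) r) (p / r) * ennreal (w x) \<partial>lebesgue)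
    \<le> ennreal K * (\<integral>\<^sup>+x. ennpowr (lr_norm r (\<lambda>k. f k x)) p * ennreal (w x) \<partial>lebesgue)"
    if f: "\<And>k. f k \<in> borel_measurable lebesgue" for f
  proof -
    note [measurable] = f
    define F where "F x = lr_norm r (\<lambda>k. f k x)" for x
    have [measurable]: "F \<in> borel_measurable lebesgue" unfolding F_def by measurable
    let ?I = "\<integral>\<^sup>+x. ennpowr (F x) p * ennreal (w x) \<partial>lebesgue"
    define b where "b j x = ennreal (2 powr (- (real j * (e - 1)))) * annulus_avg j F x" for j x
    have [measurable]: "b j \<in> borel_measurable lebesgue" for j unfolding b_def[abs_def] by measurable
    have pointwise: "ennpowr (\<Sum>k. ennpowr (global_max \<eta> (f k) x) r) (p / r) \<le> ennreal (global_const \<eta> powr p * 2 powr (p / r)) * (\<Sum>j. ennpowr (b j x) p)" for x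
    proof -
      have "(\<Sum>k. ennpowr (global_max \<eta> (f k) x) r) \<le> ennreal (global_const \<eta> powr r) * (\<Sum>j. ennreal (2 powr (- (real j * e * r))) * ennpowr (annulus_avg j F x) r)"
        unfolding F_def[abs_def] e_def using suminf_global_max_le[OF r eta0, of f x] f by simp
      also have "\<dots> \<le> ennreal (global_const \<eta> powr r) * (\<Sum>j. ennreal ((1/2) ^ j) * ennpowr (b j x) r)"
      proof (intro mult_left_mono suminf_le)
        fix j
        have "2 powr (- (real j * e * r)) \<le> (1/2) ^ j * (2 powr (- (real j * (e - 1)))) powr r"
        proof -
          \<comment> \<open>One unit of decay is split off; as \<open>r > 1\<close>, weakening it
            from \<open>2 powr (- (j * r))\<close> to \<open>2 powr (- j)\<close> is
            allowed.\<close>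
          have "2 powr (- (real j * e * r)) = 2 powr (- (real j * r)) * 2 powr (- (real j * (e - 1) * r))"
            unfolding powr_add[symmetric] by (simp add: algebra_simps)
          also have "\<dots> \<le> 2 powr (- real j) * 2 powr (- (real j * (e - 1) * r))"
          proof (intro mult_right_mono powr_mono)
            have "real j * 1 \<le> real j * r" using r by (intro mult_left_mono) auto
            then show "- (real j * r) \<le> - real j" by simp
          qed auto
          also have "2 powr (- real j) = (1/2::real) ^ j" by (simp add: powr_minus powr_realpow power_one_over inverse_eq_divide)
          also have "2 powr (- (real j * (e - 1) * r)) = (2 powr (- (real j * (e - 1)))) powr r" by (simp add: powr_powr)
          finally show ?thesis .
        qed
        then have "ennreal (2 powr (- (real j * e * r))) * ennpowr (annulus_avg j F x) r
          \<le> ennreal ((1/2) ^ j * (2 powr (- (real j * (e - 1)))) powr r) * ennpowr (annulus_avg j F x) r"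
          by (intro mult_right_mono ennreal_leI) auto
        also have "\<dots> = ennreal ((1/2) ^ j) * ennpowr (b j x) r"
          unfolding b_def ennpowr_mult ennpowr_ennreal[OF powr_ge_zero]
          by (subst ennreal_mult) (simp_all add: mult.assoc)
        finally show "ennreal (2 powr (- (real j * e * r))) * ennpowr (annulus_avg j F x) r \<le> ennreal ((1/2) ^ j) * ennpowr (b j x) r" .
      qed auto
      finally have "ennpowr (\<Sum>k. ennpowr (global_max \<eta> (f k) x) r) (p / r) \<le> ennpowr (ennreal (global_const \<eta> powr r) * (\<Sum>j. ennreal ((1/2) ^ j) * ennpowr (b j x) r)) (p / r)"
        using r p by (intro ennpowr_mono) auto
      also have "\<dots> = ennreal (global_const \<eta> powr p) * ennpowr (\<Sum>j. ennreal ((1/2) ^ j) * ennpowr (b j x) r) (p / r)"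
        using r by (simp only: ennpowr_mult ennpowr_ennreal[OF powr_ge_zero] powr_powr) simp
      also have "\<dots> \<le> ennreal (global_const \<eta> powr p) * (ennreal (2 powr (p / r)) * (\<Sum>j. ennpowr (b j x) p))"
        using r p by (intro mult_left_mono weighted_lr_sum_le) auto
      also have "\<dots> = ennreal (global_const \<eta> powr p * 2 powr (p / r)) * (\<Sum>j. ennpowr (b j x) p)"
        by (subst ennreal_mult) (simp_all add: mult.assoc)
      finally show ?thesis .
    qed
    have b_int: "(\<integral>\<^sup>+x. ennpowr (b j x) p * ennreal (w x) \<partial>lebesgue) \<le> ennreal ((1/2) ^ j) * (ennreal K0 * ?I)" for j
    proof -
      let ?c = "2 powr (- (real j * (e - 1)))"
      have "(\<integral>\<^sup>+x. ennpowr (b j x) p * ennreal (w x) \<partial>lebesgue) = ennreal (?c powr p) * (\<integral>\<^sup>+x. ennpowr (annulus_avg j F x) p * ennreal (w x) \<partial>lebesgue)"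
        unfolding b_def ennpowr_mult ennpowr_ennreal[OF powr_ge_zero] mult.assoc by (rule nn_integral_cmult) measurable
      also have "\<dots> \<le> ennreal (?c powr p) * (ennreal (C\<^sup>2 * (doubling_const \<theta> * spread j powr N) powr p) * ?I)"
        unfolding N_def using p th C H w fin by (intro mult_left_mono annulus_strong) auto
      also have "\<dots> = ennreal (?c powr p * (C\<^sup>2 * (doubling_const \<theta> * spread j powr N) powr p)) * ?I"
        by (subst ennreal_mult) (simp_all add: mult.assoc)
      also have "\<dots> \<le> ennreal ((1/2) ^ j * K0) * ?I"
      proof (intro mult_right_mono ennreal_leI)
        have "spread j \<le> 2 / rho_ratio * 2 ^ j"
        proof -
          have "rho_ratio \<le> 2 ^ j" using rho_ratio(2) one_le_power[of "2::real" j] by linarith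
          then have "1 \<le> 2 ^ j / rho_ratio" using rho_ratio(1) by (simp add: le_divide_eq)
          then show ?thesis unfolding spread_def by simp
        qed
        then have "spread j powr N \<le> (2 / rho_ratio * 2 ^ j) powr N"
          using N0 spread_gt_1[of j] by (intro powr_mono2) auto
        also have "\<dots> = (2 / rho_ratio) powr N * 2 powr (real j * N)"
          using rho_ratio by (subst powr_mult) (simp_all add: powr_realpow[symmetric] powr_powr)
        finally have "doubling_const \<theta> * spread j powr N \<le> doubling_const \<theta> * ((2 / rho_ratio) powr N * 2 powr (real j * N))"
          using doubling_const_pos[of \<theta>] by (intro mult_left_mono) auto
        then have "(doubling_const \<theta> * spread j powr N) powr p \<le> (doubling_const \<theta> * ((2 / rho_ratio) powr N * 2 powr (real j * N))) powr p"
          using p doubling_const_pos[of \<theta>] by (intro powr_mono2) auto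
        also have "\<dots> = (doubling_const \<theta> * (2 / rho_ratio) powr N) powr p * 2 powr (real j * N * p)"
          using doubling_const_pos[of \<theta>] rho_ratio by (simp add: powr_mult powr_powr mult.assoc)
        finally have A: "C\<^sup>2 * (doubling_const \<theta> * spread j powr N) powr p \<le> K0 * 2 powr (real j * N * p)"
          unfolding K0_def mult.assoc by (intro mult_left_mono) auto
        have "?c powr p * (C\<^sup>2 * (doubling_const \<theta> * spread j powr N) powr p) \<le> ?c powr p * (K0 * 2 powr (real j * N * p))"
          by (intro mult_left_mono A) auto
        also have "\<dots> = K0 * 2 powr (- (real j * ((e - 1 - N) * p)))"
          by (simp add: powr_powr powr_add[symmetric] algebra_simps)
        also have "\<dots> \<le> K0 * 2 powr (- real j)"
        proof (intro mult_left_mono powr_mono)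
          \<comment> \<open>Here \<open>2 + N \<le> e\<close> and \<open>1 \<le> p\<close> enter:
            after the growth of the averages is paid, a factor \<open>2 powr (- j)\<close> is
            left.\<close>
          have "1 * 1 \<le> (e - 1 - N) * p" using e p by (intro mult_mono) auto
          then have "real j * 1 \<le> real j * ((e - 1 - N) * p)" by (intro mult_left_mono) auto
          then show "- (real j * ((e - 1 - N) * p)) \<le> - real j" by simp
        qed (use K0 in auto)
        also have "\<dots> = (1/2) ^ j * K0" by (simp add: powr_minus powr_realpow power_one_over inverse_eq_divide)
        finally show "?c powr p * (C\<^sup>2 * (doubling_const \<theta> * spread j powr N) powr p) \<le> (1/2) ^ j * K0" .
      qed simp
      also have "\<dots> = ennreal ((1/2) ^ j) * (ennreal K0 * ?I)"
        using K0 by (subst ennreal_mult) (simp_all add: mult.assoc)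
      finally show ?thesis .
    qed
    let ?g = "ennreal (global_const \<eta> powr p * 2 powr (p / r))"
    have "(\<integral>\<^sup>+x. ennpowr (\<Sum>k. ennpowr (global_max \<eta> (f k) x) r) (p / r) * ennreal (w x) \<partial>lebesgue)
      \<le> (\<integral>\<^sup>+x. ?g * (\<Sum>j. ennpowr (b j x) p * ennreal (w x)) \<partial>lebesgue)"
    proof (intro nn_integral_mono)
      fix x
      have "ennpowr (\<Sum>k. ennpowr (global_max \<eta> (f k) x) r) (p / r) * ennreal (w x) \<le> ?g * (\<Sum>j. ennpowr (b j x) p) * ennreal (w x)"
        by (rule mult_right_mono[OF pointwise]) simp
      then show "ennpowr (\<Sum>k. ennpowr (global_max \<eta> (f k) x) r) (p / r) * ennreal (w x) \<le> ?g * (\<Sum>j. ennpowr (b j x) p * ennreal (w x))"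
        by (simp only: ennreal_suminf_multc mult.assoc)
    qed
    also have "\<dots> = ?g * (\<Sum>j. \<integral>\<^sup>+x. ennpowr (b j x) p * ennreal (w x) \<partial>lebesgue)"
      by (simp add: nn_integral_cmult nn_integral_suminf del: ennreal_suminf_multc)
    also have "\<dots> \<le> ?g * (\<Sum>j. ennreal ((1/2) ^ j) * (ennreal K0 * ?I))"
      by (intro mult_left_mono suminf_le b_int) auto
    also have "\<dots> = ?g * (2 * (ennreal K0 * ?I))"
      unfolding ennreal_suminf_multc suminf_half_powers ..
    also have "\<dots> = ennreal K * ?I"
    proof -
      have "ennreal K = ?g * (ennreal K0 * 2)"
        unfolding K_def using K0 ennreal_mult[of K0 2] by (subst ennreal_mult) auto
      then show ?thesis by (simp add: mult_ac)
    qed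
    finally show ?thesis unfolding F_def .
  qed
  then show ?thesis using K by blast
qed

end

section \<open>The critical radius\<close>

lemma locally_integrable_set_integrable:
  fixes f :: "'a::euclidean_space \<Rightarrow> 'b::euclidean_space"
  assumes "locally_integrable f" "bounded S" "S \<in> sets lebesgue"
  shows "set_integrable lebesgue S f"
proof -
  obtain R where "S \<subseteq> cball 0 R" using assms(2) by (auto simp: bounded_iff cball_def)
  moreover have "set_integrable lebesgue (cball 0 R) f" using assms(1) by (auto simp: locally_integrable_def)
  ultimately show ?thesis using assms(3) set_integrable_subset by blast
qed

lemma locally_integrable_measurable:
  fixes f :: "'a::euclidean_space \<Rightarrow> 'b::euclidean_space"
  assumes "locally_integrable f"
  shows "f \<in> borel_measurable lebesgue"
proof (rule borel_measurable_LIMSEQ_metric)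
  fix i :: nat
  have "set_integrable lebesgue (cball 0 (real i)) f"
    by (rule locally_integrable_set_integrable[OF assms]) auto
  then show "(\<lambda>x. indicator (cball 0 (real i)) x *\<^sub>R f x) \<in> borel_measurable lebesgue"
    unfolding set_integrable_def by (rule borel_measurable_integrable)
next
  fix x :: 'a
  obtain N :: nat where N: "norm x \<le> N" using real_arch_simple by blast
  have "eventually (\<lambda>i. indicator (cball 0 (real i)) x *\<^sub>R f x = f x) sequentially"
    using N by (intro eventually_sequentiallyI[of N]) (auto simp: indicator_def)
  then show "(\<lambda>i. indicator (cball 0 (real i)) x *\<^sub>R f x) \<longlonglongrightarrow> f x" by (rule tendsto_eventually)
qed

lemma ball_measure_powr:
  fixes x :: "real^'n"
  assumes "0 < r"
  shows "measure lebesgue (ball x r) = unit_ball_vol (real CARD('n)) * r powr real CARD('n)"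
  using measure_ball_cart[of r x] assms by (simp add: powr_realpow)

text \<open>Either \<open>v \<le> t\<close>, or \<open>v powr (1 - q) \<le> t powr (1 - q)\<close>
  because \<open>1 - q < 0\<close>. Integrated with a free parameter \<open>t\<close>, it serves as
  an additive form of Hoelder's inequality.\<close>

lemma le_add_powr:
  fixes v t q :: real
  assumes "0 \<le> v" "0 < t" "1 < q"
  shows "v \<le> t + t powr (1 - q) * v powr q"
proof (cases "v \<le> t")
  case False
  then have v: "t < v" "0 < v" using assms by auto
  have "v = v powr (1 - q) * v powr q" using v by (simp flip: powr_add)
  also have "\<dots> \<le> t powr (1 - q) * v powr q"
    using v assms by (intro mult_right_mono powr_mono2') auto
  finally show ?thesis using assms by linarith
qed (use assms in \<open>simp add: add_increasing2\<close>)

context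
  fixes V :: "real^'n \<Rightarrow> real" and q :: real
  assumes n3: "3 \<le> CARD('n)" and q_def: "q = real CARD('n) / 2" and RH: "reverse_Holder q V"
begin

definition mass :: "real^'n \<Rightarrow> real \<Rightarrow> real" where
  "mass x r = (LINT y:ball x r|lebesgue. V y)"

definition qmass :: "real^'n \<Rightarrow> real \<Rightarrow> real" where
  "qmass x r = (LINT y:ball x r|lebesgue. V y powr q)"

lemma RH_facts: "1 < q" "\<And>x. 0 \<le> V x" "V \<in> borel_measurable lebesgue" "locally_integrable (\<lambda>x. V x powr q)"
  using RH by (auto simp: reverse_Holder_def)

lemma integrable_powr: "bounded S \<Longrightarrow> S \<in> sets lebesgue \<Longrightarrow> set_integrable lebesgue S (\<lambda>y. V y powr q)"
  by (rule locally_integrable_set_integrable[OF RH_facts(4)])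

lemma integrable_majorant:
  assumes "bounded S" "S \<in> sets lebesgue"
  shows "set_integrable lebesgue S (\<lambda>y. t + s * V y powr q)"
proof -
  have "emeasure lebesgue S < top" using bounded_set_imp_lmeasurable[OF assms(1,2)] unfolding fmeasurable_def infinity_ennreal_def by blast
  then have "set_integrable lebesgue S (\<lambda>y. t)" using assms(2) unfolding set_integrable_def
    by (simp add: integrable_mult_left_iff)
  then show ?thesis using integrable_powr[OF assms] by (intro set_integral_add set_integrable_mult_right) auto
qed

lemma integrable_V:
  assumes "bounded S" and [measurable]: "S \<in> sets lebesgue"
  shows "set_integrable lebesgue S V"
  unfolding set_integrable_def
proof (rule Bochner_Integration.integrable_bound)
  note [measurable] = RH_facts(3)
  show "integrable lebesgue (\<lambda>y. indicator S y *\<^sub>R (1 + 1 * V y powr q))"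
    using integrable_majorant[OF assms, of 1 1] by (simp add: set_integrable_def)
  show "(\<lambda>y. indicator S y *\<^sub>R V y) \<in> borel_measurable lebesgue" by measurable
  show "AE y in lebesgue. norm (indicator S y *\<^sub>R V y) \<le> norm (indicator S y *\<^sub>R (1 + 1 * V y powr q))"
    using le_add_powr[OF RH_facts(2), of 1 q] RH_facts(1,2) by (auto simp: indicator_def)
qed

lemma set_integral_V_le:
  assumes "bounded S" and [measurable]: "S \<in> sets lebesgue" and t: "0 < t"
  shows "(LINT y:S|lebesgue. V y) \<le> t * measure lebesgue S + t powr (1 - q) * (LINT y:S|lebesgue. V y powr q)"
proof -
  have fin: "emeasure lebesgue S < top" using bounded_set_imp_lmeasurable[OF assms(1,2)] unfolding fmeasurable_def infinity_ennreal_def by blast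
  have "(LINT y:S|lebesgue. V y) \<le> (LINT y:S|lebesgue. t + t powr (1 - q) * V y powr q)"
    using le_add_powr[OF RH_facts(2) t RH_facts(1)] by (intro set_integral_mono integrable_V integrable_majorant assms) auto
  also have "\<dots> = (LINT y:S|lebesgue. t) + (LINT y:S|lebesgue. t powr (1 - q) * V y powr q)"
    using integrable_majorant[OF assms(1,2), of t 0] integrable_majorant[OF assms(1,2), of 0 "t powr (1 - q)"]
    by (intro set_integral_add) auto
  also have "(LINT y:S|lebesgue. t) = t * measure lebesgue S"
    using fin by (simp add: set_lebesgue_integral_def)
  finally show ?thesis by simp
qed

lemma qmass_mono: "r \<le> R \<Longrightarrow> qmass x r \<le> qmass x R"
  unfolding qmass_def set_lebesgue_integral_def
  by (intro integral_mono integrable_powr[unfolded set_integrable_def]) (auto simp: indicator_def)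

lemma qmass_nonneg: "0 \<le> qmass x r"
  unfolding qmass_def set_lebesgue_integral_def by (intro integral_nonneg_AE) auto

lemma mass_nonneg: "0 \<le> mass x r"
  unfolding mass_def set_lebesgue_integral_def using RH_facts(2) by (intro integral_nonneg_AE) auto

text \<open>The mass between the radii \<open>r0\<close> and \<open>r\<close> is estimated by
  \<open>set_integral_V_le\<close>. For \<open>t = e * r powr (- 2)\<close> and
  \<open>q = n / 2\<close> all powers of \<open>r\<close> cancel in the error, which then depends on
  the radii only through the increment of \<open>qmass\<close>.\<close>

lemma scaled_mass_le:
  assumes r: "0 < r" and "r0 \<le> r" and e: "0 < e"
  shows "r powr (2 - real CARD('n)) * mass x r \<le> r powr (2 - real CARD('n)) * mass x r0
    + e * unit_ball_vol (real CARD('n)) + e powr (1 - q) * (qmass x r - qmass x r0)"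
proof -
  let ?n = "real CARD('n)" and ?S = "ball x r - ball x r0"
  have S: "bounded ?S" "?S \<in> sets lebesgue" by (auto simp: bounded_diff)
  have un: "ball x r = ball x r0 \<union> ?S" "ball x r0 \<inter> ?S = {}" using assms by auto
  have m: "mass x r = mass x r0 + (LINT y:?S|lebesgue. V y)"
    unfolding mass_def by (subst un(1), subst set_integral_Un) (auto intro!: integrable_V bounded_diff)
  have qm: "qmass x r = qmass x r0 + (LINT y:?S|lebesgue. V y powr q)"
    unfolding qmass_def by (subst un(1), subst set_integral_Un) (auto intro!: integrable_powr bounded_diff)
  have "measure lebesgue ?S \<le> measure lebesgue (ball x r)"
    by (intro measure_mono_fmeasurable) auto
  then have mS: "measure lebesgue ?S \<le> unit_ball_vol ?n * r powr ?n" unfolding ball_measure_powr[OF r] .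
  define t where "t = e * r powr (- 2)"
  have t: "0 < t" using e r by (simp add: t_def)
  have "(LINT y:?S|lebesgue. V y) \<le> t * measure lebesgue ?S + t powr (1 - q) * (LINT y:?S|lebesgue. V y powr q)"
    using S t by (rule set_integral_V_le)
  also have "\<dots> \<le> t * (unit_ball_vol ?n * r powr ?n) + t powr (1 - q) * (qmass x r - qmass x r0)"
    using t mS qm by (intro add_mono mult_left_mono) auto
  finally have "mass x r \<le> mass x r0 + (t * (unit_ball_vol ?n * r powr ?n) + t powr (1 - q) * (qmass x r - qmass x r0))"
    unfolding m by simp
  then have "r powr (2 - ?n) * mass x r \<le> r powr (2 - ?n) * (mass x r0 + (t * (unit_ball_vol ?n * r powr ?n) + t powr (1 - q) * (qmass x r - qmass x r0)))"
    by (intro mult_left_mono) auto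
  also have "\<dots> = r powr (2 - ?n) * mass x r0 + (r powr (2 - ?n) * t * r powr ?n) * unit_ball_vol ?n + (r powr (2 - ?n) * t powr (1 - q)) * (qmass x r - qmass x r0)"
    by (simp add: algebra_simps)
  also have "r powr (2 - ?n) * t * r powr ?n = e"
  proof -
    have "r powr (2 - ?n) * t * r powr ?n = e * (r powr (2 - ?n) * r powr (- 2) * r powr ?n)" by (simp add: t_def mult_ac)
    also have "r powr (2 - ?n) * r powr (- 2) * r powr ?n = 1" using r by (simp flip: powr_add)
    finally show ?thesis by simp
  qed
  also have "r powr (2 - ?n) * t powr (1 - q) = e powr (1 - q)"
  proof -
    have "t powr (1 - q) = e powr (1 - q) * r powr (?n - 2)"
      using e r by (simp add: t_def powr_mult powr_powr q_def)
    then show ?thesis using r by (simp flip: powr_add)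
  qed
  finally show ?thesis .
qed

text \<open>The reverse Hoelder inequality with volumes written as powers of \<open>r\<close>; for
  \<open>q = n / 2\<close> these combine exactly to the scaling in the definition of the critical
  radius.\<close>

lemma qmass_le_scaled_mass:
  obtains C where "0 < C" "\<And>x r. 0 < r \<Longrightarrow> qmass x r \<le> C * (r powr (2 - real CARD('n)) * mass x r) powr q"
proof -
  let ?n = "real CARD('n)"
  obtain C where C: "0 < C" "\<And>x r. 0 < r \<Longrightarrow> (1 / measure lebesgue (ball x r) * qmass x r) powr (1 / q) \<le> C * (1 / measure lebesgue (ball x r) * mass x r)"
    using RH unfolding reverse_Holder_def mass_def qmass_def by blast
  let ?c = "unit_ball_vol ?n"
  have c: "0 < ?c" by (rule unit_ball_vol_pos_card)
  have q: "1 < q" by (rule RH_facts(1))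
  have "qmass x r \<le> (C powr q * ?c powr (1 - q)) * (r powr (2 - ?n) * mass x r) powr q" if r: "0 < r" for x r
  proof -
    define m where "m = measure lebesgue (ball x r)"
    have m: "m = ?c * r powr ?n" "0 < m" unfolding m_def using ball_measure_powr[OF r] ball_avg_eq(2)[OF r] by auto
    have "((1 / m * qmass x r) powr (1 / q)) powr q \<le> (C * (1 / m * mass x r)) powr q"
      using C(2)[OF r, of x] q unfolding m_def[symmetric] by (intro powr_mono2) auto
    then have "1 / m * qmass x r \<le> (C * (1 / m * mass x r)) powr q"
      using q m qmass_nonneg[of x r] by (simp add: powr_powr)
    then have "qmass x r \<le> m * (C * (1 / m * mass x r)) powr q" using m(2) by (simp add: field_simps)
    also have "\<dots> = C powr q * (m powr 1 * m powr (- q)) * mass x r powr q"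
      using m(2) C(1) mass_nonneg[of x r] by (simp add: powr_mult powr_divide powr_minus divide_simps)
    also have "m powr 1 * m powr (- q) = m powr (1 - q)" by (simp only: powr_add[symmetric]) simp
    also have "\<dots> = ?c powr (1 - q) * r powr (?n * (1 - q))" using m(1) c r by (simp add: powr_mult powr_powr)
    also have "?n * (1 - q) = (2 - ?n) * q" unfolding q_def by (simp add: field_simps)
    finally show ?thesis using r mass_nonneg[of x r] by (simp add: powr_mult powr_powr mult_ac)
  qed
  then show thesis using that[of "C powr q * ?c powr (1 - q)"] C(1) c by simp
qed

text \<open>Every point other than the centre, a null set, leaves the shrinking balls; the
  restriction of \<open>V y powr q\<close> to the unit ball dominates.\<close>

lemma qmass_tendsto_0: "(\<lambda>i. qmass x (1 / real (Suc i))) \<longlonglongrightarrow> 0"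
proof -
  have "(\<lambda>i. \<integral>y. indicator (ball x (1 / real (Suc i))) y *\<^sub>R (V y powr q) \<partial>lebesgue) \<longlonglongrightarrow> (\<integral>y. 0 \<partial>(lebesgue :: (real^'n) measure))"
  proof (rule integral_dominated_convergence[where w = "\<lambda>y. indicator (ball x 1) y *\<^sub>R (V y powr q)"])
    note [measurable] = RH_facts(3)
    show "integrable lebesgue (\<lambda>y. indicator (ball x 1) y *\<^sub>R (V y powr q))"
      using integrable_powr[of "ball x 1"] by (simp add: set_integrable_def)
    show "(\<lambda>y. indicator (ball x (1 / real (Suc i))) y *\<^sub>R (V y powr q)) \<in> borel_measurable lebesgue" for i by measurable
    show "AE y in lebesgue. norm (indicator (ball x (1 / real (Suc i))) y *\<^sub>R (V y powr q)) \<le> indicator (ball x 1) y *\<^sub>R (V y powr q)" for i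
    proof (intro always_eventually allI)
      fix y
      have "1 / real (Suc i) \<le> 1" by simp
      then have "y \<in> ball x (1 / real (Suc i)) \<Longrightarrow> y \<in> ball x 1" unfolding mem_ball by linarith
      then show "norm (indicator (ball x (1 / real (Suc i))) y *\<^sub>R (V y powr q)) \<le> indicator (ball x 1) y *\<^sub>R (V y powr q)"
        by (auto simp: indicator_def)
    qed
    have "AE y in lebesgue. y \<notin> {x}" by (intro AE_not_in) (simp add: null_sets_completionI)
    then show "AE y in lebesgue. (\<lambda>i. indicator (ball x (1 / real (Suc i))) y *\<^sub>R (V y powr q)) \<longlonglongrightarrow> 0"
    proof (rule eventually_mono)
      fix y assume "y \<notin> {x}"
      then have "0 < dist x y" by simp
      then obtain N where N: "inverse (real (Suc N)) < dist x y" using reals_Archimedean by blast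
      have "indicator (ball x (1 / real (Suc i))) y *\<^sub>R (V y powr q) = 0" if "N \<le> i" for i
      proof -
        have "1 / real (Suc i) \<le> 1 / real (Suc N)" using that by (intro divide_left_mono) auto
        then have "y \<notin> ball x (1 / real (Suc i))" using N by (simp add: inverse_eq_divide)
        then show ?thesis by simp
      qed
      then show "(\<lambda>i. indicator (ball x (1 / real (Suc i))) y *\<^sub>R (V y powr q)) \<longlonglongrightarrow> 0"
        by (intro tendsto_eventually eventually_sequentiallyI[of N])
    qed
  qed simp
  then show ?thesis unfolding qmass_def set_lebesgue_integral_def by simp
qed

lemma scaled_mass_small: "\<exists>r>0. r powr (2 - real CARD('n)) * mass x r \<le> 1"
proof -
  let ?c = "unit_ball_vol (real CARD('n))"
  have c: "0 < ?c" by (rule unit_ball_vol_pos_card)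
  \<comment> \<open>The two error terms of \<open>scaled_mass_le\<close> with \<open>r0 = 0\<close>
    are each made at most \<open>1 / 2\<close>: the volume term by this \<open>e\<close>, the other
    by a small radius.\<close>
  define e where "e = 1 / (2 * ?c)"
  have e: "0 < e" "e * ?c = 1 / 2" using c less_imp_neq[OF c] by (auto simp: e_def)
  have "0 < e powr (q - 1) / 2" using e by simp
  then have "eventually (\<lambda>i. qmass x (1 / real (Suc i)) < e powr (q - 1) / 2) sequentially"
    using qmass_tendsto_0[of x] by (rule order_tendstoD(2)[rotated])
  then obtain i where i: "qmass x (1 / real (Suc i)) < e powr (q - 1) / 2"
    by (auto simp: eventually_sequentially)
  define r where "r = 1 / real (Suc i)"
  have r: "0 < r" by (simp add: r_def)
  have "mass x 0 = 0" "qmass x 0 = 0" by (simp_all add: mass_def qmass_def set_lebesgue_integral_def)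
  then have "r powr (2 - real CARD('n)) * mass x r \<le> e * ?c + e powr (1 - q) * qmass x r"
    using scaled_mass_le[OF r _ e(1), of 0 x] r by simp
  also have "e powr (1 - q) * qmass x r \<le> e powr (1 - q) * (e powr (q - 1) / 2)"
    using i unfolding r_def by (intro mult_left_mono) auto
  also have "\<dots> = 1 / 2" using e(1) by (simp flip: powr_add)
  finally show ?thesis using e r by (intro exI[of _ r]) auto
qed

text \<open>If the scaled mass were at most 1 at arbitrarily large radii, reverse Hoelder would
  bound \<open>qmass\<close> on all balls. Its increments beyond a large \<open>r0\<close> are then
  small, so the scaled mass is small at large radii; reverse Hoelder again makes
  \<open>qmass\<close> arbitrarily small, and \<open>V\<close> vanishes almost everywhere.\<close>

lemma bdd_above_scaled_mass:
  assumes nz: "\<not> (AE y in lebesgue. V y = 0)"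
  shows "bdd_above {r. 0 < r \<and> r powr (2 - real CARD('n)) * mass x r \<le> 1}"
proof (rule ccontr)
  let ?n = "real CARD('n)" and ?c = "unit_ball_vol (real CARD('n))"
  let ?S = "{r. 0 < r \<and> r powr (2 - ?n) * mass x r \<le> 1}"
  assume unb: "\<not> bdd_above ?S"
  have q: "1 < q" by (rule RH_facts(1))
  have c: "0 < ?c" by (rule unit_ball_vol_pos_card)
  obtain C where C: "0 < C" "\<And>r. 0 < r \<Longrightarrow> qmass x r \<le> C * (r powr (2 - ?n) * mass x r) powr q"
    using qmass_le_scaled_mass by metis
  have bound: "qmass x r \<le> C" for r
  proof -
    obtain s where s: "s \<in> ?S" "r < s" using unb by (auto simp: bdd_above_def not_le)
    have "qmass x r \<le> qmass x s" using s by (intro qmass_mono) auto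
    also have "\<dots> \<le> C * (s powr (2 - ?n) * mass x s) powr q" using C(2) s by auto
    also have "\<dots> \<le> C * 1 powr q"
      using s C(1) q mass_nonneg[of x s] by (intro mult_left_mono powr_mono2) auto
    finally show ?thesis by simp
  qed
  have small: "qmass x R \<le> C * k powr q" if k: "0 < k" for R k
  proof -
    \<comment> \<open>Three terms of \<open>scaled_mass_le\<close> are made at most
      \<open>k / 3\<close>: \<open>e\<close> settles the volume term, \<open>d\<close> the increment
      of \<open>qmass\<close> beyond \<open>r0\<close>, and a large \<open>r\<close> the inner
      mass.\<close>
    define e where "e = k / (3 * ?c)"
    have e: "0 < e" "e * ?c = k / 3" using c less_imp_neq[OF c] k by (auto simp: e_def)
    define d where "d = k / 3 * e powr (q - 1)"
    have d: "0 < d" "e powr (1 - q) * d = k / 3"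
    proof -
      show "0 < d" using e k by (simp add: d_def)
      have "e powr (1 - q) * e powr (q - 1) = 1" using e(1) by (simp flip: powr_add)
      then show "e powr (1 - q) * d = k / 3" unfolding d_def by (simp add: mult.left_commute)
    qed
    define s where "s = (SUP r. qmass x r)"
    have bdd: "bdd_above (range (qmass x))" using bound by (intro bdd_aboveI2)
    have le_s: "qmass x r \<le> s" for r unfolding s_def by (rule cSUP_upper[OF _ bdd]) simp
    have "\<exists>r. s - d < qmass x r"
      using less_cSUP_iff[OF _ bdd, of "s - d"] d unfolding s_def by auto
    then obtain r1 where r1: "s - d < qmass x r1" by blast
    define r0 where "r0 = max r1 1"
    have r0: "0 < r0" "1 \<le> r0" "s - d < qmass x r0"
      using r1 qmass_mono[of r1 r0 x] by (auto simp: r0_def)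
    define r where "r = max (max r0 R) (3 * mass x r0 / k)"
    have r: "r0 \<le> r" "R \<le> r" "3 * mass x r0 / k \<le> r" "1 \<le> r" using r0 by (auto simp: r_def)
    have "r powr (2 - ?n) * mass x r0 \<le> k / 3"
    proof -
      \<comment> \<open>The dimension enters here: \<open>2 - n \<le> -1\<close> makes the fixed
        inner mass negligible for large \<open>r\<close>.\<close>
      have "r powr (2 - ?n) \<le> r powr (- 1)" using r n3 by (intro powr_mono) auto
      then have "r powr (2 - ?n) * mass x r0 \<le> r powr (- 1) * mass x r0" using mass_nonneg by (intro mult_right_mono) auto
      also have "\<dots> \<le> k / 3" using r k by (simp add: powr_minus field_simps)
      finally show ?thesis .
    qed
    moreover have "e powr (1 - q) * (qmass x r - qmass x r0) \<le> k / 3"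
    proof -
      have "qmass x r - qmass x r0 \<le> d" using le_s[of r] r0(3) by linarith
      then have "e powr (1 - q) * (qmass x r - qmass x r0) \<le> e powr (1 - q) * d" by (intro mult_left_mono) auto
      then show ?thesis using d(2) by simp
    qed
    ultimately have "r powr (2 - ?n) * mass x r \<le> k"
      using scaled_mass_le[OF _ r(1) e(1), of x] r(4) e(2) by linarith
    then have "(r powr (2 - ?n) * mass x r) powr q \<le> k powr q"
      using q mass_nonneg[of x r] by (intro powr_mono2) auto
    then have "C * (r powr (2 - ?n) * mass x r) powr q \<le> C * k powr q" using C(1) by (intro mult_left_mono) auto
    then show ?thesis using C(2)[of r] qmass_mono[OF r(2), of x] r(4) by linarith
  qed
  have zero: "qmass x R = 0" for R
  proof (rule ccontr)
    assume "qmass x R \<noteq> 0"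
    then have p: "0 < qmass x R" using qmass_nonneg[of x R] by linarith
    \<comment> \<open>Chosen such that \<open>small\<close> bounds \<open>qmass x R\<close> by half
      of itself.\<close>
    define k where "k = (qmass x R / (2 * C)) powr (1 / q)"
    have "k powr q = qmass x R / (2 * C)" using p C(1) q by (simp add: k_def powr_powr)
    then have "qmass x R \<le> C * (qmass x R / (2 * C))" using small[of k R] p C(1) by (simp add: k_def)
    then show False using p C(1) by simp
  qed
  have "AE y in lebesgue. \<forall>i::nat. y \<in> ball x (real i) \<longrightarrow> V y = 0"
    unfolding AE_all_countable
  proof
    fix i :: nat
    have int: "integrable lebesgue (\<lambda>y. indicator (ball x (real i)) y *\<^sub>R (V y powr q))"
      using integrable_powr[of "ball x (real i)"] by (simp add: set_integrable_def)
    have "AE y in lebesgue. indicator (ball x (real i)) y *\<^sub>R (V y powr q) = 0"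
      using zero[of "real i"] unfolding qmass_def set_lebesgue_integral_def
      by (subst (asm) integral_nonneg_eq_0_iff_AE[OF int]) auto
    then show "AE y in lebesgue. y \<in> ball x (real i) \<longrightarrow> V y = 0"
      by (rule eventually_mono) (auto simp: indicator_def)
  qed
  then have "AE y in lebesgue. V y = 0"
  proof (rule eventually_mono)
    fix y assume *: "\<forall>i::nat. y \<in> ball x (real i) \<longrightarrow> V y = 0"
    obtain i :: nat where "dist x y < real i" using reals_Archimedean2 by blast
    then show "V y = 0" using * by auto
  qed
  then show False using nz by simp
qed

text \<open>The supremum of reals in \<open>crit_radius\<close> is meaningful only for a nonempty
  set bounded above; \<open>scaled_mass_small\<close> and \<open>bdd_above_scaled_mass\<close>
  provide the two properties.\<close>

lemma crit_radius_positive: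
  assumes "\<not> (AE y in lebesgue. V y = 0)"
  shows "0 < crit_radius V x"
proof -
  obtain r where r: "0 < r" "r powr (2 - real CARD('n)) * mass x r \<le> 1" using scaled_mass_small by blast
  have "r \<le> crit_radius V x"
    unfolding crit_radius_def using r bdd_above_scaled_mass[OF assms, of x]
    by (intro cSup_upper) (auto simp: mass_def)
  then show ?thesis using r by linarith
qed

end

lemma wint_ball_finite:
  fixes w :: "real^'n \<Rightarrow> real"
  assumes "weight w"
  shows "wint lebesgue w (ball x R) \<noteq> top"
proof -
  have w: "\<And>x. 0 < w x" "locally_integrable w" using assms by (auto simp: weight_def)
  have "set_integrable lebesgue (ball x R) w"
    using w(2) by (rule locally_integrable_set_integrable) auto
  then have "(\<integral>\<^sup>+y. ennreal (norm (indicator (ball x R) y *\<^sub>R w y)) \<partial>lebesgue) < \<infinity>"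
    unfolding set_integrable_def integrable_iff_bounded by blast
  also have "(\<integral>\<^sup>+y. ennreal (norm (indicator (ball x R) y *\<^sub>R w y)) \<partial>lebesgue) = wint lebesgue w (ball x R)"
    unfolding wint_def using w(1) by (intro nn_integral_cong) (auto simp: indicator_def less_imp_le)
  finally show ?thesis by simp
qed

lemma slowly_varying_crit_radius:
  fixes V :: "real^'n \<Rightarrow> real"
  assumes sv: "slow_variation V l0 C0" and pos: "\<And>x. 0 < crit_radius V x"
  shows "slowly_varying (crit_radius V) l0 C0"
proof
  have sv': "0 < l0" "1 < C0"
    "\<And>x y. 1 / C0 * (1 + norm (x - y) / crit_radius V x) powr (- l0) \<le> crit_radius V y / crit_radius V x"
    "\<And>x y. crit_radius V y / crit_radius V x \<le> C0 * (1 + norm (x - y) / crit_radius V x) powr (l0 / (l0 + 1))"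
    using sv by (auto simp: slow_variation_def aux_m_def)
  show "0 < crit_radius V x" for x by (rule pos)
  show "0 < l0" "1 < C0" by (rule sv')+
  show "crit_radius V x * (1 + norm (x - y) / crit_radius V x) powr (- l0) \<le> C0 * crit_radius V y" for x y
    using sv'(3)[of x y] pos[of x] sv'(2) by (simp add: field_simps)
  show "crit_radius V y \<le> C0 * crit_radius V x * (1 + norm (x - y) / crit_radius V x) powr (l0 / (l0 + 1))" for x y
    using sv'(4)[of y x] pos[of x] by (simp add: divide_le_eq mult_ac)
qed

section \<open>The maximal operator: small and large balls combined\<close>

locale critical_weight = slowly_varying "crit_radius V" l0 C0
  for V :: "real^'n \<Rightarrow> real" and l0 C0 :: real
begin

lemma psi_vol_eq: "0 < R \<Longrightarrow> Psi V \<theta> x R * measure lebesgue (ball x R) = psi_vol \<theta> x R"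
  unfolding Psi_def psi_vol_def using measure_ball_cart[of R x] by simp

lemma Psi_avg_eq: "0 < R \<Longrightarrow> Psi_avg V \<theta> x R g = (\<integral>\<^sup>+y\<in>ball x R. g y \<partial>lebesgue) / ennreal (psi_vol \<theta> x R)"
  unfolding Psi_avg_def by (simp only: psi_vol_eq)

lemma Psi_avg_eq_ball_avg:
  assumes R: "0 < R"
  shows "Psi_avg V \<theta> x R g = ennreal ((1 + R / crit_radius V x) powr (- \<theta>)) * ball_avg x R g"
proof -
  have P: "0 < Psi V \<theta> x R"
  proof -
    have "0 < 1 + R / crit_radius V x" using R rho_pos[of x] by (intro add_pos_pos) auto
    then show ?thesis by (simp add: Psi_def)
  qed
  have m: "0 < measure lebesgue (ball x R)" by (rule ball_avg_eq(2)[OF R])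
  have "inverse (ennreal (Psi V \<theta> x R * measure lebesgue (ball x R))) = ennreal (1 / Psi V \<theta> x R * (1 / measure lebesgue (ball x R)))"
    by (subst inverse_ennreal[OF mult_pos_pos[OF P m]]) (simp only: inverse_eq_divide times_divide_times_eq mult_1)
  also have "\<dots> = ennreal (1 / Psi V \<theta> x R) * ennreal (1 / measure lebesgue (ball x R))"
    using P m by (intro ennreal_mult) auto
  also have "1 / Psi V \<theta> x R = (1 + R / crit_radius V x) powr (- \<theta>)"
    by (simp add: Psi_def powr_minus inverse_eq_divide)
  finally show ?thesis
    unfolding Psi_avg_def divide_ennreal_def ball_avg_eq(1)[OF R] by (simp only: mult_ac)
qed

lemma Ap_rho_imp_ball_Ap:
  assumes "Ap_rho V \<theta> p w" "1 < p"
  obtains C where "0 < C" "ball_Ap \<theta> p C w"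
proof -
  obtain C where C: "0 < C" "\<And>x0 r. 0 < r \<Longrightarrow> Psi_avg V \<theta> x0 r (\<lambda>y. ennreal (w y)) *
     ennpowr (Psi_avg V \<theta> x0 r (\<lambda>y. ennreal (w y powr (- 1 / (p - 1))))) (p - 1) \<le> ennreal C"
    using assms by (auto simp: Ap_rho_def)
  have "wint lebesgue w (ball x R) * ennpowr (wint lebesgue (dual_weight p w) (ball x R)) (p - 1)
    \<le> ennreal C * ennpowr (ennreal (psi_vol \<theta> x R)) p" if R: "0 < R" for x R
  proof -
    let ?P = "psi_vol \<theta> x R" and ?W = "wint lebesgue w (ball x R)" and ?S = "wint lebesgue (dual_weight p w) (ball x R)"
    have P: "0 < ?P" using R by (rule psi_vol_pos)
    have "?W / ennreal ?P * ennpowr (?S / ennreal ?P) (p - 1) \<le> ennreal C"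
      using C(2)[OF R, of x] unfolding Psi_avg_eq[OF R] wint_def dual_weight_def .
    then have "(?W / ennreal ?P * ennpowr (?S / ennreal ?P) (p - 1)) * ennpowr (ennreal ?P) p \<le> ennreal C * ennpowr (ennreal ?P) p"
      by (rule mult_right_mono) simp
    also have "ennpowr (ennreal ?P) p = ennreal ?P * ennpowr (ennreal ?P) (p - 1)"
      using ennpowr_add[of 1 "p - 1" "ennreal ?P"] assms(2) by simp
    also have "(?W / ennreal ?P * ennpowr (?S / ennreal ?P) (p - 1)) * (ennreal ?P * ennpowr (ennreal ?P) (p - 1))
      = (ennreal ?P * (?W / ennreal ?P)) * ennpowr (ennreal ?P * (?S / ennreal ?P)) (p - 1)"
      unfolding ennpowr_mult by (simp only: mult_ac)
    also have "\<dots> = ?W * ennpowr ?S (p - 1)"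
      using P by (simp add: ennreal_mult_divide_cancel)
    finally show ?thesis unfolding \<open>ennpowr (ennreal ?P) p = _\<close> .
  qed
  then show thesis using that[OF C(1)] unfolding ball_Ap_def by blast
qed

lemma Ap_rho_imp_ball_A1:
  assumes "Ap_rho V \<theta> 1 w"
  obtains C where "0 < C" "ball_A1 \<theta> C w"
proof -
  have w: "\<And>x. 0 < w x" using assms by (auto simp: Ap_rho_def weight_def)
  obtain C where C: "0 < C" "AE x in lebesgue. max_op V \<theta> w x \<le> ennreal (C * w x)"
    using assms by (auto simp: Ap_rho_def)
  have "ball_A1 \<theta> C w"
    unfolding ball_A1_def
  proof (intro eventually_mono[OF C(2)] allI impI)
    fix x x0 R assume le: "max_op V \<theta> w x \<le> ennreal (C * w x)" and R: "0 < R" "x \<in> ball x0 R"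
    let ?P = "psi_vol \<theta> x0 R"
    have P: "0 < ?P" using R(1) by (rule psi_vol_pos)
    have eq: "ennreal (norm (w y)) = ennreal (w y)" for y using w[of y] by simp
    have "wint lebesgue w (ball x0 R) / ennreal ?P = Psi_avg V \<theta> x0 R (\<lambda>y. ennreal (norm (w y)))"
      by (simp only: Psi_avg_eq[OF R(1)] wint_def eq)
    also have "\<dots> \<le> max_op V \<theta> w x" unfolding max_op_def using R by (intro SUP_upper2[of "(x0, R)"]) auto
    also note le
    finally have "ennreal ?P * (wint lebesgue w (ball x0 R) / ennreal ?P) \<le> ennreal ?P * ennreal (C * w x)"
      by (rule mult_left_mono) simp
    then show "wint lebesgue w (ball x0 R) \<le> ennreal (C * w x) * ennreal ?P"
      using P by (simp add: ennreal_mult_divide_cancel mult.commute)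
  qed
  then show thesis using that[OF C(1)] by blast
qed

text \<open>Balls are separated at the critical radius of their own centre. For small ones the
  damping factor is at most 1 and is dropped; for large ones it is kept as the source of
  decay.\<close>

lemma max_op_le:
  fixes f :: "real^'n \<Rightarrow> 'b::real_normed_vector"
  assumes eta: "0 \<le> \<eta>"
  shows "max_op V \<eta> f x \<le> max (local_max (\<lambda>y. ennreal (norm (f y))) x) (global_max \<eta> (\<lambda>y. ennreal (norm (f y))) x)"
  unfolding max_op_def
proof (intro SUP_least, clarify)
  fix x0 R assume R: "0 < R" "x \<in> ball x0 R"
  let ?f = "\<lambda>y. ennreal (norm (f y))"
  have r: "0 < crit_radius V x0" by (rule rho_pos)
  show "Psi_avg V \<eta> x0 R ?f \<le> max (local_max ?f x) (global_max \<eta> ?f x)"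
  proof (cases "R \<le> crit_radius V x0")
    case True
    have "(1 + R / crit_radius V x0) powr (- \<eta>) \<le> (1 + R / crit_radius V x0) powr 0"
      using R r eta by (intro powr_mono) auto
    also have "\<dots> \<le> 1" by simp
    finally have "ennreal ((1 + R / crit_radius V x0) powr (- \<eta>)) \<le> 1" by simp
    then have "Psi_avg V \<eta> x0 R ?f \<le> 1 * ball_avg x0 R ?f"
      unfolding Psi_avg_eq_ball_avg[OF R(1)] by (rule mult_right_mono) simp
    also have "\<dots> \<le> local_max ?f x"
      unfolding local_max_def using R True by (intro SUP_upper2[of "(x0, R)"]) auto
    finally show ?thesis by (rule max.coboundedI1)
  next
    case False
    then have "Psi_avg V \<eta> x0 R ?f \<le> global_max \<eta> ?f x"
      unfolding Psi_avg_eq_ball_avg[OF R(1)] global_max_def using R by (intro SUP_upper2[of "(x0, R)"]) auto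
    then show ?thesis by (rule max.coboundedI2)
  qed
qed

lemma suminf_max_op_le:
  fixes f :: "nat \<Rightarrow> real^'n \<Rightarrow> 'b::real_normed_vector"
  assumes eta: "0 \<le> \<eta>" and r: "0 < r"
  shows "(\<Sum>k. ennpowr (max_op V \<eta> (f k) x) r)
    \<le> (\<Sum>k. ennpowr (local_max (\<lambda>y. ennreal (norm (f k y))) x) r) + (\<Sum>k. ennpowr (global_max \<eta> (\<lambda>y. ennreal (norm (f k y))) x) r)"
proof -
  have "ennpowr (max_op V \<eta> (f k) x) r \<le> ennpowr (local_max (\<lambda>y. ennreal (norm (f k y))) x) r + ennpowr (global_max \<eta> (\<lambda>y. ennreal (norm (f k y))) x) r" for k
  proof -
    let ?a = "local_max (\<lambda>y. ennreal (norm (f k y))) x" and ?b = "global_max \<eta> (\<lambda>y. ennreal (norm (f k y))) x"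
    have "ennpowr (max_op V \<eta> (f k) x) r \<le> ennpowr (max ?a ?b) r"
      using r by (intro ennpowr_mono max_op_le[OF eta]) auto
    also have "\<dots> \<le> ennpowr ?a r + ennpowr ?b r" by (auto simp: max_def)
    finally show ?thesis .
  qed
  then show ?thesis by (subst suminf_add) (auto intro: suminf_le)
qed

lemma measurable_max_op [measurable]: "max_op V \<eta> f \<in> borel_measurable lebesgue"
  unfolding max_op_def[abs_def] by (rule measurable_ball_SUP)

lemma measurable_global_max [measurable]: "global_max \<eta> g \<in> borel_measurable lebesgue"
  unfolding global_max_def[abs_def] by (rule measurable_ball_SUP)

lemma max_op_strong:
  assumes r: "1 < r" and p: "1 < p" and th: "0 \<le> \<theta>" and Ap: "Ap_rho V \<theta> p w"
    and eta: "2 + (l0 + 3) * \<theta> + (l0 + 1) * real CARD('n) \<le> \<eta> / (l0 + 1)" and eta0: "0 \<le> \<eta>"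
  shows "\<exists>K>0. \<forall>f :: nat \<Rightarrow> real^'n \<Rightarrow> 'b::euclidean_space. (\<forall>k. locally_integrable (f k)) \<longrightarrow>
    (\<integral>\<^sup>+x. ennpowr (lr_norm r (\<lambda>k. max_op V \<eta> (f k) x)) p * ennreal (w x) \<partial>lebesgue)
    \<le> ennreal K * (\<integral>\<^sup>+x. ennpowr (lr_norm r (\<lambda>k. ennreal (norm (f k x)))) p * ennreal (w x) \<partial>lebesgue)"
proof -
  have wt: "weight w" and w: "\<And>x. 0 < w x" using Ap by (auto simp: Ap_rho_def weight_def)
  have [measurable]: "w \<in> borel_measurable lebesgue" using wt by (auto simp: weight_def intro: locally_integrable_measurable)
  obtain C where C: "0 < C" "ball_Ap \<theta> p C w" using Ap_rho_imp_ball_Ap[OF Ap p] by blast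
  have H: "ball_Holder \<theta> p C w" using p C(2) w by (intro ball_Ap_imp_ball_Holder) auto
  define C' where "C' = C * cell_psi \<theta> powr p"
  have C': "0 < C'" using C(1) cell_psi_pos[of \<theta>] by (simp add: C'_def)
  have Apc: "Ap_on lebesgue (local_cells N A) p C' w" for N A
    unfolding C'_def using p th C by (intro ball_Ap_imp_Ap_on) auto
  obtain Kg where Kg: "0 < Kg" "\<And>f. (\<And>k. f k \<in> borel_measurable lebesgue) \<Longrightarrow>
    (\<integral>\<^sup>+x. ennpowr (\<Sum>k. ennpowr (global_max \<eta> (f k) x) r) (p / r) * ennreal (w x) \<partial>lebesgue)
    \<le> ennreal Kg * (\<integral>\<^sup>+x. ennpowr (lr_norm r (\<lambda>k. f k x)) p * ennreal (w x) \<partial>lebesgue)"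
    using global_strong[OF r less_imp_le[OF p] th C(1) H \<open>w \<in> _\<close> w wint_ball_finite[OF wt] eta] by blast
  define Kl where "Kl = ball_cell_ratio powr p * real (CARD('n set)) powr (p / r) * real (CARD('n set)) * strong_const r p (2 * weak_const r (2 ^ CARD('n)) 1) C'"
  have Kl: "0 \<le> Kl"
    unfolding Kl_def using less_imp_le[OF strong_const_pos[OF p C', of "2 * weak_const r (2 ^ CARD('n)) 1" r]] r weak_const_pos[of r 1 "2 ^ CARD('n)"]
    by (intro mult_nonneg_nonneg) auto
  let ?c = "2 powr (p / r)"
  show ?thesis
  proof (intro exI[of _ "?c * (Kl + Kg)"] conjI allI impI)
    show "0 < ?c * (Kl + Kg)" using Kl Kg(1) by simp
    fix f :: "nat \<Rightarrow> real^'n \<Rightarrow> 'b" assume "\<forall>k. locally_integrable (f k)"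
    then have f [measurable]: "f k \<in> borel_measurable lebesgue" for k by (auto intro: locally_integrable_measurable)
    define g where "g k y = ennreal (norm (f k y))" for k y
    have g [measurable]: "g k \<in> borel_measurable lebesgue" for k unfolding g_def[abs_def] by measurable
    let ?I = "\<integral>\<^sup>+x. ennpowr (lr_norm r (\<lambda>k. g k x)) p * ennreal (w x) \<partial>lebesgue"
    define Lo where "Lo x = ennpowr (\<Sum>k. ennpowr (local_max (g k) x) r) (p / r)" for x
    define Gl where "Gl x = ennpowr (\<Sum>k. ennpowr (global_max \<eta> (g k) x) r) (p / r)" for x
    have [measurable]: "Lo \<in> borel_measurable lebesgue" "Gl \<in> borel_measurable lebesgue"
      unfolding Lo_def[abs_def] Gl_def[abs_def] by measurable
    have "(\<integral>\<^sup>+x. ennpowr (lr_norm r (\<lambda>k. max_op V \<eta> (f k) x)) p * ennreal (w x) \<partial>lebesgue)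
      \<le> (\<integral>\<^sup>+x. ennreal ?c * (Lo x * ennreal (w x) + Gl x * ennreal (w x)) \<partial>lebesgue)"
    proof (intro nn_integral_mono)
      fix x
      \<comment> \<open>A sum over \<open>bool\<close> makes the two-term case an instance of
        \<open>ennpowr_sum_le_card\<close> with cardinality 2.\<close>
      let ?a = "\<lambda>b::bool. if b then (\<Sum>k. ennpowr (local_max (g k) x) r) else (\<Sum>k. ennpowr (global_max \<eta> (g k) x) r)"
      have "ennpowr (lr_norm r (\<lambda>k. max_op V \<eta> (f k) x)) p = ennpowr (\<Sum>k. ennpowr (max_op V \<eta> (f k) x) r) (p / r)"
        unfolding lr_norm_def ennpowr_ennpowr by simp
      also have "\<dots> \<le> ennpowr (\<Sum>b\<in>UNIV. ?a b) (p / r)"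
        using suminf_max_op_le[OF eta0, of r f x] r p unfolding g_def UNIV_bool
        by (intro ennpowr_mono) (auto simp: add.commute)
      also have "\<dots> \<le> ennpowr (of_nat (card (UNIV :: bool set))) (p / r) * (\<Sum>b\<in>UNIV. ennpowr (?a b) (p / r))"
        using r p by (intro ennpowr_sum_le_card) auto
      also have "\<dots> = ennreal ?c * (Lo x + Gl x)"
        using ennpowr_ennreal[of 2 "p / r"] by (simp add: UNIV_bool Lo_def Gl_def add.commute)
      finally have "ennpowr (lr_norm r (\<lambda>k. max_op V \<eta> (f k) x)) p * ennreal (w x) \<le> ennreal ?c * (Lo x + Gl x) * ennreal (w x)"
        by (rule mult_right_mono) simp
      then show "ennpowr (lr_norm r (\<lambda>k. max_op V \<eta> (f k) x)) p * ennreal (w x) \<le> ennreal ?c * (Lo x * ennreal (w x) + Gl x * ennreal (w x))"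
        by (simp only: distrib_right mult.assoc)
    qed
    also have "\<dots> = ennreal ?c * ((\<integral>\<^sup>+x. Lo x * ennreal (w x) \<partial>lebesgue) + (\<integral>\<^sup>+x. Gl x * ennreal (w x) \<partial>lebesgue))"
      by (simp add: nn_integral_cmult nn_integral_add)
    also have "\<dots> \<le> ennreal ?c * (ennreal Kl * ?I + ennreal Kg * ?I)"
      unfolding Lo_def Gl_def Kl_def using r p C' w Apc g
      by (intro mult_left_mono add_mono local_strong Kg(2)) auto
    also have "\<dots> = ennreal (?c * (Kl + Kg)) * ?I"
      using Kl Kg(1) by (simp add: ennreal_mult distrib_right mult.assoc)
    finally show "(\<integral>\<^sup>+x. ennpowr (lr_norm r (\<lambda>k. max_op V \<eta> (f k) x)) p * ennreal (w x) \<partial>lebesgue)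
      \<le> ennreal (?c * (Kl + Kg)) * (\<integral>\<^sup>+x. ennpowr (lr_norm r (\<lambda>k. ennreal (norm (f k x)))) p * ennreal (w x) \<partial>lebesgue)"
      unfolding g_def .
  qed
qed

lemma Chebyshev_wint:
  assumes p: "0 < p" and a: "0 < a"
    and [measurable]: "h \<in> borel_measurable lebesgue" "w \<in> borel_measurable lebesgue"
  shows "wint lebesgue w {x. ennreal a < h x} \<le> ennreal (a powr (- p)) * (\<integral>\<^sup>+x. ennpowr (h x) p * ennreal (w x) \<partial>lebesgue)"
proof -
  have "wint lebesgue w {x. ennreal a < h x} \<le> (\<integral>\<^sup>+x. ennreal (a powr (- p)) * (ennpowr (h x) p * ennreal (w x)) \<partial>lebesgue)"
    unfolding wint_def
  proof (intro nn_integral_mono)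
    fix x
    show "ennreal (w x) * indicator {x. ennreal a < h x} x \<le> ennreal (a powr (- p)) * (ennpowr (h x) p * ennreal (w x))"
    proof (cases "ennreal a < h x")
      case True
      have "1 = ennreal (a powr (- p)) * ennpowr (ennreal a) p"
        using a by (simp add: ennpowr_ennreal powr_minus flip: ennreal_mult)
      also have "\<dots> \<le> ennreal (a powr (- p)) * ennpowr (h x) p"
        using True p by (intro mult_left_mono ennpowr_mono) auto
      finally have "1 * ennreal (w x) \<le> ennreal (a powr (- p)) * ennpowr (h x) p * ennreal (w x)"
        by (rule mult_right_mono) simp
      then show ?thesis using True by (simp add: mult.assoc)
    qed simp
  qed
  also have "\<dots> = ennreal (a powr (- p)) * (\<integral>\<^sup>+x. ennpowr (h x) p * ennreal (w x) \<partial>lebesgue)"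
    by (rule nn_integral_cmult) measurable
  finally show ?thesis .
qed

text \<open>Small balls contribute through the weak local bound; for large balls even a strong bound
  with exponent 1 holds, to which Chebyshev's inequality is applied.\<close>

lemma max_op_weak:
  assumes r: "1 < r" and th: "0 \<le> \<theta>" and Ap: "Ap_rho V \<theta> 1 w"
    and eta: "2 + (l0 + 3) * \<theta> + (l0 + 1) * real CARD('n) \<le> \<eta> / (l0 + 1)" and eta0: "0 \<le> \<eta>"
  shows "\<exists>K>0. \<forall>f :: nat \<Rightarrow> real^'n \<Rightarrow> 'b::euclidean_space. (\<forall>k. locally_integrable (f k)) \<longrightarrow>
    (\<forall>\<alpha>>0. wint lebesgue w {x. ennreal \<alpha> < lr_norm r (\<lambda>k. max_op V \<eta> (f k) x)}
      \<le> ennreal (K / \<alpha>) * (\<integral>\<^sup>+x. lr_norm r (\<lambda>k. ennreal (norm (f k x))) * ennreal (w x) \<partial>lebesgue))"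
proof -
  have wt: "weight w" and w: "\<And>x. 0 < w x" using Ap by (auto simp: Ap_rho_def weight_def)
  have wm [measurable]: "w \<in> borel_measurable lebesgue" using wt by (auto simp: weight_def intro: locally_integrable_measurable)
  obtain C where C: "0 < C" "ball_A1 \<theta> C w" using Ap_rho_imp_ball_A1[OF Ap] by blast
  have H: "ball_Holder \<theta> 1 C w" using C by (intro ball_A1_imp_ball_Holder) auto
  define C' where "C' = C * cell_psi \<theta>"
  have C': "0 < C'" using C(1) cell_psi_pos[of \<theta>] by (simp add: C'_def)
  have A1: "A1_on lebesgue (local_cells N A) C' w" for N A
    unfolding C'_def using th C w by (intro ball_A1_imp_A1_on) auto
  obtain Kg where Kg: "0 < Kg" "\<And>f. (\<And>k. f k \<in> borel_measurable lebesgue) \<Longrightarrow>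
    (\<integral>\<^sup>+x. ennpowr (\<Sum>k. ennpowr (global_max \<eta> (f k) x) r) (1 / r) * ennreal (w x) \<partial>lebesgue)
    \<le> ennreal Kg * (\<integral>\<^sup>+x. ennpowr (lr_norm r (\<lambda>k. f k x)) 1 * ennreal (w x) \<partial>lebesgue)"
    using global_strong[OF r order_refl th C(1) H wm w wint_ball_finite[OF wt] eta] by blast
  define Kl where "Kl = real (CARD('n set)) * weak_const r (2 ^ CARD('n)) C' * ball_cell_ratio * real (CARD('n set)) powr (1 / r)"
  have Kl: "0 \<le> Kl"
    unfolding Kl_def using less_imp_le[OF weak_const_pos[OF r C', of "2 ^ CARD('n)"]] ball_cell_ratio_pos
    by (intro mult_nonneg_nonneg) auto
  let ?c = "2 powr (1 / r)"
  show ?thesis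
  proof (intro exI[of _ "?c * (Kl + Kg)"] conjI allI impI)
    show "0 < ?c * (Kl + Kg)" using Kl Kg(1) by simp
    fix f :: "nat \<Rightarrow> real^'n \<Rightarrow> 'b" and \<alpha> :: real assume "\<forall>k. locally_integrable (f k)" and \<alpha>: "0 < \<alpha>"
    then have f [measurable]: "f k \<in> borel_measurable lebesgue" for k by (auto intro: locally_integrable_measurable)
    define g where "g k y = ennreal (norm (f k y))" for k y
    have g [measurable]: "g k \<in> borel_measurable lebesgue" for k unfolding g_def[abs_def] by measurable
    let ?I = "\<integral>\<^sup>+x. lr_norm r (\<lambda>k. g k x) * ennreal (w x) \<partial>lebesgue"
    define Lo where "Lo x = (\<Sum>k. ennpowr (local_max (g k) x) r)" for x
    define Gl where "Gl x = (\<Sum>k. ennpowr (global_max \<eta> (g k) x) r)" for x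
    have [measurable]: "Lo \<in> borel_measurable lebesgue" "Gl \<in> borel_measurable lebesgue"
      unfolding Lo_def[abs_def] Gl_def[abs_def] by measurable
    \<comment> \<open>With \<open>2 * t powr r = \<alpha> powr r\<close> the two parts together can
      exceed \<open>\<alpha> powr r\<close> only if one of them exceeds
      \<open>t powr r\<close>.\<close>
    define t where "t = \<alpha> / ?c"
    have t: "0 < t" using \<alpha> by (simp add: t_def)
    have tr: "2 * t powr r = \<alpha> powr r" using \<alpha> r by (simp add: t_def powr_divide powr_powr)
    define E1 where "E1 = {x. ennreal (t powr r) < Lo x}"
    define E2 where "E2 = {x. ennreal t < ennpowr (Gl x) (1 / r)}"
    have E [measurable]: "E1 \<in> sets lebesgue" "E2 \<in> sets lebesgue"
    proof -
      have "{x\<in>space lebesgue. ennreal (t powr r) < Lo x} \<in> sets lebesgue"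
        "{x\<in>space lebesgue. ennreal t < ennpowr (Gl x) (1 / r)} \<in> sets lebesgue" by measurable
      then show "E1 \<in> sets lebesgue" "E2 \<in> sets lebesgue"
        unfolding E1_def E2_def by (simp_all only: space_completion space_lborel space_borel UNIV_I simp_thms)
    qed
    have sub: "x \<in> E1 \<or> x \<in> E2" if x: "ennreal \<alpha> < lr_norm r (\<lambda>k. max_op V \<eta> (f k) x)" for x
    proof (rule ccontr)
      assume n: "\<not> ?thesis"
      then have "Lo x \<le> ennreal (t powr r)" by (simp add: E1_def not_less)
      moreover have "Gl x \<le> ennreal (t powr r)"
      proof -
        have "ennpowr (Gl x) (1 / r) \<le> ennreal t" using n by (simp add: E2_def not_less)
        then have "Gl x \<le> ennpowr (ennreal t) (1 / (1 / r))" using r by (subst (asm) ennpowr_le_iff) auto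
        then show ?thesis using t by (simp add: ennpowr_ennreal)
      qed
      ultimately have "(\<Sum>k. ennpowr (max_op V \<eta> (f k) x) r) \<le> ennreal (t powr r) + ennreal (t powr r)"
        using suminf_max_op_le[OF eta0, of r f x] r unfolding Lo_def Gl_def g_def
        by (meson add_mono order_trans less_trans zero_less_one)
      also have "\<dots> = ennpowr (ennreal \<alpha>) r"
        using \<alpha> tr by (simp add: ennpowr_ennreal flip: ennreal_plus)
      finally have "ennpowr (lr_norm r (\<lambda>k. max_op V \<eta> (f k) x)) r \<le> ennpowr (ennreal \<alpha>) r" using r by simp
      then have "lr_norm r (\<lambda>k. max_op V \<eta> (f k) x) \<le> ennreal \<alpha>" using r by (subst (asm) ennpowr_mono_iff) auto
      then show False using x by simp
    qed
    have "wint lebesgue w {x. ennreal \<alpha> < lr_norm r (\<lambda>k. max_op V \<eta> (f k) x)}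
      \<le> (\<integral>\<^sup>+x. ennreal (w x) * indicator E1 x + ennreal (w x) * indicator E2 x \<partial>lebesgue)"
      unfolding wint_def using sub
      by (intro nn_integral_mono) (auto simp: indicator_def intro: add_increasing2)
    also have "\<dots> = wint lebesgue w E1 + wint lebesgue w E2"
      unfolding wint_def by (rule nn_integral_add) measurable
    also have "\<dots> \<le> ennreal (Kl / t) * ?I + ennreal (Kg / t) * ?I"
    proof (rule add_mono)
      show "wint lebesgue w E1 \<le> ennreal (Kl / t) * ?I"
        unfolding E1_def Lo_def Kl_def using r C' t w A1 by (intro local_weak) auto
      have "wint lebesgue w E2 \<le> ennreal (t powr (- 1)) * (\<integral>\<^sup>+x. ennpowr (ennpowr (Gl x) (1 / r)) 1 * ennreal (w x) \<partial>lebesgue)"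
        unfolding E2_def using t by (intro Chebyshev_wint) auto
      also have "\<dots> \<le> ennreal (t powr (- 1)) * (ennreal Kg * ?I)"
        using Kg(2)[of g] g unfolding Gl_def by (intro mult_left_mono) auto
      also have "\<dots> = ennreal (Kg / t) * ?I"
        using t Kg(1) by (simp add: powr_minus mult.assoc[symmetric] field_simps flip: ennreal_mult)
      finally show "wint lebesgue w E2 \<le> ennreal (Kg / t) * ?I" .
    qed
    also have "\<dots> = ennreal (Kl / t + Kg / t) * ?I"
      using Kl Kg(1) t by (simp add: distrib_right)
    also have "Kl / t + Kg / t = ?c * (Kl + Kg) / \<alpha>" by (simp add: t_def add_divide_distrib distrib_left distrib_right mult.commute)
    finally show "wint lebesgue w {x. ennreal \<alpha> < lr_norm r (\<lambda>k. max_op V \<eta> (f k) x)}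
      \<le> ennreal (?c * (Kl + Kg) / \<alpha>) * (\<integral>\<^sup>+x. lr_norm r (\<lambda>k. ennreal (norm (f k x))) * ennreal (w x) \<partial>lebesgue)"
      unfolding g_def .
  qed
qed

end

text \<open>As \<open>p\<close> and the conjugate exponent are at least 1,
  \<open>\<eta> / (l0 + 1)\<close> is at least
  \<open>8 * (l0 + 1) * (3 * \<theta> + n + (l0 + 1) * n)\<close>: four of the five powers of
  \<open>l0 + 1\<close> survive the division, of which one is kept and three are estimated by 1. The
  required exponent is compared with this term by term.\<close>

lemma exponent_large_enough:
  fixes l0 r p \<theta> n :: real
  assumes "0 < l0" "1 < r" "0 < \<theta>" "1 \<le> p" "3 \<le> n"
    and p0: "p0 = 4 * (l0 + 1) ^ 5 * (p + conj_exponent ((r + 1) / 2))"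
    and th0: "\<theta>0 = p * ((3 * \<theta> + n) * p + (l0 + 1) * n)"
    and eta: "\<eta> = p0 * \<theta>0"
  shows "2 + (l0 + 3) * \<theta> + (l0 + 1) * n \<le> \<eta> / (l0 + 1)" "0 \<le> \<eta>"
proof -
  have "1 \<le> conj_exponent ((r + 1) / 2)"
    using assms(2) by (simp add: conj_exponent_def field_simps)
  then have s: "2 \<le> p + conj_exponent ((r + 1) / 2)" using assms(4) by linarith
  have a: "3 * \<theta> + n \<le> (3 * \<theta> + n) * p" using assms by (simp add: mult_le_cancel_left1)
  have b: "3 * \<theta> + n + (l0 + 1) * n \<le> \<theta>0"
  proof -
    have nn: "0 \<le> (3 * \<theta> + n) * p + (l0 + 1) * n" using assms by simp
    have "3 * \<theta> + n + (l0 + 1) * n \<le> (3 * \<theta> + n) * p + (l0 + 1) * n" using a by linarith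
    also have "\<dots> \<le> \<theta>0" unfolding th0 using nn assms(4) by (simp add: mult_le_cancel_right1)
    finally show ?thesis .
  qed
  have l4: "1 \<le> (l0 + 1) ^ 3" using assms(1) by (intro one_le_power) auto
  have nn0: "0 \<le> 3 * \<theta> + n + (l0 + 1) * n" using assms by simp
  have "8 * (l0 + 1) * (3 * \<theta> + n + (l0 + 1) * n) = 4 * (l0 + 1) * 1 * 2 * (3 * \<theta> + n + (l0 + 1) * n)" by simp
  also have "\<dots> \<le> 4 * (l0 + 1) * (l0 + 1) ^ 3 * (p + conj_exponent ((r + 1) / 2)) * \<theta>0"
    using l4 s b nn0 assms(1) by (intro mult_mono) auto
  also have "\<dots> = \<eta> / (l0 + 1)"
    using assms(1) unfolding eta p0 by (simp add: power_numeral_reduce mult_ac)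
  finally have le: "8 * (l0 + 1) * (3 * \<theta> + n + (l0 + 1) * n) \<le> \<eta> / (l0 + 1)" .
  have "(l0 + 3) * \<theta> \<le> 8 * (l0 + 1) * (3 * \<theta>)"
    using assms(1,3) by (simp add: algebra_simps)
  moreover have "2 + (l0 + 1) * n \<le> 8 * (l0 + 1) * (n + (l0 + 1) * n)"
  proof -
    define m where "m = (l0 + 1) * n"
    have "0 \<le> m" using assms(1,5) by (simp add: m_def)
    then have "2 + m \<le> 8 * 1 * (n + m)" using assms(5) by simp
    then have "2 + (l0 + 1) * n \<le> 8 * 1 * (n + (l0 + 1) * n)" unfolding m_def .
    also have "\<dots> \<le> 8 * (l0 + 1) * (n + (l0 + 1) * n)" using assms(1,5) by (intro mult_right_mono) auto
    finally show ?thesis .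
  qed
  ultimately show "2 + (l0 + 3) * \<theta> + (l0 + 1) * n \<le> \<eta> / (l0 + 1)"
    using le by (simp add: algebra_simps)
  moreover have "0 \<le> 2 + (l0 + 3) * \<theta> + (l0 + 1) * n" using assms by simp
  ultimately have "0 \<le> \<eta> / (l0 + 1)" by linarith
  then show "0 \<le> \<eta>" using assms(1) by (simp add: zero_le_divide_iff)
qed

theorem theorem2p1:
  fixes V \<omega> :: "real^'n \<Rightarrow> real" and l0 C0 r \<theta> p p0 \<theta>0 \<eta> :: real
  assumes "3 \<le> CARD('n)"
    and "reverse_Holder (real CARD('n) / 2) V"
    and "\<not> (AE x in lebesgue. V x = 0)"
    and "slow_variation V l0 C0"
    and "1 < r" and "0 < \<theta>" and "1 \<le> p"
    and "p0 = 4 * (l0 + 1) ^ 5 * (p + conj_exponent ((r + 1) / 2))"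
    and "\<theta>0 = p * ((3 * \<theta> + real CARD('n)) * p + (l0 + 1) * real CARD('n))"
    and "\<eta> = p0 * \<theta>0"
    and "Ap_rho V \<theta> p \<omega>"
  shows
    "(\<exists>C>0. \<forall>f :: nat \<Rightarrow> real^'n \<Rightarrow> 'b::{real_normed_field, euclidean_space}.
        (\<forall>k. locally_integrable (f k)) \<longrightarrow>
        (\<forall>\<alpha>>0.
          (\<integral>\<^sup>+x\<in>{x. ennreal \<alpha> < lr_norm r (\<lambda>k. max_op V \<eta> (f k) x)}. ennreal (\<omega> x) \<partial>lebesgue)
          \<le> ennreal (C * \<alpha> powr (- p)) *
             (\<integral>\<^sup>+x. ennpowr (lr_norm r (\<lambda>k. ennreal (norm (f k x)))) p * ennreal (\<omega> x) \<partial>lebesgue)))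
     \<and>
     (1 < p \<longrightarrow>
      (\<exists>C>0. \<forall>f :: nat \<Rightarrow> real^'n \<Rightarrow> 'b.
        (\<forall>k. locally_integrable (f k)) \<longrightarrow>
          (\<integral>\<^sup>+x. ennpowr (lr_norm r (\<lambda>k. max_op V \<eta> (f k) x)) p * ennreal (\<omega> x) \<partial>lebesgue)
          \<le> ennreal C *
             (\<integral>\<^sup>+x. ennpowr (lr_norm r (\<lambda>k. ennreal (norm (f k x)))) p * ennreal (\<omega> x) \<partial>lebesgue)))"
proof -
  have l0: "0 < l0" using assms(4) by (simp add: slow_variation_def)
  have "0 < crit_radius V x" for x
    using crit_radius_positive[OF assms(1) refl assms(2,3)] .
  then interpret slowly_varying "crit_radius V" l0 C0
    using assms(4) by (intro slowly_varying_crit_radius)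
  interpret critical_weight V l0 C0 ..
  have n: "3 \<le> real CARD('n)" using assms(1) by simp
  note eta = exponent_large_enough[OF l0 assms(5,6,7) n assms(8,9,10)]
  have th: "0 \<le> \<theta>" using assms(6) by simp
  let ?I = "\<lambda>f :: nat \<Rightarrow> real^'n \<Rightarrow> 'b. \<integral>\<^sup>+x. ennpowr (lr_norm r (\<lambda>k. ennreal (norm (f k x)))) p * ennreal (\<omega> x) \<partial>lebesgue"
  have strong: "1 < p \<Longrightarrow> (\<exists>C>0. \<forall>f :: nat \<Rightarrow> real^'n \<Rightarrow> 'b.
        (\<forall>k. locally_integrable (f k)) \<longrightarrow>
          (\<integral>\<^sup>+x. ennpowr (lr_norm r (\<lambda>k. max_op V \<eta> (f k) x)) p * ennreal (\<omega> x) \<partial>lebesgue)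
          \<le> ennreal C * ?I f)"
    by (rule max_op_strong[OF assms(5) _ th assms(11) eta])
  moreover have "\<exists>C>0. \<forall>f :: nat \<Rightarrow> real^'n \<Rightarrow> 'b. (\<forall>k. locally_integrable (f k)) \<longrightarrow>
        (\<forall>\<alpha>>0. wint lebesgue \<omega> {x. ennreal \<alpha> < lr_norm r (\<lambda>k. max_op V \<eta> (f k) x)} \<le> ennreal (C * \<alpha> powr (- p)) * ?I f)"
  \<comment> \<open>Only \<open>p = 1\<close> calls for the separate weak bound; for
    \<open>p > 1\<close> Chebyshev's inequality derives it from the strong one.\<close>
  proof (cases "p = 1")
    case True
    then obtain K where K: "0 < K" "\<And>f :: nat \<Rightarrow> real^'n \<Rightarrow> 'b. (\<And>k. locally_integrable (f k)) \<Longrightarrow>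
      (\<forall>\<alpha>>0. wint lebesgue \<omega> {x. ennreal \<alpha> < lr_norm r (\<lambda>k. max_op V \<eta> (f k) x)}
      \<le> ennreal (K / \<alpha>) * (\<integral>\<^sup>+x. lr_norm r (\<lambda>k. ennreal (norm (f k x))) * ennreal (\<omega> x) \<partial>lebesgue))"
      using max_op_weak[OF assms(5) th _ eta, of \<omega>, where 'b = 'b] assms(11) by blast
    have "K * \<alpha> powr (- 1) = K / \<alpha>" if "0 < \<alpha>" for \<alpha> :: real using that by (simp add: powr_minus field_simps)
    then show ?thesis using K True by (intro exI[of _ K]) simp
  next
    case False
    then have p: "1 < p" using assms(7) by simp
    obtain K where K: "0 < K" "\<And>f :: nat \<Rightarrow> real^'n \<Rightarrow> 'b. (\<forall>k. locally_integrable (f k)) \<Longrightarrow>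
      (\<integral>\<^sup>+x. ennpowr (lr_norm r (\<lambda>k. max_op V \<eta> (f k) x)) p * ennreal (\<omega> x) \<partial>lebesgue) \<le> ennreal K * ?I f"
      using strong[OF p] by blast
    have wm [measurable]: "\<omega> \<in> borel_measurable lebesgue"
      using assms(11) by (auto simp: Ap_rho_def weight_def intro: locally_integrable_measurable)
    show ?thesis
    proof (intro exI[of _ K] conjI allI impI)
      show "0 < K" by (rule K)
      fix f :: "nat \<Rightarrow> real^'n \<Rightarrow> 'b" and \<alpha> :: real assume f: "\<forall>k. locally_integrable (f k)" and \<alpha>: "0 < \<alpha>"
      have "wint lebesgue \<omega> {x. ennreal \<alpha> < lr_norm r (\<lambda>k. max_op V \<eta> (f k) x)}
        \<le> ennreal (\<alpha> powr (- p)) * (\<integral>\<^sup>+x. ennpowr (lr_norm r (\<lambda>k. max_op V \<eta> (f k) x)) p * ennreal (\<omega> x) \<partial>lebesgue)"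
        using p \<alpha> by (intro Chebyshev_wint) auto
      also have "\<dots> \<le> ennreal (\<alpha> powr (- p)) * (ennreal K * ?I f)"
        using K(2)[OF f] by (rule mult_left_mono) simp
      also have "\<dots> = ennreal (K * \<alpha> powr (- p)) * ?I f"
        using K(1) by (simp add: ennreal_mult mult_ac)
      finally show "wint lebesgue \<omega> {x. ennreal \<alpha> < lr_norm r (\<lambda>k. max_op V \<eta> (f k) x)} \<le> ennreal (K * \<alpha> powr (- p)) * ?I f" .
    qed
  qed
  ultimately show ?thesis unfolding wint_def by blast
qed

end
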